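(* Let $\mathcal{B}$ be a Grothendieck topology and let $G:\mathcal{B}\to Cat$ be a contravariant pseudo functor from $\mathcal{B}$ to the 2-category of small categories. Then $G$ is a stack if and only if it is a Giraud stack.
   Context: Grothendieck topology. Here this means a category $\mathcal{B}$ with pullbacks together with a function $K$ assigning to each object $B$ a collection $K(B)$ of families of morphisms with codomain $B$ ("Grothendieck covers") such that: (1) $\{g\}\in K(B)$ for every isomorphism $g:B'\to B$; (2) if $\{g_i:B_i\to B\}_{i\in I}\in K(B)$ and $g:D\to B$ is any morphism, then the family of pullbacks $\{B_i\times_B D\to D\}_{i\in I}$ is in $K(D)$; (3) if $\{g_i:B_i\to B\}_{i\in I}\in K(B)$ and $\{f_{ij}:D_{ij}\to B_i\}_{j\in J_i}\in K(B_i)$ for all $i$, then $\{g_i\circ f_{ij}\}_{i,j}\in K(B)$. Notation. Pseudo functors and pseudo natural transformations have invertible coherence 2-cells. For the contravariant pseudo functor $G$ write $\gamma^G_{p,q}:G(p)\circ G(q)\Rightarrow G(q\circ p)$ for its composition coherence isomorphisms. For a cover $\{g_i:B_i\to B\}_{i\in I}$, let $B_{ij}=B_i\times_B B_j$ with projections $\pi^1_{ij}$ to $B_i$ and $\pi^2_{ij}$ to $B_j$; let $B_{ijk}=B_i\times_BB_j\times_BB_k$ with projections $\pi^{12}_{ijk},\pi^{13}_{ijk},\pi^{23}_{ijk}$ to $B_{ij},B_{ik},B_{jk}$. The pseudo functor $F$ of a cover. Let $\mathcal{J}$ be the category with objects $X,Y,Z$ generated by arrows $f_1,f_2:X\to Y$,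 $f_{12},f_{13},f_{23}:Y\to Z$ subject to $f_{12}f_1=f_{13}f_1$, $f_{13}f_2=f_{23}f_2$, $f_{23}f_1=f_{12}f_2$. Define a pseudo functor $F:\mathcal{J}\to Cat$ by $F(X)=\prod_iG(B_i)$, $F(Y)=\prod_{i,j}G(B_{ij})$, $F(Z)=\prod_{i,j,k}G(B_{ijk})$; on objects (similarly on morphisms) $F(f_1)(\{a_l\})_{ij}=G(\pi^1_{ij})a_i$, $F(f_2)(\{a_l\})_{ij}=G(\pi^2_{ij})a_j$, $F(f_{12})(\{a_{lm}\})_{ijk}=G(\pi^{12}_{ijk})a_{ij}$, $F(f_{13})(\{a_{lm}\})_{ijk}=G(\pi^{13}_{ijk})a_{ik}$, $F(f_{23})(\{a_{lm}\})_{ijk}=G(\pi^{23}_{ijk})a_{jk}$, $F(f_{12}f_1)(\{a_l\})_{ijk}=G(\pi^1_{ij}\pi^{12}_{ijk})a_i$, $F(f_{13}f_2)(\{a_l\})_{ijk}=G(\pi^2_{ik}\pi^{13}_{ijk})a_k$, $F(f_{23}f_1)(\{a_l\})_{ijk}=G(\pi^1_{jk}\pi^{23}_{ijk})a_j$. $F$ strictly preserves identities; its coherence isomorphisms are identities whenever an identity arrow is involved, and otherwise are tuples of components of $\gamma^G$. The pseudo cone $\pi':\Delta_{G(B)}\Rightarrow F$ has components $\pi'_X(a)=\{G(g_i)a\}_i$, $\pi'_Y(a)=\{G(g_i\pi^1_{ij})a\}_{ij}$, $\pi'_Z(a)=\{G(g_i\pi^1_{ij}\pi^{12}_{ijk})a\}_{ijk}$,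 with coherence isomorphisms the identities for identity arrows of $\mathcal{J}$ and the tuples of components of $\gamma^G$ for the other arrows. Bilimit. For a pseudo functor $F:\mathcal{J}\to\mathcal{C}$, an object $W$ with a pseudo natural transformation $\pi:\Delta_W\Rightarrow F$ is a bilimit of $F$ if for every object $C$ the functor $(\pi\circ):Mor_{\mathcal{C}}(C,W)\to PseudoCone(C,F)$ is an equivalence of categories, where $PseudoCone(C,F)$ has as objects the pseudo natural transformations $\Delta_C\Rightarrow F$ and as morphisms the modifications. Stack. $G$ is a stack (of categories) if for every object $B$ and every cover in $K(B)$, $G(B)$ with the pseudo cone $\pi'$ is a bilimit of the pseudo functor $F$ of the cover. Giraud stack. The category $G(\{B_i\to B\}_i)$ of descent data has as objects the $\{a_i\}_i\in\prod_iG(B_i)$ with isomorphisms $\phi_{ij}:G(\pi^2_{ij})a_j\to G(\pi^1_{ij})a_i$ in $G(B_{ij})$ satisfying the cocycle condition $G(\pi^{13}_{ijk})\phi_{ik}=G(\pi^{12}_{ijk})\phi_{ij}\circ G(\pi^{23}_{ijk})\phi_{jk}$ in $G(B_{ijk})$ after inserting the coherence isomorphisms $\gamma^G$ identifying $G(\pi^{23}_{ijk})G(\pi^2_{jk})a_k\cong G(\pi^{13}_{ijk})G(\pi^2_{ik})a_k$, $G(\pi^{23}_{ijk})G(\pi^1_{jk})a_j\cong G(\pi^{12}_{ijk})G(\pi^2_{ij})a_j$ and $G(\pi^{12}_{ijk})G(\pi^1_{ij})a_i\cong G(\pi^{13}_{ijk})G(\pi^1_{ik})a_i$. Its morphisms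 are the $\{\xi_i\}_i:\{a_i\}_i\to\{a'_i\}_i$ in $\prod_iG(B_i)$ with $G(\pi^1_{ij})\xi_i\circ\phi_{ij}=\phi'_{ij}\circ G(\pi^2_{ij})\xi_j$. There is a functor $G(B)\to G(\{B_i\to B\}_i)$, $a\mapsto\{G(g_i)a\}_i$ with $\phi_{ij}=(\gamma^G_{\pi^1_{ij},g_i}a)^{-1}\circ\gamma^G_{\pi^2_{ij},g_j}a$. $G$ is a Giraud stack if this functor is an equivalence of categories for every object $B$ and every cover of $B$. *)

theory Defs
  imports Main "HOL-Library.FuncSet"
begin

section \<open>Categories, functors and natural transformations\<close>

text \<open>
  Maps out of the carrier of a category (object maps, arrow maps, families of components) are
  required to be \<^const>\<open>extensional\<close>, so that equality in HOL is equality of the mathematical maps.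
\<close>

record ('o, 'm) cat =
  Ob :: "'o set"
  Ar :: "'m set"
  Dom :: "'m \<Rightarrow> 'o"
  Cod :: "'m \<Rightarrow> 'o"
  Idt :: "'o \<Rightarrow> 'm"
  Comp :: "'m \<Rightarrow> 'm \<Rightarrow> 'm" (infixr "\<cdot>\<index>" 70)  \<comment> \<open>\<open>g \<cdot> f\<close> is \<open>g\<close> after \<open>f\<close>\<close>

definition hom :: "('o, 'm) cat \<Rightarrow> 'o \<Rightarrow> 'o \<Rightarrow> 'm set" where
  "hom C a b = {f \<in> Ar C. Dom C f = a \<and> Cod C f = b}"

locale category =
  fixes C :: "('o, 'm) cat" (structure)
  assumes Dom_in: "f \<in> Ar C \<Longrightarrow> Dom C f \<in> Ob C"
    and Cod_in: "f \<in> Ar C \<Longrightarrow> Cod C f \<in> Ob C"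
    and Idt_in: "a \<in> Ob C \<Longrightarrow> Idt C a \<in> hom C a a"
    and Comp_in: "\<lbrakk>f \<in> hom C a b; g \<in> hom C b c\<rbrakk> \<Longrightarrow> g \<cdot> f \<in> hom C a c"
    and Idt_left: "f \<in> hom C a b \<Longrightarrow> Idt C b \<cdot> f = f"
    and Idt_right: "f \<in> hom C a b \<Longrightarrow> f \<cdot> Idt C a = f"
    and Comp_assoc: "\<lbrakk>f \<in> hom C a b; g \<in> hom C b c; h \<in> hom C c d\<rbrakk> \<Longrightarrow> (h \<cdot> g) \<cdot> f = h \<cdot> (g \<cdot> f)"

definition inverse_arrows :: "('o, 'm) cat \<Rightarrow> 'm \<Rightarrow> 'm \<Rightarrow> bool" where
  "inverse_arrows C f g \<longleftrightarrow> f \<in> Ar C \<and> g \<in> hom C (Cod C f) (Dom C f) \<and>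
     g \<cdot>\<^bsub>C\<^esub> f = Idt C (Dom C f) \<and> f \<cdot>\<^bsub>C\<^esub> g = Idt C (Cod C f)"

definition is_iso :: "('o, 'm) cat \<Rightarrow> 'm \<Rightarrow> bool" where
  "is_iso C f \<longleftrightarrow> (\<exists>g. inverse_arrows C f g)"

definition inv_arrow :: "('o, 'm) cat \<Rightarrow> 'm \<Rightarrow> 'm" where
  "inv_arrow C f = (THE g. inverse_arrows C f g)"

definition dual :: "('o, 'm) cat \<Rightarrow> ('o, 'm) cat" where
  "dual C = \<lparr>Ob = Ob C, Ar = Ar C, Dom = Cod C, Cod = Dom C, Idt = Idt C,
     Comp = (\<lambda>g f. f \<cdot>\<^bsub>C\<^esub> g)\<rparr>"

definition prod_cat :: "'s set \<Rightarrow> ('s \<Rightarrow> ('o, 'm) cat) \<Rightarrow> ('s \<Rightarrow> 'o, 's \<Rightarrow> 'm) cat" where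
  "prod_cat S C = \<lparr>Ob = (\<Pi>\<^sub>E s\<in>S. Ob (C s)), Ar = (\<Pi>\<^sub>E s\<in>S. Ar (C s)),
     Dom = (\<lambda>f. \<lambda>s\<in>S. Dom (C s) (f s)), Cod = (\<lambda>f. \<lambda>s\<in>S. Cod (C s) (f s)),
     Idt = (\<lambda>a. \<lambda>s\<in>S. Idt (C s) (a s)), Comp = (\<lambda>g f. \<lambda>s\<in>S. g s \<cdot>\<^bsub>C s\<^esub> f s)\<rparr>"

record ('o1, 'm1, 'o2, 'm2) fctr =
  fob :: "'o1 \<Rightarrow> 'o2"
  far :: "'m1 \<Rightarrow> 'm2"

definition is_functor ::
  "('o1, 'm1) cat \<Rightarrow> ('o2, 'm2) cat \<Rightarrow> ('o1, 'm1, 'o2, 'm2) fctr \<Rightarrow> bool" where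
  "is_functor C D T \<longleftrightarrow> category C \<and> category D \<and>
     fob T \<in> Ob C \<rightarrow>\<^sub>E Ob D \<and> far T \<in> Ar C \<rightarrow>\<^sub>E Ar D \<and>
     (\<forall>f \<in> Ar C. Dom D (far T f) = fob T (Dom C f) \<and> Cod D (far T f) = fob T (Cod C f)) \<and>
     (\<forall>a \<in> Ob C. far T (Idt C a) = Idt D (fob T a)) \<and>
     (\<forall>f \<in> Ar C. \<forall>g \<in> Ar C. Dom C g = Cod C f \<longrightarrow>
        far T (g \<cdot>\<^bsub>C\<^esub> f) = far T g \<cdot>\<^bsub>D\<^esub> far T f)"

definition id_fctr :: "('o, 'm) cat \<Rightarrow> ('o, 'm, 'o, 'm) fctr" where
  "id_fctr C = \<lparr>fob = (\<lambda>a\<in>Ob C. a), far = (\<lambda>f\<in>Ar C. f)\<rparr>"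

text \<open>\<open>comp_fctr C T S\<close> is \<open>T\<close> after \<open>S\<close>, where \<open>C\<close> is the domain of \<open>S\<close>.\<close>

definition comp_fctr ::
  "('o1, 'm1) cat \<Rightarrow> ('o2, 'm2, 'o3, 'm3) fctr \<Rightarrow> ('o1, 'm1, 'o2, 'm2) fctr
    \<Rightarrow> ('o1, 'm1, 'o3, 'm3) fctr" where
  "comp_fctr C T S =
     \<lparr>fob = (\<lambda>a\<in>Ob C. fob T (fob S a)), far = (\<lambda>f\<in>Ar C. far T (far S f))\<rparr>"

definition is_natural ::
  "('o1, 'm1) cat \<Rightarrow> ('o2, 'm2) cat \<Rightarrow> ('o1, 'm1, 'o2, 'm2) fctr \<Rightarrow> ('o1, 'm1, 'o2, 'm2) fctr
    \<Rightarrow> ('o1 \<Rightarrow> 'm2) \<Rightarrow> bool" where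
  "is_natural C D S T \<tau> \<longleftrightarrow> is_functor C D S \<and> is_functor C D T \<and>
     \<tau> \<in> extensional (Ob C) \<and> (\<forall>a \<in> Ob C. \<tau> a \<in> hom D (fob S a) (fob T a)) \<and>
     (\<forall>f \<in> Ar C. far T f \<cdot>\<^bsub>D\<^esub> \<tau> (Dom C f) = \<tau> (Cod C f) \<cdot>\<^bsub>D\<^esub> far S f)"

definition is_natural_iso ::
  "('o1, 'm1) cat \<Rightarrow> ('o2, 'm2) cat \<Rightarrow> ('o1, 'm1, 'o2, 'm2) fctr \<Rightarrow> ('o1, 'm1, 'o2, 'm2) fctr
    \<Rightarrow> ('o1 \<Rightarrow> 'm2) \<Rightarrow> bool" where
  "is_natural_iso C D S T \<tau> \<longleftrightarrow> is_natural C D S T \<tau> \<and> (\<forall>a \<in> Ob C. is_iso D (\<tau> a))"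

definition is_equivalence ::
  "('o1, 'm1) cat \<Rightarrow> ('o2, 'm2) cat \<Rightarrow> ('o1, 'm1, 'o2, 'm2) fctr \<Rightarrow> bool" where
  "is_equivalence C D T \<longleftrightarrow> is_functor C D T \<and>
     (\<exists>S. is_functor D C S \<and>
       (\<exists>\<eta>. is_natural_iso C C (id_fctr C) (comp_fctr C S T) \<eta>) \<and>
       (\<exists>\<epsilon>. is_natural_iso D D (comp_fctr D T S) (id_fctr D) \<epsilon>))"

text \<open>The hom-category \<open>Mor(C, D)\<close> of \<open>Cat\<close>. Its arrows carry their source and target.\<close>

definition functor_cat ::
  "('o1, 'm1) cat \<Rightarrow> ('o2, 'm2) cat \<Rightarrow>
    (('o1, 'm1, 'o2, 'm2) fctr,
     ('o1, 'm1, 'o2, 'm2) fctr \<times> ('o1 \<Rightarrow> 'm2) \<times> ('o1, 'm1, 'o2, 'm2) fctr) cat" where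
  "functor_cat C D =
     \<lparr>Ob = {S. is_functor C D S},
      Ar = {(S, \<tau>, T). is_natural C D S T \<tau>},
      Dom = (\<lambda>(S, \<tau>, T). S),
      Cod = (\<lambda>(S, \<tau>, T). T),
      Idt = (\<lambda>S. (S, \<lambda>a\<in>Ob C. Idt D (fob S a), S)),
      Comp = (\<lambda>(_, \<sigma>, U) (S, \<tau>, _). (S, \<lambda>a\<in>Ob C. \<sigma> a \<cdot>\<^bsub>D\<^esub> \<tau> a, U))\<rparr>"


section \<open>Pseudo functors to \<open>Cat\<close>\<close>

text \<open>
  A pseudo functor from a category to the 2-category of categories: \<open>PC P p q\<close> is the family of
  components of the composition coherence \<open>P(p) P(q) \<Rightarrow> P(pq)\<close>, and \<open>PU P d\<close> that of the unit
  coherence \<open>Id \<Rightarrow> P(id\<^sub>d)\<close>.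
\<close>

record ('d, 'f, 'o, 'm) pfctr =
  PO :: "'d \<Rightarrow> ('o, 'm) cat"
  PM :: "'f \<Rightarrow> ('o, 'm, 'o, 'm) fctr"
  PC :: "'f \<Rightarrow> 'f \<Rightarrow> 'o \<Rightarrow> 'm"
  PU :: "'d \<Rightarrow> 'o \<Rightarrow> 'm"

locale pseudo_functor = D: category D
  for D :: "('d, 'f) cat" (structure) +
  fixes P :: "('d, 'f, 'o, 'm) pfctr"
  assumes PO_category: "d \<in> Ob D \<Longrightarrow> category (PO P d)"
    and PM_functor: "p \<in> hom D d e \<Longrightarrow> is_functor (PO P d) (PO P e) (PM P p)"
    and PC_natural_iso: "\<lbrakk>q \<in> hom D c d; p \<in> hom D d e\<rbrakk> \<Longrightarrow>
      is_natural_iso (PO P c) (PO P e) (comp_fctr (PO P c) (PM P p) (PM P q)) (PM P (p \<cdot> q))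
        (PC P p q)"
    and PU_natural_iso: "d \<in> Ob D \<Longrightarrow>
      is_natural_iso (PO P d) (PO P d) (id_fctr (PO P d)) (PM P (Idt D d)) (PU P d)"
    and PC_assoc: "\<lbrakk>r \<in> hom D b c; q \<in> hom D c d; p \<in> hom D d e; a \<in> Ob (PO P b)\<rbrakk> \<Longrightarrow>
      PC P p (q \<cdot> r) a \<cdot>\<^bsub>PO P e\<^esub> far (PM P p) (PC P q r a)
        = PC P (p \<cdot> q) r a \<cdot>\<^bsub>PO P e\<^esub> PC P p q (fob (PM P r) a)"
    and PC_Idt_right: "\<lbrakk>p \<in> hom D d e; a \<in> Ob (PO P d)\<rbrakk> \<Longrightarrow>
      PC P p (Idt D d) a \<cdot>\<^bsub>PO P e\<^esub> far (PM P p) (PU P d a) = Idt (PO P e) (fob (PM P p) a)"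
    and PC_Idt_left: "\<lbrakk>p \<in> hom D d e; a \<in> Ob (PO P d)\<rbrakk> \<Longrightarrow>
      PC P (Idt D e) p a \<cdot>\<^bsub>PO P e\<^esub> PU P e (fob (PM P p) a) = Idt (PO P e) (fob (PM P p) a)"

text \<open>
  With composition in the dual, \<open>PC G p q\<close> is \<open>\<gamma>\<^sub>p\<^sub>,\<^sub>q : G(p) G(q) \<Rightarrow> G(qp)\<close>.
\<close>

definition contravariant_pseudo_functor :: "('b, 'f) cat \<Rightarrow> ('b, 'f, 'o, 'm) pfctr \<Rightarrow> bool" where
  "contravariant_pseudo_functor \<B> G \<longleftrightarrow> category \<B> \<and> pseudo_functor (dual \<B>) G"

text \<open>The constant pseudo functor \<open>\<Delta>\<^sub>C\<close>.\<close>

definition const_pf :: "('o, 'm) cat \<Rightarrow> ('d, 'f, 'o, 'm) pfctr" where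
  "const_pf C = \<lparr>PO = (\<lambda>_. C), PM = (\<lambda>_. id_fctr C), PC = (\<lambda>_ _. \<lambda>a\<in>Ob C. Idt C a),
     PU = (\<lambda>_. \<lambda>a\<in>Ob C. Idt C a)\<rparr>"

text \<open>
  A pseudo natural transformation \<open>\<alpha> : P \<Rightarrow> Q\<close> has functors \<open>TO \<alpha> d : P(d) \<rightarrow> Q(d)\<close> and, for
  \<open>f : d \<rightarrow> e\<close>, an invertible 2-cell \<open>TC \<alpha> f : Q(f) \<alpha>\<^sub>d \<Rightarrow> \<alpha>\<^sub>e P(f)\<close>. The categories in the values of
  \<open>P\<close> and \<open>Q\<close> may have different types.
\<close>

record ('d, 'f, 'o1, 'm1, 'o2, 'm2) ptrans =
  TO :: "'d \<Rightarrow> ('o1, 'm1, 'o2, 'm2) fctr"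
  TC :: "'f \<Rightarrow> 'o1 \<Rightarrow> 'm2"

locale pseudo_natural =
  D: category D + P: pseudo_functor D P + Q: pseudo_functor D Q
  for D :: "('d, 'f) cat" (structure)
    and P :: "('d, 'f, 'o1, 'm1) pfctr" and Q :: "('d, 'f, 'o2, 'm2) pfctr" +
  fixes \<alpha> :: "('d, 'f, 'o1, 'm1, 'o2, 'm2) ptrans"
  assumes TO_extensional: "TO \<alpha> \<in> extensional (Ob D)"
    and TC_extensional: "TC \<alpha> \<in> extensional (Ar D)"
    and TO_functor: "d \<in> Ob D \<Longrightarrow> is_functor (PO P d) (PO Q d) (TO \<alpha> d)"
    and TC_natural_iso: "f \<in> hom D d e \<Longrightarrow>
      is_natural_iso (PO P d) (PO Q e)
        (comp_fctr (PO P d) (PM Q f) (TO \<alpha> d)) (comp_fctr (PO P d) (TO \<alpha> e) (PM P f)) (TC \<alpha> f)"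
    and TC_Idt: "\<lbrakk>d \<in> Ob D; a \<in> Ob (PO P d)\<rbrakk> \<Longrightarrow>
      TC \<alpha> (Idt D d) a \<cdot>\<^bsub>PO Q d\<^esub> PU Q d (fob (TO \<alpha> d) a) = far (TO \<alpha> d) (PU P d a)"
    and TC_Comp: "\<lbrakk>f \<in> hom D c d; g \<in> hom D d e; a \<in> Ob (PO P c)\<rbrakk> \<Longrightarrow>
      TC \<alpha> (g \<cdot> f) a \<cdot>\<^bsub>PO Q e\<^esub> PC Q g f (fob (TO \<alpha> c) a)
        = far (TO \<alpha> e) (PC P g f a) \<cdot>\<^bsub>PO Q e\<^esub>
          (TC \<alpha> g (fob (PM P f) a) \<cdot>\<^bsub>PO Q e\<^esub> far (PM Q g) (TC \<alpha> f a))"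

definition is_modification ::
  "('d, 'f) cat \<Rightarrow> ('d, 'f, 'o1, 'm1) pfctr \<Rightarrow> ('d, 'f, 'o2, 'm2) pfctr
    \<Rightarrow> ('d, 'f, 'o1, 'm1, 'o2, 'm2) ptrans \<Rightarrow> ('d, 'f, 'o1, 'm1, 'o2, 'm2) ptrans
    \<Rightarrow> ('d \<Rightarrow> 'o1 \<Rightarrow> 'm2) \<Rightarrow> bool" where
  "is_modification D P Q \<alpha> \<beta> \<mu> \<longleftrightarrow>
     pseudo_natural D P Q \<alpha> \<and> pseudo_natural D P Q \<beta> \<and> \<mu> \<in> extensional (Ob D) \<and>
     (\<forall>d \<in> Ob D. is_natural (PO P d) (PO Q d) (TO \<alpha> d) (TO \<beta> d) (\<mu> d)) \<and>
     (\<forall>d \<in> Ob D. \<forall>e \<in> Ob D. \<forall>f \<in> hom D d e. \<forall>a \<in> Ob (PO P d).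
        \<mu> e (fob (PM P f) a) \<cdot>\<^bsub>PO Q e\<^esub> TC \<alpha> f a
          = TC \<beta> f a \<cdot>\<^bsub>PO Q e\<^esub> far (PM Q f) (\<mu> d a))"

definition pseudo_nat_cat ::
  "('d, 'f) cat \<Rightarrow> ('d, 'f, 'o1, 'm1) pfctr \<Rightarrow> ('d, 'f, 'o2, 'm2) pfctr \<Rightarrow>
    (('d, 'f, 'o1, 'm1, 'o2, 'm2) ptrans,
     ('d, 'f, 'o1, 'm1, 'o2, 'm2) ptrans \<times> ('d \<Rightarrow> 'o1 \<Rightarrow> 'm2)
       \<times> ('d, 'f, 'o1, 'm1, 'o2, 'm2) ptrans) cat" where
  "pseudo_nat_cat D P Q =
     \<lparr>Ob = {\<alpha>. pseudo_natural D P Q \<alpha>},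
      Ar = {(\<alpha>, \<mu>, \<beta>). is_modification D P Q \<alpha> \<beta> \<mu>},
      Dom = (\<lambda>(\<alpha>, \<mu>, \<beta>). \<alpha>),
      Cod = (\<lambda>(\<alpha>, \<mu>, \<beta>). \<beta>),
      Idt = (\<lambda>\<alpha>. (\<alpha>, \<lambda>d\<in>Ob D. \<lambda>a\<in>Ob (PO P d). Idt (PO Q d) (fob (TO \<alpha> d) a), \<alpha>)),
      Comp = (\<lambda>(_, \<nu>, \<gamma>) (\<alpha>, \<mu>, _).
        (\<alpha>, \<lambda>d\<in>Ob D. \<lambda>a\<in>Ob (PO P d). \<nu> d a \<cdot>\<^bsub>PO Q d\<^esub> \<mu> d a, \<gamma>))\<rparr>"

definition pseudo_cone_cat ::
  "('d, 'f) cat \<Rightarrow> ('o1, 'm1) cat \<Rightarrow> ('d, 'f, 'o2, 'm2) pfctr \<Rightarrow>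
    (('d, 'f, 'o1, 'm1, 'o2, 'm2) ptrans,
     ('d, 'f, 'o1, 'm1, 'o2, 'm2) ptrans \<times> ('d \<Rightarrow> 'o1 \<Rightarrow> 'm2)
       \<times> ('d, 'f, 'o1, 'm1, 'o2, 'm2) ptrans) cat" where
  "pseudo_cone_cat D C F = pseudo_nat_cat D (const_pf C) F"

text \<open>The functor \<open>(\<pi> \<circ>) : Mor(C, W) \<rightarrow> PseudoCone(C, F)\<close> of a pseudo cone \<open>\<pi> : \<Delta>\<^sub>W \<Rightarrow> F\<close>.\<close>

definition cone_after ::
  "('d, 'f) cat \<Rightarrow> ('ow, 'mw) cat \<Rightarrow> ('d, 'f, 'ow, 'mw, 'o, 'm) ptrans \<Rightarrow> ('oc, 'mc) cat
    \<Rightarrow> ('oc, 'mc, 'ow, 'mw) fctr \<Rightarrow> ('d, 'f, 'oc, 'mc, 'o, 'm) ptrans" where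
  "cone_after D W \<pi> C H =
     \<lparr>TO = (\<lambda>d\<in>Ob D. comp_fctr C (TO \<pi> d) H),
      TC = (\<lambda>f\<in>Ar D. \<lambda>c\<in>Ob C. TC \<pi> f (fob H c))\<rparr>"

definition cone_functor ::
  "('d, 'f) cat \<Rightarrow> ('ow, 'mw) cat \<Rightarrow> ('d, 'f, 'ow, 'mw, 'o, 'm) ptrans \<Rightarrow> ('oc, 'mc) cat \<Rightarrow>
    (('oc, 'mc, 'ow, 'mw) fctr,
     ('oc, 'mc, 'ow, 'mw) fctr \<times> ('oc \<Rightarrow> 'mw) \<times> ('oc, 'mc, 'ow, 'mw) fctr,
     ('d, 'f, 'oc, 'mc, 'o, 'm) ptrans,
     ('d, 'f, 'oc, 'mc, 'o, 'm) ptrans \<times> ('d \<Rightarrow> 'oc \<Rightarrow> 'm) \<times> ('d, 'f, 'oc, 'mc, 'o, 'm) ptrans)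
    fctr" where
  "cone_functor D W \<pi> C =
     \<lparr>fob = (\<lambda>H\<in>Ob (functor_cat C W). cone_after D W \<pi> C H),
      far = (\<lambda>(H, \<theta>, H')\<in>Ar (functor_cat C W).
        (cone_after D W \<pi> C H, \<lambda>d\<in>Ob D. \<lambda>c\<in>Ob C. far (TO \<pi> d) (\<theta> c), cone_after D W \<pi> C H'))\<rparr>"

text \<open>
  Bilimits in \<open>Cat\<close>. HOL cannot quantify over types inside a formula, so the types of the objects
  and arrows of the test category \<open>C\<close> are a parameter of the notion, passed as a type argument.
\<close>

definition is_bilimit ::
  "('oc, 'mc) cat itself \<Rightarrow> ('d, 'f) cat \<Rightarrow> ('d, 'f, 'o, 'm) pfctr \<Rightarrow> ('ow, 'mw) cat
    \<Rightarrow> ('d, 'f, 'ow, 'mw, 'o, 'm) ptrans \<Rightarrow> bool" where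
  "is_bilimit (_ :: ('oc, 'mc) cat itself) D F W \<pi> \<longleftrightarrow>
     pseudo_functor D F \<and> category W \<and> pseudo_natural D (const_pf W) F \<pi> \<and>
     (\<forall>C :: ('oc, 'mc) cat. category C \<longrightarrow>
        is_equivalence (functor_cat C W) (pseudo_cone_cat D C F) (cone_functor D W \<pi> C))"


section \<open>Pullbacks and Grothendieck topologies\<close>

text \<open>\<open>p\<close> and \<open>q\<close> are the projections to the domains of \<open>f\<close> and \<open>g\<close>, respectively.\<close>

definition is_pullback :: "('b, 'f) cat \<Rightarrow> 'f \<Rightarrow> 'f \<Rightarrow> 'f \<Rightarrow> 'f \<Rightarrow> bool" where
  "is_pullback \<B> f g p q \<longleftrightarrow>
     f \<in> Ar \<B> \<and> g \<in> Ar \<B> \<and> Cod \<B> f = Cod \<B> g \<and>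
     p \<in> Ar \<B> \<and> q \<in> Ar \<B> \<and> Dom \<B> p = Dom \<B> q \<and> Cod \<B> p = Dom \<B> f \<and> Cod \<B> q = Dom \<B> g \<and>
     f \<cdot>\<^bsub>\<B>\<^esub> p = g \<cdot>\<^bsub>\<B>\<^esub> q \<and>
     (\<forall>u \<in> Ar \<B>. \<forall>v \<in> Ar \<B>.
        Dom \<B> u = Dom \<B> v \<and> Cod \<B> u = Dom \<B> f \<and> Cod \<B> v = Dom \<B> g \<and> f \<cdot>\<^bsub>\<B>\<^esub> u = g \<cdot>\<^bsub>\<B>\<^esub> v \<longrightarrow>
        (\<exists>!h. h \<in> hom \<B> (Dom \<B> u) (Dom \<B> p) \<and> p \<cdot>\<^bsub>\<B>\<^esub> h = u \<and> q \<cdot>\<^bsub>\<B>\<^esub> h = v))"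

definition has_pullbacks :: "('b, 'f) cat \<Rightarrow> bool" where
  "has_pullbacks \<B> \<longleftrightarrow>
     (\<forall>f \<in> Ar \<B>. \<forall>g \<in> Ar \<B>. Cod \<B> f = Cod \<B> g \<longrightarrow> (\<exists>p q. is_pullback \<B> f g p q))"

definition pb :: "('b, 'f) cat \<Rightarrow> 'f \<Rightarrow> 'f \<Rightarrow> 'f \<times> 'f" where
  "pb \<B> f g = (SOME (p, q). is_pullback \<B> f g p q)"

text \<open>
  A family of arrows is a pair \<open>(I, g)\<close> of an index set and an extensional function on it. As all
  index sets are subsets of one type \<open>'i\<close>, the singleton family in the first axiom is indexed by an
  arbitrary one-element set, and the composite family in the third axiom by an arbitrary set \<open>L\<close> in
  bijection with the set of pairs \<open>(i, j)\<close>.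
\<close>

locale grothendieck_topology = category \<B>
  for \<B> :: "('b, 'f) cat" (structure) +
  fixes K :: "'b \<Rightarrow> ('i set \<times> ('i \<Rightarrow> 'f)) set"
  assumes pullbacks: "has_pullbacks \<B>"
    and cover_family: "\<lbrakk>b \<in> Ob \<B>; (I, g) \<in> K b\<rbrakk> \<Longrightarrow> g \<in> I \<rightarrow>\<^sub>E {f \<in> Ar \<B>. Cod \<B> f = b}"
    and cover_iso: "is_iso \<B> h \<Longrightarrow> ({i}, \<lambda>_\<in>{i}. h) \<in> K (Cod \<B> h)"
    and cover_pullback: "\<lbrakk>h \<in> hom \<B> d b; b \<in> Ob \<B>; (I, g) \<in> K b;
        \<And>i. i \<in> I \<Longrightarrow> is_pullback \<B> (g i) h (p i) (q i)\<rbrakk> \<Longrightarrow> (I, \<lambda>i\<in>I. q i) \<in> K d"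
    and cover_comp: "\<lbrakk>b \<in> Ob \<B>; (I, g) \<in> K b; \<And>i. i \<in> I \<Longrightarrow> (J i, f i) \<in> K (Dom \<B> (g i));
        bij_betw e L (SIGMA i:I. J i)\<rbrakk> \<Longrightarrow>
        (L, \<lambda>l\<in>L. g (fst (e l)) \<cdot> f (fst (e l)) (snd (e l))) \<in> K b"


section \<open>Projections of the iterated fibre products of a family\<close>

text \<open>
  \<open>B\<^sub>i\<^sub>j = B\<^sub>i \<times>\<^sub>B B\<^sub>j\<close> is the domain of \<open>pi1 \<B> g i j\<close> and \<open>B\<^sub>i\<^sub>j\<^sub>k = B\<^sub>i\<^sub>j \<times>\<^sub>B B\<^sub>k\<close> that of \<open>pi12 \<B> g i j k\<close>.
\<close>

definition pi1 :: "('b, 'f) cat \<Rightarrow> ('i \<Rightarrow> 'f) \<Rightarrow> 'i \<Rightarrow> 'i \<Rightarrow> 'f" where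
  "pi1 \<B> g i j = fst (pb \<B> (g i) (g j))"

definition pi2 :: "('b, 'f) cat \<Rightarrow> ('i \<Rightarrow> 'f) \<Rightarrow> 'i \<Rightarrow> 'i \<Rightarrow> 'f" where
  "pi2 \<B> g i j = snd (pb \<B> (g i) (g j))"

definition pi12 :: "('b, 'f) cat \<Rightarrow> ('i \<Rightarrow> 'f) \<Rightarrow> 'i \<Rightarrow> 'i \<Rightarrow> 'i \<Rightarrow> 'f" where
  "pi12 \<B> g i j k = fst (pb \<B> (g i \<cdot>\<^bsub>\<B>\<^esub> pi1 \<B> g i j) (g k))"

text \<open>The projection from \<open>B\<^sub>i\<^sub>j\<^sub>k\<close> to \<open>B\<^sub>k\<close>.\<close>

definition proj3 :: "('b, 'f) cat \<Rightarrow> ('i \<Rightarrow> 'f) \<Rightarrow> 'i \<Rightarrow> 'i \<Rightarrow> 'i \<Rightarrow> 'f" where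
  "proj3 \<B> g i j k = snd (pb \<B> (g i \<cdot>\<^bsub>\<B>\<^esub> pi1 \<B> g i j) (g k))"

definition pi13 :: "('b, 'f) cat \<Rightarrow> ('i \<Rightarrow> 'f) \<Rightarrow> 'i \<Rightarrow> 'i \<Rightarrow> 'i \<Rightarrow> 'f" where
  "pi13 \<B> g i j k = (THE h. h \<in> hom \<B> (Dom \<B> (pi12 \<B> g i j k)) (Dom \<B> (pi1 \<B> g i k)) \<and>
     pi1 \<B> g i k \<cdot>\<^bsub>\<B>\<^esub> h = pi1 \<B> g i j \<cdot>\<^bsub>\<B>\<^esub> pi12 \<B> g i j k \<and>
     pi2 \<B> g i k \<cdot>\<^bsub>\<B>\<^esub> h = proj3 \<B> g i j k)"

definition pi23 :: "('b, 'f) cat \<Rightarrow> ('i \<Rightarrow> 'f) \<Rightarrow> 'i \<Rightarrow> 'i \<Rightarrow> 'i \<Rightarrow> 'f" where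
  "pi23 \<B> g i j k = (THE h. h \<in> hom \<B> (Dom \<B> (pi12 \<B> g i j k)) (Dom \<B> (pi1 \<B> g j k)) \<and>
     pi1 \<B> g j k \<cdot>\<^bsub>\<B>\<^esub> h = pi2 \<B> g i j \<cdot>\<^bsub>\<B>\<^esub> pi12 \<B> g i j k \<and>
     pi2 \<B> g j k \<cdot>\<^bsub>\<B>\<^esub> h = proj3 \<B> g i j k)"


section \<open>Stacks\<close>

datatype jobj = JX | JY | JZ

text \<open>
  The arrows of the category \<open>\<J>\<close>: three identities, the five generators, and the three composites
  that remain distinct under the relations.
\<close>

datatype jarr = IdX | IdY | IdZ | F1 | F2 | F12 | F13 | F23 | F12F1 | F13F2 | F23F1

fun jdom :: "jarr \<Rightarrow> jobj" where
  "jdom IdY = JY" | "jdom IdZ = JZ" | "jdom F12 = JY" | "jdom F13 = JY" | "jdom F23 = JY"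
| "jdom _ = JX"

fun jcod :: "jarr \<Rightarrow> jobj" where
  "jcod IdX = JX" | "jcod IdY = JY" | "jcod F1 = JY" | "jcod F2 = JY"
| "jcod _ = JZ"

primrec jid :: "jobj \<Rightarrow> jarr" where
  "jid JX = IdX" | "jid JY = IdY" | "jid JZ = IdZ"

definition jcomp :: "jarr \<Rightarrow> jarr \<Rightarrow> jarr" where
  "jcomp g f =
     (if f \<in> range jid then g
      else if g \<in> range jid then f
      else if (g, f) \<in> {(F12, F1), (F13, F1)} then F12F1
      else if (g, f) \<in> {(F13, F2), (F23, F2)} then F13F2
      else F23F1)"  \<comment> \<open>the composable pairs left are \<open>(F23, F1)\<close> and \<open>(F12, F2)\<close>\<close>

definition \<J> :: "(jobj, jarr) cat" where
  "\<J> = \<lparr>Ob = UNIV, Ar = UNIV, Dom = jdom, Cod = jcod, Idt = jid, Comp = jcomp\<rparr>"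

text \<open>
  To give \<open>F(X)\<close>, \<open>F(Y)\<close>, \<open>F(Z)\<close> a common type, the tuples of indices \<open>i\<close>, \<open>ij\<close>, \<open>ijk\<close> are encoded
  as lists of length one, two, three.
\<close>

primrec tuples :: "'i set \<Rightarrow> jobj \<Rightarrow> 'i list set" where
  "tuples I JX = {[i] |i. i \<in> I}"
| "tuples I JY = {[i, j] |i j. i \<in> I \<and> j \<in> I}"
| "tuples I JZ = {[i, j, k] |i j k. i \<in> I \<and> j \<in> I \<and> k \<in> I}"

text \<open>
  The composite of the cover with the projection of the fibre product belonging to a tuple; its
  domain is the fibre product \<open>B\<^sub>i\<close>, \<open>B\<^sub>i\<^sub>j\<close>, \<open>B\<^sub>i\<^sub>j\<^sub>k\<close>.
\<close>

fun to_base :: "('b, 'f) cat \<Rightarrow> ('i \<Rightarrow> 'f) \<Rightarrow> 'i list \<Rightarrow> 'f" where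
  "to_base \<B> g [i] = g i"
| "to_base \<B> g [i, j] = g i \<cdot>\<^bsub>\<B>\<^esub> pi1 \<B> g i j"
| "to_base \<B> g [i, j, k] = g i \<cdot>\<^bsub>\<B>\<^esub> (pi1 \<B> g i j \<cdot>\<^bsub>\<B>\<^esub> pi12 \<B> g i j k)"
| "to_base \<B> g _ = undefined"

text \<open>
  A non-identity arrow \<open>u\<close> of \<open>\<J>\<close> acts by \<open>F(u)(a)\<^sub>t = G(proj u t) a\<^sub>s\<close> with \<open>s = face u t\<close>.
\<close>

primrec face :: "jarr \<Rightarrow> 'i list \<Rightarrow> 'i list" where
  "face IdX t = t" | "face IdY t = t" | "face IdZ t = t"
| "face F1 t = [t ! 0]"
| "face F2 t = [t ! 1]"
| "face F12 t = [t ! 0, t ! 1]"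
| "face F13 t = [t ! 0, t ! 2]"
| "face F23 t = [t ! 1, t ! 2]"
| "face F12F1 t = [t ! 0]"
| "face F13F2 t = [t ! 2]"
| "face F23F1 t = [t ! 1]"

context
  fixes \<B> :: "('b, 'f) cat" (structure) and g :: "'i \<Rightarrow> 'f"
begin

primrec proj :: "jarr \<Rightarrow> 'i list \<Rightarrow> 'f" where
  "proj IdX t = Idt \<B> (Dom \<B> (to_base \<B> g t))"
| "proj IdY t = Idt \<B> (Dom \<B> (to_base \<B> g t))"
| "proj IdZ t = Idt \<B> (Dom \<B> (to_base \<B> g t))"
| "proj F1 t = pi1 \<B> g (t ! 0) (t ! 1)"
| "proj F2 t = pi2 \<B> g (t ! 0) (t ! 1)"
| "proj F12 t = pi12 \<B> g (t ! 0) (t ! 1) (t ! 2)"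
| "proj F13 t = pi13 \<B> g (t ! 0) (t ! 1) (t ! 2)"
| "proj F23 t = pi23 \<B> g (t ! 0) (t ! 1) (t ! 2)"
| "proj F12F1 t = pi1 \<B> g (t ! 0) (t ! 1) \<cdot> pi12 \<B> g (t ! 0) (t ! 1) (t ! 2)"
| "proj F13F2 t = pi2 \<B> g (t ! 0) (t ! 2) \<cdot> pi13 \<B> g (t ! 0) (t ! 1) (t ! 2)"
| "proj F23F1 t = pi1 \<B> g (t ! 1) (t ! 2) \<cdot> pi23 \<B> g (t ! 0) (t ! 1) (t ! 2)"

end

text \<open>The category \<open>G(B\<^sub>i)\<close>, \<open>G(B\<^sub>i\<^sub>j)\<close> or \<open>G(B\<^sub>i\<^sub>j\<^sub>k)\<close>, according to the tuple.\<close>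

definition fibre :: "('b, 'f) cat \<Rightarrow> ('b, 'f, 'o, 'm) pfctr \<Rightarrow> ('i \<Rightarrow> 'f) \<Rightarrow> 'i list \<Rightarrow> ('o, 'm) cat"
  where "fibre \<B> G g t = PO G (Dom \<B> (to_base \<B> g t))"

definition cover_ob :: "('b, 'f) cat \<Rightarrow> ('b, 'f, 'o, 'm) pfctr \<Rightarrow> 'i set \<Rightarrow> ('i \<Rightarrow> 'f)
    \<Rightarrow> jobj \<Rightarrow> ('i list \<Rightarrow> 'o, 'i list \<Rightarrow> 'm) cat" where
  "cover_ob \<B> G I g x = prod_cat (tuples I x) (fibre \<B> G g)"

definition cover_map :: "('b, 'f) cat \<Rightarrow> ('b, 'f, 'o, 'm) pfctr \<Rightarrow> 'i set \<Rightarrow> ('i \<Rightarrow> 'f)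
    \<Rightarrow> jarr \<Rightarrow> ('i list \<Rightarrow> 'o, 'i list \<Rightarrow> 'm, 'i list \<Rightarrow> 'o, 'i list \<Rightarrow> 'm) fctr" where
  "cover_map \<B> G I g u =
     (if u \<in> range jid then id_fctr (cover_ob \<B> G I g (jdom u))
      else
        \<lparr>fob = (\<lambda>a\<in>Ob (cover_ob \<B> G I g (jdom u)). \<lambda>t\<in>tuples I (jcod u).
           fob (PM G (proj \<B> g u t)) (a (face u t))),
         far = (\<lambda>\<xi>\<in>Ar (cover_ob \<B> G I g (jdom u)). \<lambda>t\<in>tuples I (jcod u).
           far (PM G (proj \<B> g u t)) (\<xi> (face u t)))\<rparr>)"

text \<open>The pseudo functor \<open>F\<close> of a cover \<open>(I, g)\<close>.\<close>

definition cover_pf :: "('b, 'f) cat \<Rightarrow> ('b, 'f, 'o, 'm) pfctr \<Rightarrow> 'i set \<Rightarrow> ('i \<Rightarrow> 'f)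
    \<Rightarrow> (jobj, jarr, 'i list \<Rightarrow> 'o, 'i list \<Rightarrow> 'm) pfctr" where
  "cover_pf \<B> G I g =
     \<lparr>PO = cover_ob \<B> G I g,
      PM = cover_map \<B> G I g,
      PC = (\<lambda>v u. \<lambda>a\<in>Ob (cover_ob \<B> G I g (jdom u)).
        if u \<in> range jid \<or> v \<in> range jid
        then Idt (cover_ob \<B> G I g (jcod v)) (fob (cover_map \<B> G I g (jcomp v u)) a)
        else (\<lambda>t\<in>tuples I (jcod v).
          PC G (proj \<B> g v t) (proj \<B> g u (face v t)) (a (face u (face v t))))),
      PU = (\<lambda>x. \<lambda>a\<in>Ob (cover_ob \<B> G I g x). Idt (cover_ob \<B> G I g x) a)\<rparr>"

text \<open>The pseudo cone \<open>\<pi>' : \<Delta>\<^bsub>G(B)\<^esub> \<Rightarrow> F\<close> of a cover \<open>(I, g)\<close> of \<open>b\<close>.\<close>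

definition cover_leg :: "('b, 'f) cat \<Rightarrow> ('b, 'f, 'o, 'm) pfctr \<Rightarrow> 'b \<Rightarrow> 'i set \<Rightarrow> ('i \<Rightarrow> 'f)
    \<Rightarrow> jobj \<Rightarrow> ('o, 'm, 'i list \<Rightarrow> 'o, 'i list \<Rightarrow> 'm) fctr" where
  "cover_leg \<B> G b I g x =
     \<lparr>fob = (\<lambda>a\<in>Ob (PO G b). \<lambda>t\<in>tuples I x. fob (PM G (to_base \<B> g t)) a),
      far = (\<lambda>\<xi>\<in>Ar (PO G b). \<lambda>t\<in>tuples I x. far (PM G (to_base \<B> g t)) \<xi>)\<rparr>"

definition cover_cone :: "('b, 'f) cat \<Rightarrow> ('b, 'f, 'o, 'm) pfctr \<Rightarrow> 'b \<Rightarrow> 'i set \<Rightarrow> ('i \<Rightarrow> 'f)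
    \<Rightarrow> (jobj, jarr, 'o, 'm, 'i list \<Rightarrow> 'o, 'i list \<Rightarrow> 'm) ptrans" where
  "cover_cone \<B> G b I g =
     \<lparr>TO = cover_leg \<B> G b I g,
      TC = (\<lambda>u. \<lambda>a\<in>Ob (PO G b).
        if u \<in> range jid
        then Idt (cover_ob \<B> G I g (jcod u)) (fob (cover_leg \<B> G b I g (jcod u)) a)
        else (\<lambda>t\<in>tuples I (jcod u). PC G (proj \<B> g u t) (to_base \<B> g (face u t)) a))\<rparr>"

definition stack :: "('oc, 'mc) cat itself \<Rightarrow> ('b, 'f) cat
    \<Rightarrow> ('b \<Rightarrow> ('i set \<times> ('i \<Rightarrow> 'f)) set) \<Rightarrow> ('b, 'f, 'o, 'm) pfctr \<Rightarrow> bool" where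
  "stack T \<B> K G \<longleftrightarrow>
     (\<forall>b \<in> Ob \<B>. \<forall>(I, g) \<in> K b.
        is_bilimit T \<J> (cover_pf \<B> G I g) (PO G b) (cover_cone \<B> G b I g))"


section \<open>Giraud stacks\<close>

text \<open>
  For \<open>\<phi> : G(p\<^sub>2) a\<^sub>2 \<rightarrow> G(p\<^sub>1) a\<^sub>1\<close>, this is \<open>G(r) \<phi>\<close> made into an arrow
  \<open>G(p\<^sub>2 r) a\<^sub>2 \<rightarrow> G(p\<^sub>1 r) a\<^sub>1\<close> of \<open>C\<close> by the coherence isomorphisms of \<open>G\<close>.
\<close>

definition restrict_along ::
  "('b, 'f, 'o, 'm) pfctr \<Rightarrow> ('o, 'm) cat \<Rightarrow> 'f \<Rightarrow> 'f \<Rightarrow> 'f \<Rightarrow> 'o \<Rightarrow> 'o \<Rightarrow> 'm \<Rightarrow> 'm" where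
  "restrict_along G C r p1 p2 a1 a2 \<phi> =
     PC G r p1 a1 \<cdot>\<^bsub>C\<^esub> far (PM G r) \<phi> \<cdot>\<^bsub>C\<^esub> inv_arrow C (PC G r p2 a2)"

text \<open>
  The sources and targets of the three transported isomorphisms match because
  \<open>\<pi>\<^sup>2 \<pi>\<^sup>2\<^sup>3 = \<pi>\<^sup>2 \<pi>\<^sup>1\<^sup>3\<close>, \<open>\<pi>\<^sup>1 \<pi>\<^sup>2\<^sup>3 = \<pi>\<^sup>2 \<pi>\<^sup>1\<^sup>2\<close> and \<open>\<pi>\<^sup>1 \<pi>\<^sup>1\<^sup>2 = \<pi>\<^sup>1 \<pi>\<^sup>1\<^sup>3\<close>.
\<close>

definition cocycle :: "('b, 'f) cat \<Rightarrow> ('b, 'f, 'o, 'm) pfctr \<Rightarrow> 'i set \<Rightarrow> ('i \<Rightarrow> 'f)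
    \<Rightarrow> ('i \<Rightarrow> 'o) \<Rightarrow> ('i \<times> 'i \<Rightarrow> 'm) \<Rightarrow> bool" where
  "cocycle \<B> G I g a \<phi> \<longleftrightarrow>
     (\<forall>i\<in>I. \<forall>j\<in>I. \<forall>k\<in>I. let C = fibre \<B> G g [i, j, k] in
        restrict_along G C (pi13 \<B> g i j k) (pi1 \<B> g i k) (pi2 \<B> g i k) (a i) (a k) (\<phi> (i, k))
        = restrict_along G C (pi12 \<B> g i j k) (pi1 \<B> g i j) (pi2 \<B> g i j) (a i) (a j) (\<phi> (i, j))
          \<cdot>\<^bsub>C\<^esub>
          restrict_along G C (pi23 \<B> g i j k) (pi1 \<B> g j k) (pi2 \<B> g j k) (a j) (a k) (\<phi> (j, k)))"

definition descent_data :: "('b, 'f) cat \<Rightarrow> ('b, 'f, 'o, 'm) pfctr \<Rightarrow> 'i set \<Rightarrow> ('i \<Rightarrow> 'f)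
    \<Rightarrow> (('i \<Rightarrow> 'o) \<times> ('i \<times> 'i \<Rightarrow> 'm)) set" where
  "descent_data \<B> G I g =
     {(a, \<phi>). a \<in> (\<Pi>\<^sub>E i\<in>I. Ob (fibre \<B> G g [i])) \<and> \<phi> \<in> extensional (I \<times> I) \<and>
        (\<forall>i\<in>I. \<forall>j\<in>I.
           \<phi> (i, j) \<in> hom (fibre \<B> G g [i, j])
             (fob (PM G (pi2 \<B> g i j)) (a j)) (fob (PM G (pi1 \<B> g i j)) (a i)) \<and>
           is_iso (fibre \<B> G g [i, j]) (\<phi> (i, j))) \<and>
        cocycle \<B> G I g a \<phi>}"

definition descent_arrow :: "('b, 'f) cat \<Rightarrow> ('b, 'f, 'o, 'm) pfctr \<Rightarrow> 'i set \<Rightarrow> ('i \<Rightarrow> 'f)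
    \<Rightarrow> ('i \<Rightarrow> 'o) \<times> ('i \<times> 'i \<Rightarrow> 'm) \<Rightarrow> ('i \<Rightarrow> 'o) \<times> ('i \<times> 'i \<Rightarrow> 'm) \<Rightarrow> ('i \<Rightarrow> 'm) \<Rightarrow> bool" where
  "descent_arrow \<B> G I g = (\<lambda>(a, \<phi>) (a', \<phi>') \<xi>.
     (a, \<phi>) \<in> descent_data \<B> G I g \<and> (a', \<phi>') \<in> descent_data \<B> G I g \<and>
     \<xi> \<in> (\<Pi>\<^sub>E i\<in>I. hom (fibre \<B> G g [i]) (a i) (a' i)) \<and>
     (\<forall>i\<in>I. \<forall>j\<in>I.
        far (PM G (pi1 \<B> g i j)) (\<xi> i) \<cdot>\<^bsub>fibre \<B> G g [i, j]\<^esub> \<phi> (i, j)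
        = \<phi>' (i, j) \<cdot>\<^bsub>fibre \<B> G g [i, j]\<^esub> far (PM G (pi2 \<B> g i j)) (\<xi> j)))"

definition descent_cat :: "('b, 'f) cat \<Rightarrow> ('b, 'f, 'o, 'm) pfctr \<Rightarrow> 'i set \<Rightarrow> ('i \<Rightarrow> 'f)
    \<Rightarrow> (('i \<Rightarrow> 'o) \<times> ('i \<times> 'i \<Rightarrow> 'm),
       (('i \<Rightarrow> 'o) \<times> ('i \<times> 'i \<Rightarrow> 'm)) \<times> ('i \<Rightarrow> 'm) \<times> (('i \<Rightarrow> 'o) \<times> ('i \<times> 'i \<Rightarrow> 'm))) cat" where
  "descent_cat \<B> G I g =
     \<lparr>Ob = descent_data \<B> G I g,
      Ar = {(x, \<xi>, y). descent_arrow \<B> G I g x y \<xi>},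
      Dom = (\<lambda>(x, \<xi>, y). x),
      Cod = (\<lambda>(x, \<xi>, y). y),
      Idt = (\<lambda>x. (x, \<lambda>i\<in>I. Idt (fibre \<B> G g [i]) (fst x i), x)),
      Comp = (\<lambda>(_, \<zeta>, z) (x, \<xi>, _). (x, \<lambda>i\<in>I. \<zeta> i \<cdot>\<^bsub>fibre \<B> G g [i]\<^esub> \<xi> i, z))\<rparr>"

definition canonical_descent :: "('b, 'f) cat \<Rightarrow> ('b, 'f, 'o, 'm) pfctr \<Rightarrow> 'i set \<Rightarrow> ('i \<Rightarrow> 'f)
    \<Rightarrow> 'o \<Rightarrow> ('i \<Rightarrow> 'o) \<times> ('i \<times> 'i \<Rightarrow> 'm)" where
  "canonical_descent \<B> G I g a =
     (\<lambda>i\<in>I. fob (PM G (g i)) a,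
      \<lambda>(i, j)\<in>I \<times> I.
        inv_arrow (fibre \<B> G g [i, j]) (PC G (pi1 \<B> g i j) (g i) a)
        \<cdot>\<^bsub>fibre \<B> G g [i, j]\<^esub> PC G (pi2 \<B> g i j) (g j) a)"

definition descent_functor :: "('b, 'f) cat \<Rightarrow> ('b, 'f, 'o, 'm) pfctr \<Rightarrow> 'b \<Rightarrow> 'i set \<Rightarrow> ('i \<Rightarrow> 'f)
    \<Rightarrow> ('o, 'm, ('i \<Rightarrow> 'o) \<times> ('i \<times> 'i \<Rightarrow> 'm),
       (('i \<Rightarrow> 'o) \<times> ('i \<times> 'i \<Rightarrow> 'm)) \<times> ('i \<Rightarrow> 'm) \<times> (('i \<Rightarrow> 'o) \<times> ('i \<times> 'i \<Rightarrow> 'm))) fctr" where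
  "descent_functor \<B> G b I g =
     \<lparr>fob = (\<lambda>a\<in>Ob (PO G b). canonical_descent \<B> G I g a),
      far = (\<lambda>\<xi>\<in>Ar (PO G b).
        (canonical_descent \<B> G I g (Dom (PO G b) \<xi>),
         \<lambda>i\<in>I. far (PM G (g i)) \<xi>,
         canonical_descent \<B> G I g (Cod (PO G b) \<xi>)))\<rparr>"

definition giraud_stack :: "('b, 'f) cat
    \<Rightarrow> ('b \<Rightarrow> ('i set \<times> ('i \<Rightarrow> 'f)) set) \<Rightarrow> ('b, 'f, 'o, 'm) pfctr \<Rightarrow> bool" where
  "giraud_stack \<B> K G \<longleftrightarrow>
     (\<forall>b \<in> Ob \<B>. \<forall>(I, g) \<in> K b.
        is_equivalence (PO G b) (descent_cat \<B> G I g) (descent_functor \<B> G b I g))"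

end

theory Submission
  imports Defs
begin

text \<open>
  For any pseudo functor \<open>F : \<J> \<rightarrow> Cat\<close>, a pseudo cone \<open>\<alpha>\<close> with vertex \<open>C\<close> gives for every \<open>c\<close> the
  cocycle \<open>\<phi> = (\<alpha>\<^bsub>f1\<^esub> c)\<inverse> \<cdot> \<alpha>\<^bsub>f2\<^esub> c\<close> on \<open>\<alpha>\<^sub>X c\<close>. Its restrictions along \<open>v : Y \<rightarrow> Z\<close> satisfy
  \<open>\<alpha>\<^bsub>v f1\<^esub> \<cdot> v\<^sup>*\<phi> = \<alpha>\<^bsub>v f2\<^esub>\<close>, so the relations of \<open>\<J>\<close> yield the cocycle condition. Modifications between
  pseudo cones are the same as natural families of maps of cocycles, as the components at \<open>Y\<close> and \<open>Z\<close>
  are conjugates of the one at \<open>X\<close>. Hence if the functor from \<open>W\<close> to cocycles is an equivalence, then so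
  is composition with the pseudo cone, for every test category. Conversely every cocycle comes from a
  pseudo cone on the point, so the test category with one arrow suffices to recover the equivalence.
  For the pseudo functor of a cover, cocycles are descent data up to reindexing.
\<close>

section \<open>Categories, functors and equivalences\<close>

text \<open>A bilimit is tested against categories whose types must be fixed in advance. The cocycle
  category removes this dependence, as it expresses the universal property without a test category.
  Going from cocycles to cones works objectwise over any test category. Going back needs a test
  category that exists at whatever types were fixed; the terminal one does, as
  \<open>undefined\<close> inhabits every type.

  The shape of \<J> keeps the coherence manageable. Non-identity arrows go strictly up in X, Y, Z,
  so one of any three composable arrows is an identity, and only six pairs of non-identities
  compose. A pseudo cone on the point with given cells at \<open>F1\<close>, \<open>F2\<close> and
  \<open>F12F1\<close> has five more non-identity cells. Five of the six pairs determine these one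
  by one; the sixth pair is exactly the cocycle condition.

  The associativity of the coherence of \<open>G\<close> enters where the pseudo cone of a cover is
  checked, as the map down to the base is a third composable arrow there.\<close>

lemma hom_Ar: "f \<in> hom C a b \<Longrightarrow> f \<in> Ar C"
  and hom_Dom: "f \<in> hom C a b \<Longrightarrow> Dom C f = a"
  and hom_Cod: "f \<in> hom C a b \<Longrightarrow> Cod C f = b"
  by (simp_all add: hom_def)

context category
begin

lemma hom_Ob: "f \<in> hom C a b \<Longrightarrow> a \<in> Ob C \<and> b \<in> Ob C"
  using Dom_in Cod_in by (auto simp: hom_def)

lemma Ar_Idt: "a \<in> Ob C \<Longrightarrow> Idt C a \<in> Ar C"
  and Dom_Idt: "a \<in> Ob C \<Longrightarrow> Dom C (Idt C a) = a"
  and Cod_Idt: "a \<in> Ob C \<Longrightarrow> Cod C (Idt C a) = a"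
  using Idt_in[of a] by (simp_all add: hom_def)

text \<open>Typing by \<open>Ar\<close>, \<open>Dom\<close> and \<open>Cod\<close> instead of
  \<open>hom\<close> leaves no intermediate object to be guessed, so these facts serve as
  conditional rewrite rules and the simplifier discharges their side conditions itself.\<close>

lemma Ar_Comp: "\<lbrakk>f \<in> Ar C; g \<in> Ar C; Dom C g = Cod C f\<rbrakk> \<Longrightarrow> g \<cdot> f \<in> Ar C"
  and Dom_Comp: "\<lbrakk>f \<in> Ar C; g \<in> Ar C; Dom C g = Cod C f\<rbrakk> \<Longrightarrow> Dom C (g \<cdot> f) = Dom C f"
  and Cod_Comp: "\<lbrakk>f \<in> Ar C; g \<in> Ar C; Dom C g = Cod C f\<rbrakk> \<Longrightarrow> Cod C (g \<cdot> f) = Cod C g"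
  using Comp_in[of f "Dom C f" "Cod C f" g "Cod C g"] by (simp_all add: hom_def)

lemma assoc: "\<lbrakk>f \<in> Ar C; g \<in> Ar C; h \<in> Ar C; Dom C g = Cod C f; Dom C h = Cod C g\<rbrakk>
    \<Longrightarrow> (h \<cdot> g) \<cdot> f = h \<cdot> (g \<cdot> f)"
  using Comp_assoc[of f "Dom C f" "Cod C f" g "Cod C g" h "Cod C h"] by (simp add: hom_def)

lemma left_unit: "\<lbrakk>f \<in> Ar C; Cod C f = b\<rbrakk> \<Longrightarrow> Idt C b \<cdot> f = f"
  and right_unit: "\<lbrakk>f \<in> Ar C; Dom C f = a\<rbrakk> \<Longrightarrow> f \<cdot> Idt C a = f"
  using Idt_left[of f "Dom C f" b] Idt_right[of f a "Cod C f"] by (simp_all add: hom_def)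

lemmas cat_simps = Dom_in Cod_in Ar_Idt Dom_Idt Cod_Idt Ar_Comp Dom_Comp Cod_Comp assoc left_unit
  right_unit

lemma inverse_arrows_unique:
  assumes "inverse_arrows C f g" "inverse_arrows C f h"
  shows "g = h"
proof -
  have g: "g \<in> Ar C" "h \<in> Ar C" "f \<in> Ar C" "Dom C g = Cod C f" "Cod C h = Dom C f"
    and eq: "g \<cdot> f = Idt C (Dom C f)" "f \<cdot> h = Idt C (Cod C f)"
    using assms by (simp_all add: inverse_arrows_def hom_def)
  have "(g \<cdot> f) \<cdot> h = g \<cdot> (f \<cdot> h)"
    using g by (simp add: assoc)
  then show ?thesis
    unfolding eq using g by (simp add: left_unit right_unit)
qed

lemma inv_arrow_eq: "inverse_arrows C f g \<Longrightarrow> inv_arrow C f = g"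
  unfolding inv_arrow_def using inverse_arrows_unique by blast

lemma inverse_arrows_inv_arrow: "is_iso C f \<Longrightarrow> inverse_arrows C f (inv_arrow C f)"
  using inv_arrow_eq by (auto simp: is_iso_def)

lemma is_iso_Ar: "is_iso C f \<Longrightarrow> f \<in> Ar C"
  by (auto simp: is_iso_def inverse_arrows_def)

lemma inv_arrow_Ar: "is_iso C f \<Longrightarrow> inv_arrow C f \<in> Ar C"
  and Dom_inv_arrow: "is_iso C f \<Longrightarrow> Dom C (inv_arrow C f) = Cod C f"
  and Cod_inv_arrow: "is_iso C f \<Longrightarrow> Cod C (inv_arrow C f) = Dom C f"
  and inv_arrow_left: "is_iso C f \<Longrightarrow> inv_arrow C f \<cdot> f = Idt C (Dom C f)"
  and inv_arrow_right: "is_iso C f \<Longrightarrow> f \<cdot> inv_arrow C f = Idt C (Cod C f)"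
  using inverse_arrows_inv_arrow[of f] by (simp_all add: inverse_arrows_def hom_def)

text \<open>Rewriting with \<open>assoc\<close> nests composites to the right, so an arrow and its
  inverse usually meet in front of a remaining factor; this and the next lemma cancel them
  there.\<close>

lemma inv_arrow_left_assoc:
  assumes "is_iso C f" "h \<in> Ar C" "Cod C h = Dom C f"
  shows "inv_arrow C f \<cdot> (f \<cdot> h) = h"
proof -
  have "inv_arrow C f \<cdot> (f \<cdot> h) = (inv_arrow C f \<cdot> f) \<cdot> h"
    using assms is_iso_Ar[of f] by (simp only: assoc inv_arrow_Ar Dom_inv_arrow)
  then show ?thesis
    using assms by (simp add: inv_arrow_left left_unit)
qed

lemma inv_arrow_right_assoc:
  assumes "is_iso C f" "h \<in> Ar C" "Cod C h = Cod C f"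
  shows "f \<cdot> (inv_arrow C f \<cdot> h) = h"
proof -
  have "f \<cdot> (inv_arrow C f \<cdot> h) = (f \<cdot> inv_arrow C f) \<cdot> h"
    using assms is_iso_Ar[of f] by (simp only: assoc inv_arrow_Ar Dom_inv_arrow Cod_inv_arrow)
  then show ?thesis
    using assms by (simp add: inv_arrow_right left_unit)
qed

lemmas iso_simps = is_iso_Ar inv_arrow_Ar Dom_inv_arrow Cod_inv_arrow inv_arrow_left inv_arrow_right
  inv_arrow_left_assoc inv_arrow_right_assoc

lemma is_iso_inv_arrow: "is_iso C f \<Longrightarrow> is_iso C (inv_arrow C f)"
  unfolding is_iso_def[of _ "inv_arrow C f"] inverse_arrows_def
  by (rule exI[of _ f]) (simp add: iso_simps hom_def)

lemma is_iso_Idt: "a \<in> Ob C \<Longrightarrow> is_iso C (Idt C a)"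
  and inv_arrow_Idt: "a \<in> Ob C \<Longrightarrow> inv_arrow C (Idt C a) = Idt C a"
proof -
  assume "a \<in> Ob C"
  then have "inverse_arrows C (Idt C a) (Idt C a)"
    by (simp add: inverse_arrows_def hom_def cat_simps)
  then show "is_iso C (Idt C a)" "inv_arrow C (Idt C a) = Idt C a"
    by (auto simp: is_iso_def intro: inv_arrow_eq)
qed

lemma is_iso_Comp: "\<lbrakk>is_iso C f; is_iso C g; Dom C g = Cod C f\<rbrakk> \<Longrightarrow> is_iso C (g \<cdot> f)"
  unfolding is_iso_def[of _ "g \<cdot> f"] inverse_arrows_def
  by (rule exI[of _ "inv_arrow C f \<cdot> inv_arrow C g"]) (simp add: cat_simps iso_simps hom_def)

text \<open>The standard device for equations between coherence cells: compose both sides with an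
  invertible cell, compute, and cancel it by this rule or the next.\<close>

lemma iso_cancel_left:
  assumes "f \<cdot> g = f \<cdot> h" "is_iso C f" "g \<in> Ar C" "h \<in> Ar C" "Cod C g = Dom C f"
    "Cod C h = Dom C f"
  shows "g = h"
  by (metis assms inv_arrow_left_assoc)

lemma iso_cancel_right:
  assumes "g \<cdot> f = h \<cdot> f" "is_iso C f" "g \<in> Ar C" "h \<in> Ar C" "Dom C g = Cod C f"
    "Dom C h = Cod C f"
  shows "g = h"
proof -
  have "g = (g \<cdot> f) \<cdot> inv_arrow C f" "h = (h \<cdot> f) \<cdot> inv_arrow C f"
    using assms(2-) by (simp_all add: cat_simps iso_simps)
  then show ?thesis
    using assms(1) by simp
qed

end

section \<open>Functors and natural transformations\<close>

lemma is_functor_categories: "is_functor C D T \<Longrightarrow> category C \<and> category D"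
  by (simp add: is_functor_def)

lemma functor_fob: "\<lbrakk>is_functor C D T; a \<in> Ob C\<rbrakk> \<Longrightarrow> fob T a \<in> Ob D"
  and functor_far: "\<lbrakk>is_functor C D T; f \<in> Ar C\<rbrakk> \<Longrightarrow> far T f \<in> Ar D"
  and functor_Dom: "\<lbrakk>is_functor C D T; f \<in> Ar C\<rbrakk> \<Longrightarrow> Dom D (far T f) = fob T (Dom C f)"
  and functor_Cod: "\<lbrakk>is_functor C D T; f \<in> Ar C\<rbrakk> \<Longrightarrow> Cod D (far T f) = fob T (Cod C f)"
  and functor_Idt: "\<lbrakk>is_functor C D T; a \<in> Ob C\<rbrakk> \<Longrightarrow> far T (Idt C a) = Idt D (fob T a)"
  and functor_Comp: "\<lbrakk>is_functor C D T; f \<in> Ar C; g \<in> Ar C; Dom C g = Cod C f\<rbrakk>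
    \<Longrightarrow> far T (g \<cdot>\<^bsub>C\<^esub> f) = far T g \<cdot>\<^bsub>D\<^esub> far T f"
  by (auto simp: is_functor_def)

lemmas functor_simps = functor_fob functor_far functor_Dom functor_Cod functor_Idt functor_Comp

lemma functor_hom: "\<lbrakk>is_functor C D T; f \<in> hom C a b\<rbrakk> \<Longrightarrow> far T f \<in> hom D (fob T a) (fob T b)"
  by (simp add: hom_def functor_simps)

lemma functor_inverse_arrows:
  assumes "is_functor C D T" "inverse_arrows C f g"
  shows "inverse_arrows D (far T f) (far T g)"
proof -
  interpret C: category C using assms(1) by (simp add: is_functor_def)
  have "far T (g \<cdot>\<^bsub>C\<^esub> f) = Idt D (fob T (Dom C f))" "far T (f \<cdot>\<^bsub>C\<^esub> g) = Idt D (fob T (Cod C f))"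
    using assms(2) by (simp_all add: inverse_arrows_def functor_Idt[OF assms(1)] C.cat_simps)
  then show ?thesis
    using assms(2) functor_Comp[OF assms(1), of f g] functor_Comp[OF assms(1), of g f]
    by (simp add: inverse_arrows_def hom_def functor_simps[OF assms(1)])
qed

lemma functor_is_iso: "\<lbrakk>is_functor C D T; is_iso C f\<rbrakk> \<Longrightarrow> is_iso D (far T f)"
  unfolding is_iso_def by (elim exE) (rule exI, rule functor_inverse_arrows)

lemma functor_inv_arrow:
  assumes "is_functor C D T" "is_iso C f"
  shows "inv_arrow D (far T f) = far T (inv_arrow C f)"
proof (rule category.inv_arrow_eq)
  show "category D" "inverse_arrows D (far T f) (far T (inv_arrow C f))"
    using assms(1) functor_inverse_arrows[OF assms(1)
        category.inverse_arrows_inv_arrow[OF conjunct1[OF is_functor_categories[OF assms(1)]] assms(2)]]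
    by (simp_all add: is_functor_categories)
qed

lemma functor_id:
  assumes "category C"
  shows "is_functor C C (id_fctr C)"
proof -
  interpret category C by fact
  show ?thesis
    using assms by (auto simp: is_functor_def id_fctr_def cat_simps)
qed

lemma fob_id [simp]: "a \<in> Ob C \<Longrightarrow> fob (id_fctr C) a = a"
  and far_id [simp]: "f \<in> Ar C \<Longrightarrow> far (id_fctr C) f = f"
  by (simp_all add: id_fctr_def)

lemma fob_comp [simp]: "a \<in> Ob C \<Longrightarrow> fob (comp_fctr C T S) a = fob T (fob S a)"
  and far_comp [simp]: "f \<in> Ar C \<Longrightarrow> far (comp_fctr C T S) f = far T (far S f)"
  by (simp_all add: comp_fctr_def)

lemma functor_comp:
  assumes "is_functor C D S" "is_functor D E T"
  shows "is_functor C E (comp_fctr C T S)"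
proof -
  interpret C: category C using assms(1) by (simp add: is_functor_def)
  show ?thesis
    using assms is_functor_categories[OF assms(1)] is_functor_categories[OF assms(2)]
    unfolding is_functor_def[of C E]
    by (auto simp: C.cat_simps functor_simps[OF assms(1)] functor_simps[OF assms(2)]
        comp_fctr_def)
qed

lemma natural_functors: "is_natural C D S T \<tau> \<Longrightarrow> is_functor C D S \<and> is_functor C D T"
  by (simp add: is_natural_def)

lemma natural_hom: "\<lbrakk>is_natural C D S T \<tau>; a \<in> Ob C\<rbrakk> \<Longrightarrow> \<tau> a \<in> hom D (fob S a) (fob T a)"
  by (simp add: is_natural_def)

lemma natural_square: "\<lbrakk>is_natural C D S T \<tau>; f \<in> Ar C\<rbrakk>
    \<Longrightarrow> far T f \<cdot>\<^bsub>D\<^esub> \<tau> (Dom C f) = \<tau> (Cod C f) \<cdot>\<^bsub>D\<^esub> far S f"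
  by (simp add: is_natural_def)

lemma natural_extensional: "is_natural C D S T \<tau> \<Longrightarrow> \<tau> \<in> extensional (Ob C)"
  by (simp add: is_natural_def)

section \<open>Equivalences as fully faithful and essentially surjective functors\<close>

definition fully_faithful ::
  "('o1, 'm1) cat \<Rightarrow> ('o2, 'm2) cat \<Rightarrow> ('o1, 'm1, 'o2, 'm2) fctr \<Rightarrow> bool" where
  "fully_faithful C D T \<longleftrightarrow>
     (\<forall>a\<in>Ob C. \<forall>b\<in>Ob C. bij_betw (far T) (hom C a b) (hom D (fob T a) (fob T b)))"

definition essentially_surjective ::
  "('o1, 'm1) cat \<Rightarrow> ('o2, 'm2) cat \<Rightarrow> ('o1, 'm1, 'o2, 'm2) fctr \<Rightarrow> bool" where
  "essentially_surjective C D T \<longleftrightarrow>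
     (\<forall>d\<in>Ob D. \<exists>c\<in>Ob C. \<exists>f\<in>hom D (fob T c) d. is_iso D f)"

lemma fully_faithful_inj:
  assumes "fully_faithful C D T" "a \<in> Ob C" "b \<in> Ob C" "f \<in> hom C a b" "f' \<in> hom C a b"
    "far T f = far T f'"
  shows "f = f'"
  using assms unfolding fully_faithful_def bij_betw_def inj_on_def by blast

lemma fully_faithful_surj:
  assumes "fully_faithful C D T" "a \<in> Ob C" "b \<in> Ob C" "h \<in> hom D (fob T a) (fob T b)"
  obtains f where "f \<in> hom C a b" "far T f = h"
  using assms unfolding fully_faithful_def bij_betw_def by (metis imageE)

lemma fully_faithfulI:
  assumes "is_functor C D T"
    and "\<And>a b f f'. \<lbrakk>a \<in> Ob C; b \<in> Ob C; f \<in> hom C a b; f' \<in> hom C a b; far T f = far T f'\<rbrakk>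
      \<Longrightarrow> f = f'"
    and "\<And>a b h. \<lbrakk>a \<in> Ob C; b \<in> Ob C; h \<in> hom D (fob T a) (fob T b)\<rbrakk>
      \<Longrightarrow> \<exists>f\<in>hom C a b. far T f = h"
  shows "fully_faithful C D T"
  unfolding fully_faithful_def
proof (intro ballI bij_betw_imageI inj_onI equalityI subsetI)
  fix a b f f'
  assume "a \<in> Ob C" "b \<in> Ob C" "f \<in> hom C a b" "f' \<in> hom C a b" "far T f = far T f'"
  then show "f = f'" by (rule assms(2))
next
  fix a b h
  assume "a \<in> Ob C" "b \<in> Ob C" "h \<in> hom D (fob T a) (fob T b)"
  then show "h \<in> far T ` hom C a b" using assms(3)[of a b h] by blast
next
  fix a b h
  assume "h \<in> far T ` hom C a b"
  then show "h \<in> hom D (fob T a) (fob T b)" using functor_hom[OF assms(1)] by blast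
qed

text \<open>The inverse of the image lifts by fullness; both composites with the lift are sent to
  identities, so faithfulness makes them identities.\<close>

lemma fully_faithful_reflects_iso:
  assumes T: "is_functor C D T" "fully_faithful C D T"
    and f: "f \<in> Ar C" "is_iso D (far T f)"
  shows "is_iso C f"
proof -
  interpret C: category C using T(1) by (simp add: is_functor_def)
  interpret D: category D using T(1) by (simp add: is_functor_def)
  let ?a = "Dom C f" and ?b = "Cod C f"
  note [simp] = f(1) C.cat_simps functor_simps[OF T(1)]
  have "inv_arrow D (far T f) \<in> hom D (fob T ?b) (fob T ?a)"
    using f by (simp add: D.iso_simps hom_def)
  then obtain h where h: "h \<in> hom C ?b ?a" "far T h = inv_arrow D (far T f)"
    using fully_faithful_surj[OF T(2), of ?b ?a] by auto
  have "h \<cdot>\<^bsub>C\<^esub> f = Idt C ?a"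
    using h f(2) by (intro fully_faithful_inj[OF T(2), of ?a ?a]) (simp_all add: hom_def D.iso_simps)
  moreover have "f \<cdot>\<^bsub>C\<^esub> h = Idt C ?b"
    using h f(2) by (intro fully_faithful_inj[OF T(2), of ?b ?b]) (simp_all add: hom_def D.iso_simps)
  ultimately show ?thesis
    using h f by (auto simp: is_iso_def inverse_arrows_def)
qed

text \<open>Conjugation by \<eta> recovers an arrow \<open>f\<close> from \<open>S T f\<close>, so
  \<open>T\<close> is faithful; conjugation by \<epsilon> likewise shows that \<open>S\<close> is
  faithful. Fullness of \<open>T\<close> uses the faithfulness of \<open>S\<close>: the candidate
  preimage agrees with \<open>h\<close> after applying \<open>S\<close>.\<close>

lemma equivalence_imp_fully_faithful:
  assumes "is_equivalence C D T"
  shows "fully_faithful C D T"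
proof -
  from assms obtain S \<eta> \<epsilon> where T: "is_functor C D T" and S: "is_functor D C S"
    and \<eta>: "is_natural_iso C C (id_fctr C) (comp_fctr C S T) \<eta>"
    and \<epsilon>: "is_natural_iso D D (comp_fctr D T S) (id_fctr D) \<epsilon>"
    by (auto simp: is_equivalence_def)
  interpret C: category C using T by (simp add: is_functor_def)
  interpret D: category D using T by (simp add: is_functor_def)
  have \<eta>_nat: "is_natural C C (id_fctr C) (comp_fctr C S T) \<eta>"
    and \<epsilon>_nat: "is_natural D D (comp_fctr D T S) (id_fctr D) \<epsilon>"
    using \<eta> \<epsilon> by (simp_all add: is_natural_iso_def)
  have \<eta>_iso: "is_iso C (\<eta> a)" "\<eta> a \<in> Ar C" "Dom C (\<eta> a) = a" "Cod C (\<eta> a) = fob S (fob T a)"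
    if "a \<in> Ob C" for a
    using \<eta> that natural_hom[OF \<eta>_nat that] by (auto simp: is_natural_iso_def hom_def)
  have \<epsilon>_iso: "is_iso D (\<epsilon> a)" "\<epsilon> a \<in> Ar D" "Dom D (\<epsilon> a) = fob T (fob S a)" "Cod D (\<epsilon> a) = a"
    if "a \<in> Ob D" for a
    using \<epsilon> that natural_hom[OF \<epsilon>_nat that] by (auto simp: is_natural_iso_def hom_def)
  have \<eta>_sq: "far S (far T f) \<cdot>\<^bsub>C\<^esub> \<eta> (Dom C f) = \<eta> (Cod C f) \<cdot>\<^bsub>C\<^esub> f" if "f \<in> Ar C" for f
    using natural_square[OF \<eta>_nat that] that by simp
  have \<epsilon>_sq: "f \<cdot>\<^bsub>D\<^esub> \<epsilon> (Dom D f) = \<epsilon> (Cod D f) \<cdot>\<^bsub>D\<^esub> far T (far S f)" if "f \<in> Ar D" for f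
    using natural_square[OF \<epsilon>_nat that] that by simp
  note [simp] = C.cat_simps D.cat_simps functor_simps[OF T] functor_simps[OF S] \<eta>_iso \<epsilon>_iso
    C.iso_simps D.iso_simps
  have S_faithful: "k = k'"
    if "k \<in> hom D d e" "k' \<in> hom D d e" "far S k = far S k'" for k k' d e
  proof (rule D.iso_cancel_right[of k "\<epsilon> d"])
    have "d \<in> Ob D" using that(1) by (auto simp: hom_def)
    then show "k \<cdot>\<^bsub>D\<^esub> \<epsilon> d = k' \<cdot>\<^bsub>D\<^esub> \<epsilon> d" "is_iso D (\<epsilon> d)" "k \<in> Ar D" "k' \<in> Ar D"
      "Dom D k = Cod D (\<epsilon> d)" "Dom D k' = Cod D (\<epsilon> d)"
      using that \<epsilon>_sq[of k] \<epsilon>_sq[of k'] by (auto simp: hom_def)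
  qed
  show ?thesis
  proof (rule fully_faithfulI[OF T])
    fix a b f f'
    assume ab: "a \<in> Ob C" "b \<in> Ob C" and f: "f \<in> hom C a b" "f' \<in> hom C a b"
      and eq: "far T f = far T f'"
    show "f = f'"
      using ab f \<eta>_sq[of f] \<eta>_sq[of f'] eq
      by (intro C.iso_cancel_left[of "\<eta> b" f f']) (auto simp: hom_def)
  next
    fix a b h
    assume ab: "a \<in> Ob C" "b \<in> Ob C" and h: "h \<in> hom D (fob T a) (fob T b)"
    \<comment> \<open>Naturality of \<eta> leaves no other choice: a preimage \<open>f\<close> of
      \<open>h\<close> satisfies \<open>\<eta> b\<close> after \<open>f\<close> =
      \<open>far S h\<close> after \<open>\<eta> a\<close>.\<close>
    let ?f = "inv_arrow C (\<eta> b) \<cdot>\<^bsub>C\<^esub> (far S h \<cdot>\<^bsub>C\<^esub> \<eta> a)"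
    have f: "?f \<in> hom C a b"
      using ab h by (simp add: hom_def)
    have "far S (far T ?f) = far S h"
    proof (rule C.iso_cancel_right[of _ "\<eta> a"])
      show "far S (far T ?f) \<cdot>\<^bsub>C\<^esub> \<eta> a = far S h \<cdot>\<^bsub>C\<^esub> \<eta> a"
        using \<eta>_sq[of ?f] f ab h by (simp add: hom_def)
    qed (use f ab h in \<open>simp_all add: hom_def\<close>)
    then have "far T ?f = h"
      using S_faithful[of "far T ?f" "fob T a" "fob T b" h] functor_hom[OF T f] h by simp
    then show "\<exists>f\<in>hom C a b. far T f = h"
      using f by blast
  qed
qed

text \<open>This form is easier to transport than a quasi-inverse with two natural isomorphisms.
  From right to left, a quasi-inverse is assembled by choosing for every object \<open>d\<close> an
  object \<open>s d\<close> and an isomorphism \<open>\<epsilon>' d\<close> from its image; all laws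
  are verified after applying \<open>T\<close>.\<close>

lemma equivalence_iff:
  "is_equivalence C D T \<longleftrightarrow>
    is_functor C D T \<and> fully_faithful C D T \<and> essentially_surjective C D T"
proof (intro iffI conjI)
  assume eq: "is_equivalence C D T"
  show "fully_faithful C D T" "is_functor C D T"
    using equivalence_imp_fully_faithful[OF eq] eq by (auto simp: is_equivalence_def)
  from eq obtain S \<epsilon> where S: "is_functor D C S"
    and \<epsilon>: "is_natural_iso D D (comp_fctr D T S) (id_fctr D) \<epsilon>"
    by (auto simp: is_equivalence_def)
  show "essentially_surjective C D T"
    unfolding essentially_surjective_def
  proof
    fix d assume d: "d \<in> Ob D"
    have "\<epsilon> d \<in> hom D (fob T (fob S d)) d" "is_iso D (\<epsilon> d)"
      using \<epsilon> d natural_hom[of D D "comp_fctr D T S" "id_fctr D" \<epsilon> d]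
      by (auto simp: is_natural_iso_def)
    then show "\<exists>c\<in>Ob C. \<exists>f\<in>hom D (fob T c) d. is_iso D f"
      using functor_fob[OF S d] by blast
  qed
next
  assume "is_functor C D T \<and> fully_faithful C D T \<and> essentially_surjective C D T"
  then have T: "is_functor C D T" and ff: "fully_faithful C D T"
    and es: "essentially_surjective C D T"
    by auto
  interpret C: category C using T by (simp add: is_functor_def)
  interpret D: category D using T by (simp add: is_functor_def)
  have "\<forall>d\<in>Ob D. \<exists>c f. c \<in> Ob C \<and> f \<in> hom D (fob T c) d \<and> is_iso D f"
    using es unfolding essentially_surjective_def by blast
  then obtain s \<epsilon>' where s: "\<And>d. d \<in> Ob D \<Longrightarrow> s d \<in> Ob C"
    and \<epsilon>': "\<And>d. d \<in> Ob D \<Longrightarrow> \<epsilon>' d \<in> hom D (fob T (s d)) d"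
      "\<And>d. d \<in> Ob D \<Longrightarrow> is_iso D (\<epsilon>' d)"
    by metis
  have \<epsilon>: "is_iso D (\<epsilon>' d)" "\<epsilon>' d \<in> Ar D" "Dom D (\<epsilon>' d) = fob T (s d)" "Cod D (\<epsilon>' d) = d"
    if "d \<in> Ob D" for d
    using \<epsilon>'[OF that] by (auto simp: hom_def)
  note [simp] = C.cat_simps D.cat_simps functor_simps[OF T] s \<epsilon> C.iso_simps D.iso_simps
  \<comment> \<open>The conjugate of \<open>k\<close> by the chosen isomorphisms. Lifting it along
    \<open>T\<close> defines the quasi-inverse on arrows and makes \<epsilon>' natural by
    construction.\<close>
  let ?u = "\<lambda>k. inv_arrow D (\<epsilon>' (Cod D k)) \<cdot>\<^bsub>D\<^esub> (k \<cdot>\<^bsub>D\<^esub> \<epsilon>' (Dom D k))"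
  have "\<forall>k\<in>Ar D. \<exists>f. f \<in> hom C (s (Dom D k)) (s (Cod D k)) \<and> far T f = ?u k"
  proof
    fix k assume k: "k \<in> Ar D"
    then have "?u k \<in> hom D (fob T (s (Dom D k))) (fob T (s (Cod D k)))"
      by (simp add: hom_def)
    then show "\<exists>f. f \<in> hom C (s (Dom D k)) (s (Cod D k)) \<and> far T f = ?u k"
      using fully_faithful_surj[OF ff, of "s (Dom D k)" "s (Cod D k)"] k by (metis D.Dom_in D.Cod_in s)
  qed
  then obtain m where m': "\<And>k. k \<in> Ar D \<Longrightarrow> m k \<in> hom C (s (Dom D k)) (s (Cod D k))"
    and mT: "\<And>k. k \<in> Ar D \<Longrightarrow> far T (m k) = ?u k"
    by metis
  have m: "m k \<in> Ar C" "Dom C (m k) = s (Dom D k)" "Cod C (m k) = s (Cod D k)" if "k \<in> Ar D" for k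
    using m'[OF that] by (auto simp: hom_def)
  define S where "S = \<lparr>fob = (\<lambda>d\<in>Ob D. s d), far = (\<lambda>k\<in>Ar D. m k)\<rparr>"
  have [simp]: "fob S d = s d" if "d \<in> Ob D" for d using that by (simp add: S_def)
  have [simp]: "far S k = m k" if "k \<in> Ar D" for k using that by (simp add: S_def)
  have S: "is_functor D C S"
    unfolding is_functor_def
  proof (intro conjI ballI impI)
    show "far S (Idt D d) = Idt C (fob S d)" if d: "d \<in> Ob D" for d
      using d m'[of "Idt D d"] C.Idt_in[of "s d"]
      by (intro fully_faithful_inj[OF ff, of "s d" "s d"]) (simp_all add: mT)
    show "far S (h \<cdot>\<^bsub>D\<^esub> k) = far S h \<cdot>\<^bsub>C\<^esub> far S k"
      if k: "k \<in> Ar D" "h \<in> Ar D" "Dom D h = Cod D k" for k h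
      using k m'[of "h \<cdot>\<^bsub>D\<^esub> k"]
      by (intro fully_faithful_inj[OF ff, of "s (Dom D k)" "s (Cod D h)"])
        (simp_all add: mT m hom_def)
  qed (use m' in \<open>auto simp: S_def m C.category_axioms D.category_axioms\<close>)
  have \<epsilon>nat: "is_natural_iso D D (comp_fctr D T S) (id_fctr D) (\<lambda>d\<in>Ob D. \<epsilon>' d)"
    using functor_comp[OF S T] functor_id[OF D.category_axioms]
    by (auto simp: is_natural_iso_def is_natural_def hom_def mT)
  \<comment> \<open>The unit at \<open>c\<close> is the lift of the inverse of \<epsilon>' at
    \<open>T c\<close>. It is invertible since \<open>T\<close> reflects isomorphisms, and natural
    since \<open>T\<close> is faithful.\<close>
  have "\<forall>c\<in>Ob C. \<exists>f. f \<in> hom C c (s (fob T c)) \<and> far T f = inv_arrow D (\<epsilon>' (fob T c))"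
  proof
    fix c assume c: "c \<in> Ob C"
    then have "inv_arrow D (\<epsilon>' (fob T c)) \<in> hom D (fob T c) (fob T (s (fob T c)))"
      by (simp add: hom_def)
    then show "\<exists>f. f \<in> hom C c (s (fob T c)) \<and> far T f = inv_arrow D (\<epsilon>' (fob T c))"
      using fully_faithful_surj[OF ff, of c "s (fob T c)"] c s functor_fob[OF T] by metis
  qed
  then obtain \<eta> where \<eta>: "\<And>c. c \<in> Ob C \<Longrightarrow> \<eta> c \<in> hom C c (s (fob T c))"
    and \<eta>T: "\<And>c. c \<in> Ob C \<Longrightarrow> far T (\<eta> c) = inv_arrow D (\<epsilon>' (fob T c))"
    by metis
  have \<eta>': "\<eta> c \<in> Ar C" "Dom C (\<eta> c) = c" "Cod C (\<eta> c) = s (fob T c)" if "c \<in> Ob C" for c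
    using \<eta>[OF that] by (auto simp: hom_def)
  have \<eta>_iso: "is_iso C (\<eta> c)" if c: "c \<in> Ob C" for c
    using c by (intro fully_faithful_reflects_iso[OF T ff])
      (simp_all add: \<eta>' \<eta>T D.is_iso_inv_arrow)
  have \<eta>_sq: "m (far T f) \<cdot>\<^bsub>C\<^esub> \<eta> (Dom C f) = \<eta> (Cod C f) \<cdot>\<^bsub>C\<^esub> f" if f: "f \<in> Ar C" for f
    using f by (intro fully_faithful_inj[OF ff, of "Dom C f" "s (fob T (Cod C f))"])
      (simp_all add: hom_def \<eta>' m mT \<eta>T)
  have "is_natural_iso C C (id_fctr C) (comp_fctr C S T) (\<lambda>c\<in>Ob C. \<eta> c)"
    using functor_comp[OF T S] functor_id[OF C.category_axioms]
    by (auto simp: is_natural_iso_def is_natural_def \<eta>_iso \<eta> \<eta>_sq)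
  then show "is_equivalence C D T"
    unfolding is_equivalence_def using T S \<epsilon>nat by blast
qed

section \<open>Pseudo cones\<close>

lemma is_natural_isoD:
  assumes "is_natural_iso C D S T \<tau>" "a \<in> Ob C"
  shows "\<tau> a \<in> Ar D" "Dom D (\<tau> a) = fob S a" "Cod D (\<tau> a) = fob T a" "is_iso D (\<tau> a)"
  using assms by (auto simp: is_natural_iso_def is_natural_def hom_def)

context pseudo_functor
begin

lemma PC_simps:
  assumes "q \<in> hom D c d" "p \<in> hom D d e" "a \<in> Ob (PO P c)"
  shows "PC P p q a \<in> Ar (PO P e)"
    and "Dom (PO P e) (PC P p q a) = fob (PM P p) (fob (PM P q) a)"
    and "Cod (PO P e) (PC P p q a) = fob (PM P (p \<cdot> q)) a"
    and "is_iso (PO P e) (PC P p q a)"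
  using is_natural_isoD[OF PC_natural_iso[OF assms(1,2)] assms(3)] assms(3) by simp_all

lemma PC_natural:
  assumes "q \<in> hom D c d" "p \<in> hom D d e" "h \<in> Ar (PO P c)"
  shows "far (PM P (p \<cdot> q)) h \<cdot>\<^bsub>PO P e\<^esub> PC P p q (Dom (PO P c) h) =
    PC P p q (Cod (PO P c) h) \<cdot>\<^bsub>PO P e\<^esub> far (PM P p) (far (PM P q) h)"
  using PC_natural_iso[OF assms(1,2)] assms(3) by (simp add: is_natural_iso_def is_natural_def)

lemma PU_simps:
  assumes "d \<in> Ob D" "a \<in> Ob (PO P d)"
  shows "PU P d a \<in> Ar (PO P d)"
    and "Dom (PO P d) (PU P d a) = a"
    and "Cod (PO P d) (PU P d a) = fob (PM P (Idt D d)) a"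
    and "is_iso (PO P d) (PU P d a)"
  using is_natural_isoD[OF PU_natural_iso[OF assms(1)] assms(2)] assms(2) by simp_all

lemma PU_natural:
  assumes "d \<in> Ob D" "h \<in> Ar (PO P d)"
  shows "far (PM P (Idt D d)) h \<cdot>\<^bsub>PO P d\<^esub> PU P d (Dom (PO P d) h) =
    PU P d (Cod (PO P d) h) \<cdot>\<^bsub>PO P d\<^esub> h"
  using PU_natural_iso[OF assms(1)] assms(2) by (simp add: is_natural_iso_def is_natural_def)

end

section \<open>Identity transformations and the constant pseudo functor\<close>

lemma is_natural_Idt:
  assumes "is_functor C D S"
  shows "is_natural C D S S (\<lambda>a\<in>Ob C. Idt D (fob S a))"
proof -
  interpret C: category C using assms by (simp add: is_functor_def)
  interpret D: category D using assms by (simp add: is_functor_def)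
  show ?thesis
    using assms by (auto simp: is_natural_def hom_def C.cat_simps D.cat_simps functor_simps[OF assms])
qed

lemma is_natural_iso_Idt:
  assumes "is_functor C D S"
  shows "is_natural_iso C D S S (\<lambda>a\<in>Ob C. Idt D (fob S a))"
  using is_natural_Idt[OF assms] is_functor_categories[OF assms]
  by (auto simp: is_natural_iso_def category.is_iso_Idt functor_fob[OF assms])

text \<open>These are equalities of records, not mere isomorphisms, because the maps of a functor
  are extensional on the carriers.\<close>

lemma comp_fctr_id:
  assumes "is_functor C D T"
  shows "comp_fctr C T (id_fctr C) = T" "comp_fctr C (id_fctr D) T = T"
proof -
  have "fob T = (\<lambda>a\<in>Ob C. fob T a)" "far T = (\<lambda>f\<in>Ar C. far T f)"
    using assms by (auto simp: is_functor_def PiE_def extensional_restrict)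
  then have "T = \<lparr>fob = (\<lambda>a\<in>Ob C. fob T a), far = (\<lambda>f\<in>Ar C. far T f)\<rparr>"
    by (cases T) auto
  moreover have "comp_fctr C T (id_fctr C) = \<lparr>fob = (\<lambda>a\<in>Ob C. fob T a), far = (\<lambda>f\<in>Ar C. far T f)\<rparr>"
    "comp_fctr C (id_fctr D) T = \<lparr>fob = (\<lambda>a\<in>Ob C. fob T a), far = (\<lambda>f\<in>Ar C. far T f)\<rparr>"
    by (auto simp: comp_fctr_def functor_fob[OF assms] functor_far[OF assms] intro!: restrict_ext)
  ultimately show "comp_fctr C T (id_fctr C) = T" "comp_fctr C (id_fctr D) T = T"
    by simp_all
qed

lemma const_pf_simps [simp]:
  "PO (const_pf C) d = C" "PM (const_pf C) u = id_fctr C"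
  "a \<in> Ob C \<Longrightarrow> PC (const_pf C) v u a = Idt C a" "a \<in> Ob C \<Longrightarrow> PU (const_pf C) d a = Idt C a"
  by (simp_all add: const_pf_def)

lemma pseudo_functor_const_pf:
  assumes "category D" "category C"
  shows "pseudo_functor D (const_pf C)"
proof -
  interpret C: category C by fact
  have id: "is_functor C C (id_fctr C)" by (rule functor_id) fact
  have eq: "(\<lambda>a\<in>Ob C. Idt C a) = (\<lambda>a\<in>Ob C. Idt C (fob (id_fctr C) a))"
    by (auto intro!: restrict_ext)
  have "is_natural_iso C C (id_fctr C) (id_fctr C) (\<lambda>a\<in>Ob C. Idt C a)"
    unfolding eq using id by (rule is_natural_iso_Idt)
  then show ?thesis
    unfolding pseudo_functor_def pseudo_functor_axioms_def
    using assms id by (auto simp: comp_fctr_id[OF id] C.cat_simps) (simp_all add: const_pf_def)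
qed

text \<open>The axioms of a pseudo natural transformation out of \<open>const_pf C\<close> are full
  of identities coming from the constant pseudo functor; the lemmas of this locale restate them with
  these identities removed.\<close>

locale pseudo_cone = F: pseudo_functor D F + C: category C
  for D :: "('d, 'f) cat" (structure) and F :: "('d, 'f, 'o, 'm) pfctr" and C :: "('oc, 'mc) cat" +
  fixes \<alpha> :: "('d, 'f, 'oc, 'mc, 'o, 'm) ptrans"
  assumes natural: "pseudo_natural D (const_pf C) F \<alpha>"
begin

sublocale N: pseudo_natural D "const_pf C" F \<alpha>
  by (rule natural)

lemma TO_functor: "d \<in> Ob D \<Longrightarrow> is_functor C (PO F d) (TO \<alpha> d)"
  using N.TO_functor by simp

lemma TC_simps:
  assumes "u \<in> hom D d e" "c \<in> Ob C"
  shows "TC \<alpha> u c \<in> Ar (PO F e)"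
    and "Dom (PO F e) (TC \<alpha> u c) = fob (PM F u) (fob (TO \<alpha> d) c)"
    and "Cod (PO F e) (TC \<alpha> u c) = fob (TO \<alpha> e) c"
    and "is_iso (PO F e) (TC \<alpha> u c)"
  using is_natural_isoD[OF N.TC_natural_iso[OF assms(1)], of c] assms(2) by simp_all

lemma TC_natural:
  assumes "u \<in> hom D d e" "h \<in> Ar C"
  shows "far (TO \<alpha> e) h \<cdot>\<^bsub>PO F e\<^esub> TC \<alpha> u (Dom C h) =
    TC \<alpha> u (Cod C h) \<cdot>\<^bsub>PO F e\<^esub> far (PM F u) (far (TO \<alpha> d) h)"
  using N.TC_natural_iso[OF assms(1)] assms(2)
  by (simp add: is_natural_iso_def is_natural_def)

lemma TC_Idt:
  assumes "d \<in> Ob D" "c \<in> Ob C"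
  shows "TC \<alpha> (Idt D d) c \<cdot>\<^bsub>PO F d\<^esub> PU F d (fob (TO \<alpha> d) c) = Idt (PO F d) (fob (TO \<alpha> d) c)"
  using N.TC_Idt[of d c] functor_Idt[OF TO_functor] assms by simp

text \<open>In the general axiom the composition coherence of the source contributes a leading
  factor, which for a constant pseudo functor is an identity and disappears.\<close>

lemma TC_Comp:
  assumes "u \<in> hom D d e" "v \<in> hom D e k" "c \<in> Ob C"
  shows "TC \<alpha> (v \<cdot> u) c \<cdot>\<^bsub>PO F k\<^esub> PC F v u (fob (TO \<alpha> d) c) =
    TC \<alpha> v c \<cdot>\<^bsub>PO F k\<^esub> far (PM F v) (TC \<alpha> u c)"
proof -
  interpret E: category "PO F e" using F.D.hom_Ob[OF assms(1)] by (simp add: F.PO_category)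
  interpret K: category "PO F k" using F.D.hom_Ob[OF assms(2)] by (simp add: F.PO_category)
  have e: "e \<in> Ob D" "k \<in> Ob D" using F.D.hom_Ob assms by blast+
  show ?thesis
    using N.TC_Comp[of u d e v k c] assms e
    by (simp add: functor_simps[OF TO_functor] functor_simps[OF F.PM_functor[OF assms(2)]]
        TC_simps[OF assms(1)] TC_simps[OF assms(2)] K.cat_simps)
qed

end

text \<open>The coherence condition for composites is automatic when one of the factors is an identity.\<close>

lemma pseudo_coneI:
  assumes F: "pseudo_functor D F" and C: "category C"
    and ext: "TO \<alpha> \<in> extensional (Ob D)" "TC \<alpha> \<in> extensional (Ar D)"
      "\<And>u. u \<in> Ar D \<Longrightarrow> TC \<alpha> u \<in> extensional (Ob C)"
    and func: "\<And>d. d \<in> Ob D \<Longrightarrow> is_functor C (PO F d) (TO \<alpha> d)"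
    and hom: "\<And>u d e c. \<lbrakk>u \<in> hom D d e; c \<in> Ob C\<rbrakk>
      \<Longrightarrow> TC \<alpha> u c \<in> hom (PO F e) (fob (PM F u) (fob (TO \<alpha> d) c)) (fob (TO \<alpha> e) c)"
    and iso: "\<And>u d e c. \<lbrakk>u \<in> hom D d e; c \<in> Ob C\<rbrakk> \<Longrightarrow> is_iso (PO F e) (TC \<alpha> u c)"
    and nat: "\<And>u d e h. \<lbrakk>u \<in> hom D d e; h \<in> Ar C\<rbrakk> \<Longrightarrow>
      far (TO \<alpha> e) h \<cdot>\<^bsub>PO F e\<^esub> TC \<alpha> u (Dom C h) =
      TC \<alpha> u (Cod C h) \<cdot>\<^bsub>PO F e\<^esub> far (PM F u) (far (TO \<alpha> d) h)"
    and unit: "\<And>d c. \<lbrakk>d \<in> Ob D; c \<in> Ob C\<rbrakk> \<Longrightarrow>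
      TC \<alpha> (Idt D d) c \<cdot>\<^bsub>PO F d\<^esub> PU F d (fob (TO \<alpha> d) c) = Idt (PO F d) (fob (TO \<alpha> d) c)"
    and comp: "\<And>u v d e k c. \<lbrakk>u \<in> hom D d e; v \<in> hom D e k; u \<notin> Idt D ` Ob D; v \<notin> Idt D ` Ob D;
      c \<in> Ob C\<rbrakk> \<Longrightarrow> TC \<alpha> (v \<cdot>\<^bsub>D\<^esub> u) c \<cdot>\<^bsub>PO F k\<^esub> PC F v u (fob (TO \<alpha> d) c) =
        TC \<alpha> v c \<cdot>\<^bsub>PO F k\<^esub> far (PM F v) (TC \<alpha> u c)"
  shows "pseudo_cone D F C \<alpha>"
proof -
  interpret F: pseudo_functor D F by fact
  interpret C: category C by fact
  interpret const: pseudo_functor D "const_pf C"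
    using F.D.category_axioms C by (rule pseudo_functor_const_pf)
  have TC: "TC \<alpha> u c \<in> Ar (PO F e)" "Dom (PO F e) (TC \<alpha> u c) = fob (PM F u) (fob (TO \<alpha> d) c)"
    "Cod (PO F e) (TC \<alpha> u c) = fob (TO \<alpha> e) c" if "u \<in> hom D d e" "c \<in> Ob C" for u d e c
    using hom[OF that] by (simp_all add: hom_def)
  have comp_Idt: "TC \<alpha> (v \<cdot>\<^bsub>D\<^esub> Idt D d) c \<cdot>\<^bsub>PO F k\<^esub> PC F v (Idt D d) (fob (TO \<alpha> d) c) =
      TC \<alpha> v c \<cdot>\<^bsub>PO F k\<^esub> far (PM F v) (TC \<alpha> (Idt D d) c)"
    if v: "v \<in> hom D d k" and c: "c \<in> Ob C" for v d k c
  proof -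
    have d: "d \<in> Ob D" "k \<in> Ob D"
      using F.D.hom_Ob[OF v] by auto
    interpret K: category "PO F k" using d by (simp add: F.PO_category)
    have id: "Idt D d \<in> hom D d d" using d(1) by (rule F.D.Idt_in)
    let ?x = "fob (TO \<alpha> d) c"
    note [simp] = functor_simps[OF func[OF d(1)]] functor_simps[OF F.PM_functor[OF id]]
      functor_simps[OF F.PM_functor[OF v]] TC[OF id] F.PU_simps F.PC_simps[OF id v] c d
      F.D.Idt_right[OF v] K.cat_simps
    \<comment> \<open>Both sides are left inverses of the invertible arrow
      \<open>far (PM F v) (PU F d ?x)\<close>: the left one by \<open>PC_Idt_right\<close>, the
      right one by applying \<open>F\<close> at \<open>v\<close> to the unit axiom.\<close>
    have "PC F v (Idt D d) ?x = far (PM F v) (TC \<alpha> (Idt D d) c)"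
    proof (rule K.iso_cancel_right[of _ "far (PM F v) (PU F d ?x)"])
      have "far (PM F v) (TC \<alpha> (Idt D d) c) \<cdot>\<^bsub>PO F k\<^esub> far (PM F v) (PU F d ?x) =
          Idt (PO F k) (fob (PM F v) ?x)"
        using functor_Comp[OF F.PM_functor[OF v], of "PU F d ?x" "TC \<alpha> (Idt D d) c"] unit[of d c]
        by simp
      then show "PC F v (Idt D d) ?x \<cdot>\<^bsub>PO F k\<^esub> far (PM F v) (PU F d ?x) =
          far (PM F v) (TC \<alpha> (Idt D d) c) \<cdot>\<^bsub>PO F k\<^esub> far (PM F v) (PU F d ?x)"
        using F.PC_Idt_right[OF v, of ?x] by simp
      show "is_iso (PO F k) (far (PM F v) (PU F d ?x))"
        by (rule functor_is_iso[OF F.PM_functor[OF v]]) simp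
    qed simp_all
    then show ?thesis by simp
  qed
  have Idt_comp: "TC \<alpha> (Idt D k \<cdot>\<^bsub>D\<^esub> u) c \<cdot>\<^bsub>PO F k\<^esub> PC F (Idt D k) u (fob (TO \<alpha> d) c) =
      TC \<alpha> (Idt D k) c \<cdot>\<^bsub>PO F k\<^esub> far (PM F (Idt D k)) (TC \<alpha> u c)"
    if u: "u \<in> hom D d k" and c: "c \<in> Ob C" for u d k c
  proof -
    have d: "d \<in> Ob D" "k \<in> Ob D"
      using F.D.hom_Ob[OF u] by auto
    interpret K: category "PO F k" using d by (simp add: F.PO_category)
    have id: "Idt D k \<in> hom D k k" using d(2) by (rule F.D.Idt_in)
    let ?x = "fob (TO \<alpha> d) c" and ?i = "Idt D k"
    let ?\<eta> = "PU F k (fob (PM F u) ?x)"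
    note [simp] = functor_simps[OF func[OF d(1)]] functor_simps[OF func[OF d(2)]]
      functor_simps[OF F.PM_functor[OF id]] functor_simps[OF F.PM_functor[OF u]]
      TC[OF id] TC[OF u] F.PU_simps F.PC_simps[OF u id] c d F.D.Idt_left[OF u] K.cat_simps
    have l: "PC F ?i u ?x \<cdot>\<^bsub>PO F k\<^esub> ?\<eta> = Idt (PO F k) (fob (PM F u) ?x)"
      using F.PC_Idt_left[OF u, of ?x] by simp
    have r: "far (PM F ?i) (TC \<alpha> u c) \<cdot>\<^bsub>PO F k\<^esub> ?\<eta> = PU F k (fob (TO \<alpha> k) c) \<cdot>\<^bsub>PO F k\<^esub> TC \<alpha> u c"
      using F.PU_natural[of k "TC \<alpha> u c"] by simp
    \<comment> \<open>Precompose with the unit \<open>?\<eta>\<close>. The left side becomes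
      \<open>TC \<alpha> u c\<close> by \<open>PC_Idt_left\<close>. On the right, naturality of the
      unit moves it next to \<open>TC \<alpha> ?i c\<close>, where the unit axiom absorbs
      both.\<close>
    have "TC \<alpha> u c \<cdot>\<^bsub>PO F k\<^esub> PC F ?i u ?x = TC \<alpha> ?i c \<cdot>\<^bsub>PO F k\<^esub> far (PM F ?i) (TC \<alpha> u c)"
    proof (rule K.iso_cancel_right[of _ ?\<eta>])
      have "(TC \<alpha> ?i c \<cdot>\<^bsub>PO F k\<^esub> far (PM F ?i) (TC \<alpha> u c)) \<cdot>\<^bsub>PO F k\<^esub> ?\<eta> =
          (TC \<alpha> ?i c \<cdot>\<^bsub>PO F k\<^esub> PU F k (fob (TO \<alpha> k) c)) \<cdot>\<^bsub>PO F k\<^esub> TC \<alpha> u c"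
        by (simp add: r)
      also have "\<dots> = TC \<alpha> u c"
        unfolding unit[OF d(2) c] by simp
      also have "\<dots> = (TC \<alpha> u c \<cdot>\<^bsub>PO F k\<^esub> PC F ?i u ?x) \<cdot>\<^bsub>PO F k\<^esub> ?\<eta>"
        by (simp add: l)
      finally show "(TC \<alpha> u c \<cdot>\<^bsub>PO F k\<^esub> PC F ?i u ?x) \<cdot>\<^bsub>PO F k\<^esub> ?\<eta> =
        (TC \<alpha> ?i c \<cdot>\<^bsub>PO F k\<^esub> far (PM F ?i) (TC \<alpha> u c)) \<cdot>\<^bsub>PO F k\<^esub> ?\<eta>"
        by simp
    qed simp_all
    then show ?thesis by simp
  qed
  have comp': "TC \<alpha> (v \<cdot>\<^bsub>D\<^esub> u) c \<cdot>\<^bsub>PO F k\<^esub> PC F v u (fob (TO \<alpha> d) c) =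
      TC \<alpha> v c \<cdot>\<^bsub>PO F k\<^esub> far (PM F v) (TC \<alpha> u c)"
    if u: "u \<in> hom D d e" and v: "v \<in> hom D e k" and c: "c \<in> Ob C" for u v d e k c
  proof -
    have "u = Idt D e \<and> d = e" if "u \<in> Idt D ` Ob D"
      using that u by (auto simp: hom_def F.D.Dom_Idt F.D.Cod_Idt)
    moreover have "v = Idt D k \<and> e = k" if "v \<in> Idt D ` Ob D"
      using that v by (auto simp: hom_def F.D.Dom_Idt F.D.Cod_Idt)
    ultimately consider "u = Idt D e" "d = e" | "v = Idt D k" "e = k"
      | "u \<notin> Idt D ` Ob D" "v \<notin> Idt D ` Ob D"
      by blast
    then show ?thesis
    proof cases
      case 1
      then show ?thesis using comp_Idt[OF v c] by simp
    next
      case 2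
      then show ?thesis using Idt_comp[of u d k, OF _ c] u by simp
    next
      case 3
      with u v c show ?thesis by (intro comp)
    qed
  qed
  have "pseudo_natural D (const_pf C) F \<alpha>"
    unfolding pseudo_natural_def pseudo_natural_axioms_def
  proof (intro conjI allI impI F.D.category_axioms F.pseudo_functor_axioms
      const.pseudo_functor_axioms ext)
    show "is_functor (PO (const_pf C) d) (PO F d) (TO \<alpha> d)" if "d \<in> Ob D" for d
      using func[OF that] by simp
    show "is_natural_iso (PO (const_pf C) d) (PO F e) (comp_fctr (PO (const_pf C) d) (PM F u) (TO \<alpha> d))
       (comp_fctr (PO (const_pf C) d) (TO \<alpha> e) (PM (const_pf C) u)) (TC \<alpha> u)"
      if u: "u \<in> hom D d e" for u d e
    proof -
      have d: "d \<in> Ob D" "e \<in> Ob D" using F.D.hom_Ob[OF u] by auto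
      show ?thesis
        using functor_comp[OF func[OF d(1)] F.PM_functor[OF u]] func[OF d(2)] hom[OF u] iso[OF u]
          nat[OF u] ext(3)[OF hom_Ar[OF u]]
        by (auto simp: is_natural_iso_def is_natural_def comp_fctr_id[OF func[OF d(2)]] C.cat_simps)
    qed
    show "TC \<alpha> (Idt D d) a \<cdot>\<^bsub>PO F d\<^esub> PU F d (fob (TO \<alpha> d) a) =
      far (TO \<alpha> d) (PU (const_pf C) d a)" if "d \<in> Ob D" "a \<in> Ob (PO (const_pf C) d)" for d a
      using that unit[of d a] functor_Idt[OF func] by simp
    show "TC \<alpha> (v \<cdot>\<^bsub>D\<^esub> u) a \<cdot>\<^bsub>PO F k\<^esub> PC F v u (fob (TO \<alpha> d) a) =
       far (TO \<alpha> k) (PC (const_pf C) v u a) \<cdot>\<^bsub>PO F k\<^esub>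
       (TC \<alpha> v (fob (PM (const_pf C) u) a) \<cdot>\<^bsub>PO F k\<^esub> far (PM F v) (TC \<alpha> u a))"
      if u: "u \<in> hom D d e" and v: "v \<in> hom D e k" and a: "a \<in> Ob (PO (const_pf C) d)"
      for u v d e k a
    proof -
      have d: "d \<in> Ob D" "e \<in> Ob D" "k \<in> Ob D"
        using F.D.hom_Ob[OF u] F.D.hom_Ob[OF v] by auto
      interpret K: category "PO F k" using d by (simp add: F.PO_category)
      show ?thesis
        using comp'[OF u v, of a] a d functor_simps[OF func[OF d(3)]] TC[OF u] TC[OF v]
          functor_simps[OF F.PM_functor[OF v]]
        by (simp add: K.cat_simps)
    qed
  qed
  then show ?thesis
    by (intro pseudo_cone.intro pseudo_cone_axioms.intro F C)
qed

section \<open>Modifications and the functor of a pseudo cone\<close>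

locale pseudo_cone_pair = A: pseudo_cone D F C \<alpha> + B: pseudo_cone D F C \<beta>
  for D :: "('d, 'f) cat" (structure) and F :: "('d, 'f, 'o, 'm) pfctr" and C :: "('oc, 'mc) cat"
    and \<alpha> \<beta> :: "('d, 'f, 'oc, 'mc, 'o, 'm) ptrans"
begin

text \<open>The modification condition at one arrow and one object, bundled with the typing of both
  components, so that squares can be pasted and cancelled without separate typing arguments.\<close>

definition square :: "'d \<Rightarrow> 'd \<Rightarrow> 'f \<Rightarrow> 'oc \<Rightarrow> 'm \<Rightarrow> 'm \<Rightarrow> bool" where
  "square d e u c m n \<longleftrightarrow> u \<in> hom D d e \<and> c \<in> Ob C \<and>
     m \<in> hom (PO F d) (fob (TO \<alpha> d) c) (fob (TO \<beta> d) c) \<and>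
     n \<in> hom (PO F e) (fob (TO \<alpha> e) c) (fob (TO \<beta> e) c) \<and>
     n \<cdot>\<^bsub>PO F e\<^esub> TC \<alpha> u c = TC \<beta> u c \<cdot>\<^bsub>PO F e\<^esub> far (PM F u) m"

text \<open>The cell at an identity is inverse to the unit \<open>PU\<close>, so the square is the
  naturality of the unit at \<open>m\<close>, obtained after precomposing with it.\<close>

lemma square_Idt:
  assumes d: "d \<in> Ob D" and c: "c \<in> Ob C"
    and m: "m \<in> hom (PO F d) (fob (TO \<alpha> d) c) (fob (TO \<beta> d) c)"
  shows "square d d (Idt D d) c m m"
proof -
  interpret d: category "PO F d" using d by (rule A.F.PO_category)
  have id: "Idt D d \<in> hom D d d" using d by (rule A.F.D.Idt_in)
  have [simp]: "m \<in> Ar (PO F d)" "Dom (PO F d) m = fob (TO \<alpha> d) c" "Cod (PO F d) m = fob (TO \<beta> d) c"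
    using m by (simp_all add: hom_def)
  let ?x = "fob (TO \<alpha> d) c" and ?y = "fob (TO \<beta> d) c"
  note [simp] = d c d.cat_simps A.TC_simps[OF id] B.TC_simps[OF id] A.F.PU_simps
    functor_simps[OF A.F.PM_functor[OF id]] functor_simps[OF A.TO_functor[OF d]]
    functor_simps[OF B.TO_functor[OF d]]
  have "(m \<cdot>\<^bsub>PO F d\<^esub> TC \<alpha> (Idt D d) c) \<cdot>\<^bsub>PO F d\<^esub> PU F d ?x =
      (TC \<beta> (Idt D d) c \<cdot>\<^bsub>PO F d\<^esub> PU F d ?y) \<cdot>\<^bsub>PO F d\<^esub> m"
    using A.TC_Idt[OF d c] B.TC_Idt[OF d c] by simp
  also have "\<dots> = (TC \<beta> (Idt D d) c \<cdot>\<^bsub>PO F d\<^esub> far (PM F (Idt D d)) m) \<cdot>\<^bsub>PO F d\<^esub> PU F d ?x"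
    using A.F.PU_natural[OF d, of m] by simp
  finally have "m \<cdot>\<^bsub>PO F d\<^esub> TC \<alpha> (Idt D d) c = TC \<beta> (Idt D d) c \<cdot>\<^bsub>PO F d\<^esub> far (PM F (Idt D d)) m"
    by (rule d.iso_cancel_right) simp_all
  then show ?thesis using id m by (simp add: square_def)
qed

text \<open>Pasting law. The equation for the composite precomposed with \<open>PC F v u\<close>,
  and the equation for \<open>v\<close> precomposed with the image of \<open>TC \<alpha> u c\<close>
  under \<open>v\<close>, have the same two sides. Both of these arrows are invertible, so the law
  works in both directions, and a square over \<open>v\<close> can be extracted from one over the
  composite.\<close>

lemma square_Comp_iff:
  assumes sq: "square d e u c m n" and v: "v \<in> hom D e k"
    and p: "p \<in> hom (PO F k) (fob (TO \<alpha> k) c) (fob (TO \<beta> k) c)"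
  shows "square d k (v \<cdot> u) c m p \<longleftrightarrow> square e k v c n p"
proof -
  have u: "u \<in> hom D d e" and c: "c \<in> Ob C"
    using sq by (simp_all add: square_def)
  have d: "d \<in> Ob D" "e \<in> Ob D" "k \<in> Ob D"
    using A.F.D.hom_Ob[OF u] A.F.D.hom_Ob[OF v] by auto
  interpret e: category "PO F e" using d by (simp add: A.F.PO_category)
  interpret k: category "PO F k" using d by (simp add: A.F.PO_category)
  have vu: "v \<cdot> u \<in> hom D d k" using u v by (rule A.F.D.Comp_in)
  have [simp]: "m \<in> Ar (PO F d)" "Dom (PO F d) m = fob (TO \<alpha> d) c" "Cod (PO F d) m = fob (TO \<beta> d) c"
    "n \<in> Ar (PO F e)" "Dom (PO F e) n = fob (TO \<alpha> e) c" "Cod (PO F e) n = fob (TO \<beta> e) c"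
    "p \<in> Ar (PO F k)" "Dom (PO F k) p = fob (TO \<alpha> k) c" "Cod (PO F k) p = fob (TO \<beta> k) c"
    using sq p by (simp_all add: square_def hom_def)
  have sq1: "n \<cdot>\<^bsub>PO F e\<^esub> TC \<alpha> u c = TC \<beta> u c \<cdot>\<^bsub>PO F e\<^esub> far (PM F u) m"
    using sq by (simp add: square_def)
  note [simp] = d c e.cat_simps k.cat_simps A.TC_simps[OF u] B.TC_simps[OF u] A.TC_simps[OF v]
    B.TC_simps[OF v] A.TC_simps[OF vu] B.TC_simps[OF vu] A.F.PC_simps[OF u v]
    functor_simps[OF A.F.PM_functor[OF u]] functor_simps[OF A.F.PM_functor[OF v]]
    functor_simps[OF A.F.PM_functor[OF vu]] functor_is_iso[OF A.F.PM_functor[OF v]]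
    functor_simps[OF A.TO_functor[OF d(1)]] functor_simps[OF B.TO_functor[OF d(1)]]
    functor_simps[OF A.TO_functor[OF d(2)]] functor_simps[OF B.TO_functor[OF d(2)]]
    functor_simps[OF A.TO_functor[OF d(3)]] functor_simps[OF B.TO_functor[OF d(3)]]
  let ?x = "fob (TO \<alpha> d) c" and ?y = "fob (TO \<beta> d) c"
  let ?v = "far (PM F v)" and ?u = "far (PM F u)"
  have left: "(p \<cdot>\<^bsub>PO F k\<^esub> TC \<alpha> (v \<cdot> u) c) \<cdot>\<^bsub>PO F k\<^esub> PC F v u ?x =
      (p \<cdot>\<^bsub>PO F k\<^esub> TC \<alpha> v c) \<cdot>\<^bsub>PO F k\<^esub> ?v (TC \<alpha> u c)"
    using A.TC_Comp[OF u v c] by simp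
  have "(TC \<beta> v c \<cdot>\<^bsub>PO F k\<^esub> ?v n) \<cdot>\<^bsub>PO F k\<^esub> ?v (TC \<alpha> u c) =
      TC \<beta> v c \<cdot>\<^bsub>PO F k\<^esub> ?v (n \<cdot>\<^bsub>PO F e\<^esub> TC \<alpha> u c)"
    by simp
  also have "\<dots> = (TC \<beta> v c \<cdot>\<^bsub>PO F k\<^esub> ?v (TC \<beta> u c)) \<cdot>\<^bsub>PO F k\<^esub> ?v (?u m)"
    unfolding sq1 by simp
  also have "\<dots> = TC \<beta> (v \<cdot> u) c \<cdot>\<^bsub>PO F k\<^esub> (PC F v u ?y \<cdot>\<^bsub>PO F k\<^esub> ?v (?u m))"
    unfolding B.TC_Comp[OF u v c, symmetric] by simp
  also have "PC F v u ?y \<cdot>\<^bsub>PO F k\<^esub> ?v (?u m) = far (PM F (v \<cdot> u)) m \<cdot>\<^bsub>PO F k\<^esub> PC F v u ?x"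
    using A.F.PC_natural[OF u v, of m] by simp
  finally have right: "(TC \<beta> (v \<cdot> u) c \<cdot>\<^bsub>PO F k\<^esub> far (PM F (v \<cdot> u)) m) \<cdot>\<^bsub>PO F k\<^esub> PC F v u ?x =
      (TC \<beta> v c \<cdot>\<^bsub>PO F k\<^esub> ?v n) \<cdot>\<^bsub>PO F k\<^esub> ?v (TC \<alpha> u c)"
    by simp
  have "p \<cdot>\<^bsub>PO F k\<^esub> TC \<alpha> (v \<cdot> u) c = TC \<beta> (v \<cdot> u) c \<cdot>\<^bsub>PO F k\<^esub> far (PM F (v \<cdot> u)) m \<longleftrightarrow>
      p \<cdot>\<^bsub>PO F k\<^esub> TC \<alpha> v c = TC \<beta> v c \<cdot>\<^bsub>PO F k\<^esub> ?v n"
  proof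
    assume "p \<cdot>\<^bsub>PO F k\<^esub> TC \<alpha> (v \<cdot> u) c = TC \<beta> (v \<cdot> u) c \<cdot>\<^bsub>PO F k\<^esub> far (PM F (v \<cdot> u)) m"
    then have "(p \<cdot>\<^bsub>PO F k\<^esub> TC \<alpha> v c) \<cdot>\<^bsub>PO F k\<^esub> ?v (TC \<alpha> u c) =
        (TC \<beta> v c \<cdot>\<^bsub>PO F k\<^esub> ?v n) \<cdot>\<^bsub>PO F k\<^esub> ?v (TC \<alpha> u c)"
      unfolding left[symmetric] right[symmetric] by (rule arg_cong)
    then show "p \<cdot>\<^bsub>PO F k\<^esub> TC \<alpha> v c = TC \<beta> v c \<cdot>\<^bsub>PO F k\<^esub> ?v n"
      by (rule k.iso_cancel_right) simp_all
  next
    assume "p \<cdot>\<^bsub>PO F k\<^esub> TC \<alpha> v c = TC \<beta> v c \<cdot>\<^bsub>PO F k\<^esub> ?v n"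
    then have "(p \<cdot>\<^bsub>PO F k\<^esub> TC \<alpha> (v \<cdot> u) c) \<cdot>\<^bsub>PO F k\<^esub> PC F v u ?x =
        (TC \<beta> (v \<cdot> u) c \<cdot>\<^bsub>PO F k\<^esub> far (PM F (v \<cdot> u)) m) \<cdot>\<^bsub>PO F k\<^esub> PC F v u ?x"
      unfolding left right by (rule arg_cong)
    then show "p \<cdot>\<^bsub>PO F k\<^esub> TC \<alpha> (v \<cdot> u) c = TC \<beta> (v \<cdot> u) c \<cdot>\<^bsub>PO F k\<^esub> far (PM F (v \<cdot> u)) m"
      by (rule k.iso_cancel_right) simp_all
  qed
  then show ?thesis
    using sq u v vu p by (simp add: square_def)
qed

lemma modificationI:
  assumes "\<mu> \<in> extensional (Ob D)" "\<And>d. d \<in> Ob D \<Longrightarrow> \<mu> d \<in> extensional (Ob C)"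
    and "\<And>d h. \<lbrakk>d \<in> Ob D; h \<in> Ar C\<rbrakk> \<Longrightarrow> far (TO \<beta> d) h \<cdot>\<^bsub>PO F d\<^esub> \<mu> d (Dom C h) =
      \<mu> d (Cod C h) \<cdot>\<^bsub>PO F d\<^esub> far (TO \<alpha> d) h"
    and sq: "\<And>u d e c. \<lbrakk>u \<in> hom D d e; c \<in> Ob C\<rbrakk> \<Longrightarrow> square d e u c (\<mu> d c) (\<mu> e c)"
  shows "is_modification D (const_pf C) F \<alpha> \<beta> \<mu>"
proof -
  \<comment> \<open>The square at the identity of \<open>d\<close> contains the typing of the
    component.\<close>
  have "\<mu> d c \<in> hom (PO F d) (fob (TO \<alpha> d) c) (fob (TO \<beta> d) c)" if "d \<in> Ob D" "c \<in> Ob C" for d c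
    using sq[OF A.F.D.Idt_in[OF that(1)] that(2)] by (simp add: square_def)
  then show ?thesis
    using assms(1-3) sq unfolding is_modification_def is_natural_def square_def
    by (simp add: A.natural B.natural A.TO_functor B.TO_functor)
qed

end

lemma modificationD:
  assumes "is_modification D (const_pf C) F \<alpha> \<beta> \<mu>"
  shows "pseudo_natural D (const_pf C) F \<alpha>" "pseudo_natural D (const_pf C) F \<beta>"
    and "\<mu> \<in> extensional (Ob D)" "\<And>d. d \<in> Ob D \<Longrightarrow> \<mu> d \<in> extensional (Ob C)"
    and "\<And>d. d \<in> Ob D \<Longrightarrow> is_natural C (PO F d) (TO \<alpha> d) (TO \<beta> d) (\<mu> d)"
  using assms by (auto simp: is_modification_def is_natural_def)

lemma (in pseudo_cone_pair) modification_square: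
  assumes "is_modification D (const_pf C) F \<alpha> \<beta> \<mu>" "u \<in> hom D d e" "c \<in> Ob C"
  shows "square d e u c (\<mu> d c) (\<mu> e c)"
  using assms A.F.D.hom_Ob[OF assms(2)] natural_hom[OF modificationD(5)[OF assms(1)]]
  by (simp add: is_modification_def square_def)

lemma pseudo_coneI':
  "\<lbrakk>pseudo_functor D F; category C; pseudo_natural D (const_pf C) F \<alpha>\<rbrakk> \<Longrightarrow> pseudo_cone D F C \<alpha>"
  by (intro pseudo_cone.intro pseudo_cone_axioms.intro)

section \<open>Functor categories and categories of pseudo cones\<close>

lemma is_natural_Comp:
  assumes \<tau>: "is_natural C D S T \<tau>" and \<sigma>: "is_natural C D T U \<sigma>"
  shows "is_natural C D S U (\<lambda>a\<in>Ob C. \<sigma> a \<cdot>\<^bsub>D\<^esub> \<tau> a)"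
proof -
  have S: "is_functor C D S" and T: "is_functor C D T" and U: "is_functor C D U"
    using assms by (auto simp: is_natural_def)
  interpret C: category C using S by (simp add: is_functor_def)
  interpret D: category D using S by (simp add: is_functor_def)
  have [simp]: "\<tau> a \<in> Ar D" "Dom D (\<tau> a) = fob S a" "Cod D (\<tau> a) = fob T a"
    "\<sigma> a \<in> Ar D" "Dom D (\<sigma> a) = fob T a" "Cod D (\<sigma> a) = fob U a" if "a \<in> Ob C" for a
    using natural_hom[OF \<tau> that] natural_hom[OF \<sigma> that] by (simp_all add: hom_def)
  have "far U f \<cdot>\<^bsub>D\<^esub> (\<sigma> (Dom C f) \<cdot>\<^bsub>D\<^esub> \<tau> (Dom C f)) = (\<sigma> (Cod C f) \<cdot>\<^bsub>D\<^esub> \<tau> (Cod C f)) \<cdot>\<^bsub>D\<^esub> far S f"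
    if f: "f \<in> Ar C" for f
  proof -
    note [simp] = f C.cat_simps D.cat_simps functor_simps[OF S] functor_simps[OF T] functor_simps[OF U]
    have "far U f \<cdot>\<^bsub>D\<^esub> (\<sigma> (Dom C f) \<cdot>\<^bsub>D\<^esub> \<tau> (Dom C f)) = (far U f \<cdot>\<^bsub>D\<^esub> \<sigma> (Dom C f)) \<cdot>\<^bsub>D\<^esub> \<tau> (Dom C f)"
      by simp
    also have "\<dots> = \<sigma> (Cod C f) \<cdot>\<^bsub>D\<^esub> (far T f \<cdot>\<^bsub>D\<^esub> \<tau> (Dom C f))"
      unfolding natural_square[OF \<sigma> f] by simp
    also have "\<dots> = (\<sigma> (Cod C f) \<cdot>\<^bsub>D\<^esub> \<tau> (Cod C f)) \<cdot>\<^bsub>D\<^esub> far S f"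
      unfolding natural_square[OF \<tau> f] by simp
    finally show ?thesis .
  qed
  then show ?thesis
    using S U by (auto simp: is_natural_def hom_def C.cat_simps D.cat_simps)
qed

lemma category_functor_cat:
  assumes "category C" "category D"
  shows "category (functor_cat C D)"
proof -
  interpret D: category D by fact
  have [simp]: "\<tau> a \<in> Ar D" "Dom D (\<tau> a) = fob S a" "Cod D (\<tau> a) = fob T a"
    if "is_natural C D S T \<tau>" "a \<in> Ob C" for S T \<tau> a
    using natural_hom[OF that] by (simp_all add: hom_def)
  have [simp]: "restrict \<tau> (Ob C) = \<tau>" if "is_natural C D S T \<tau>" for S T \<tau>
    using natural_extensional[OF that] by (rule extensional_restrict)
  \<comment> \<open>The unit laws equate a freshly restricted family with a given one; this holds
    because natural transformations are extensional on the objects.\<close>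
  have eqI: "(\<lambda>a\<in>Ob C. \<sigma> a) = \<tau>"
    if "is_natural C D S T \<tau>" "\<And>a. a \<in> Ob C \<Longrightarrow> \<sigma> a = \<tau> a" for S T \<sigma> \<tau>
    using natural_extensional[OF that(1)] that(2) by (intro extensionalityI[of _ "Ob C"]) auto
  show ?thesis
    by unfold_locales
      (auto simp: functor_cat_def hom_def natural_functors functor_fob D.cat_simps
        intro!: is_natural_Idt is_natural_Comp restrict_ext eqI)
qed

text \<open>The squares of \<mu> and \<nu> over the same \<open>u\<close> are stacked along the
  common cell \<open>TC \<beta> u c\<close>.\<close>

lemma modification_Comp:
  assumes F: "pseudo_functor D F" and C: "category C"
    and \<mu>: "is_modification D (const_pf C) F \<alpha> \<beta> \<mu>"
    and \<nu>: "is_modification D (const_pf C) F \<beta> \<gamma> \<nu>"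
  shows "is_modification D (const_pf C) F \<alpha> \<gamma> (\<lambda>d\<in>Ob D. \<lambda>c\<in>Ob C. \<nu> d c \<cdot>\<^bsub>PO F d\<^esub> \<mu> d c)"
proof -
  interpret AB: pseudo_cone_pair D F C \<alpha> \<beta>
    using pseudo_coneI'[OF F C] modificationD(1,2)[OF \<mu>] by (intro pseudo_cone_pair.intro)
  interpret BC: pseudo_cone_pair D F C \<beta> \<gamma>
    using pseudo_coneI'[OF F C] modificationD(1,2)[OF \<nu>] by (intro pseudo_cone_pair.intro)
  interpret AC: pseudo_cone_pair D F C \<alpha> \<gamma> ..
  note nat = is_natural_Comp[OF modificationD(5)[OF \<mu>] modificationD(5)[OF \<nu>]]
  show ?thesis
  proof (rule AC.modificationI)
    show "far (TO \<gamma> d) h \<cdot>\<^bsub>PO F d\<^esub> (\<lambda>d\<in>Ob D. \<lambda>c\<in>Ob C. \<nu> d c \<cdot>\<^bsub>PO F d\<^esub> \<mu> d c) d (Dom C h) =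
        (\<lambda>d\<in>Ob D. \<lambda>c\<in>Ob C. \<nu> d c \<cdot>\<^bsub>PO F d\<^esub> \<mu> d c) d (Cod C h) \<cdot>\<^bsub>PO F d\<^esub> far (TO \<alpha> d) h"
      if "d \<in> Ob D" "h \<in> Ar C" for d h
      using natural_square[OF nat, of d h] that by simp
    fix u d e c
    assume u: "u \<in> hom D d e" and c: "c \<in> Ob C"
    have d: "d \<in> Ob D" "e \<in> Ob D" using AB.A.F.D.hom_Ob[OF u] by auto
    interpret d: category "PO F d" using d by (simp add: AB.A.F.PO_category)
    interpret e: category "PO F e" using d by (simp add: AB.A.F.PO_category)
    have sq: "AB.square d e u c (\<mu> d c) (\<mu> e c)" "BC.square d e u c (\<nu> d c) (\<nu> e c)"
      using AB.modification_square[OF \<mu> u c] BC.modification_square[OF \<nu> u c] by auto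
    then have sq1: "\<mu> e c \<cdot>\<^bsub>PO F e\<^esub> TC \<alpha> u c = TC \<beta> u c \<cdot>\<^bsub>PO F e\<^esub> far (PM F u) (\<mu> d c)"
      and sq2: "\<nu> e c \<cdot>\<^bsub>PO F e\<^esub> TC \<beta> u c = TC \<gamma> u c \<cdot>\<^bsub>PO F e\<^esub> far (PM F u) (\<nu> d c)"
      by (auto simp: AB.square_def BC.square_def)
    have [simp]: "\<mu> d c \<in> Ar (PO F d)" "\<mu> e c \<in> Ar (PO F e)" "\<nu> d c \<in> Ar (PO F d)" "\<nu> e c \<in> Ar (PO F e)"
      "Dom (PO F d) (\<mu> d c) = fob (TO \<alpha> d) c" "Cod (PO F d) (\<mu> d c) = fob (TO \<beta> d) c"
      "Dom (PO F e) (\<mu> e c) = fob (TO \<alpha> e) c" "Cod (PO F e) (\<mu> e c) = fob (TO \<beta> e) c"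
      "Dom (PO F d) (\<nu> d c) = fob (TO \<beta> d) c" "Cod (PO F d) (\<nu> d c) = fob (TO \<gamma> d) c"
      "Dom (PO F e) (\<nu> e c) = fob (TO \<beta> e) c" "Cod (PO F e) (\<nu> e c) = fob (TO \<gamma> e) c"
      using sq by (auto simp: AB.square_def BC.square_def hom_def)
    note [simp] = c d d.cat_simps e.cat_simps AB.A.TC_simps[OF u] AB.B.TC_simps[OF u]
      BC.B.TC_simps[OF u] functor_simps[OF AB.A.F.PM_functor[OF u]]
    have "(\<nu> e c \<cdot>\<^bsub>PO F e\<^esub> \<mu> e c) \<cdot>\<^bsub>PO F e\<^esub> TC \<alpha> u c = (\<nu> e c \<cdot>\<^bsub>PO F e\<^esub> TC \<beta> u c) \<cdot>\<^bsub>PO F e\<^esub> far (PM F u) (\<mu> d c)"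
      by (simp add: sq1)
    also have "\<dots> = TC \<gamma> u c \<cdot>\<^bsub>PO F e\<^esub> far (PM F u) (\<nu> d c \<cdot>\<^bsub>PO F d\<^esub> \<mu> d c)"
      unfolding sq2 by simp
    finally show "AC.square d e u c ((\<lambda>d\<in>Ob D. \<lambda>c\<in>Ob C. \<nu> d c \<cdot>\<^bsub>PO F d\<^esub> \<mu> d c) d c)
        ((\<lambda>d\<in>Ob D. \<lambda>c\<in>Ob C. \<nu> d c \<cdot>\<^bsub>PO F d\<^esub> \<mu> d c) e c)"
      using u by (simp add: AC.square_def hom_def)
  qed auto
qed

lemma modification_Idt:
  assumes "pseudo_cone D F C \<alpha>"
  shows "is_modification D (const_pf C) F \<alpha> \<alpha>
    (\<lambda>d\<in>Ob D. \<lambda>c\<in>Ob C. Idt (PO F d) (fob (TO \<alpha> d) c))"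
proof -
  interpret A: pseudo_cone_pair D F C \<alpha> \<alpha>
    using assms by (intro pseudo_cone_pair.intro)
  show ?thesis
  proof (rule A.modificationI)
    show "far (TO \<alpha> d) h \<cdot>\<^bsub>PO F d\<^esub> (\<lambda>d\<in>Ob D. \<lambda>c\<in>Ob C. Idt (PO F d) (fob (TO \<alpha> d) c)) d (Dom C h) =
        (\<lambda>d\<in>Ob D. \<lambda>c\<in>Ob C. Idt (PO F d) (fob (TO \<alpha> d) c)) d (Cod C h) \<cdot>\<^bsub>PO F d\<^esub> far (TO \<alpha> d) h"
      if "d \<in> Ob D" "h \<in> Ar C" for d h
      using natural_square[OF is_natural_Idt[OF A.A.TO_functor], of d h] that by simp
    fix u d e c
    assume u: "u \<in> hom D d e" and c: "c \<in> Ob C"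
    have d: "d \<in> Ob D" "e \<in> Ob D" using A.A.F.D.hom_Ob[OF u] by auto
    interpret d: category "PO F d" using d by (simp add: A.A.F.PO_category)
    interpret e: category "PO F e" using d by (simp add: A.A.F.PO_category)
    show "A.square d e u c ((\<lambda>d\<in>Ob D. \<lambda>c\<in>Ob C. Idt (PO F d) (fob (TO \<alpha> d) c)) d c)
        ((\<lambda>d\<in>Ob D. \<lambda>c\<in>Ob C. Idt (PO F d) (fob (TO \<alpha> d) c)) e c)"
      using c d u by (simp add: A.square_def d.Idt_in e.Idt_in functor_simps[OF A.A.TO_functor]
          functor_simps[OF A.A.F.PM_functor[OF u]] e.cat_simps A.A.TC_simps[OF u])
  qed auto
qed

lemma category_pseudo_cone_cat:
  assumes F: "pseudo_functor D F" and C: "category C"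
  shows "category (pseudo_cone_cat D C F)"
proof -
  have PO: "category (PO F d)" if "d \<in> Ob D" for d
    using F that by (rule pseudo_functor.PO_category)
  have [simp]: "\<mu> d a \<in> Ar (PO F d)" "Dom (PO F d) (\<mu> d a) = fob (TO \<alpha> d) a"
    "Cod (PO F d) (\<mu> d a) = fob (TO \<beta> d) a"
    if "is_modification D (const_pf C) F \<alpha> \<beta> \<mu>" "d \<in> Ob D" "a \<in> Ob C" for \<alpha> \<beta> \<mu> d a
    using natural_hom[OF modificationD(5)[OF that(1,2)] that(3)] by (simp_all add: hom_def)
  have eqI: "(\<lambda>d\<in>Ob D. \<lambda>a\<in>Ob C. \<sigma> d a) = \<mu>"
    if \<mu>: "is_modification D (const_pf C) F \<alpha> \<beta> \<mu>"
      and eq: "\<And>d a. \<lbrakk>d \<in> Ob D; a \<in> Ob C\<rbrakk> \<Longrightarrow> \<sigma> d a = \<mu> d a"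
    for \<sigma> \<mu> \<alpha> \<beta>
  proof (rule extensionalityI[of _ "Ob D"])
    show "(\<lambda>d\<in>Ob D. \<lambda>a\<in>Ob C. \<sigma> d a) d = \<mu> d" if d: "d \<in> Ob D" for d
      using d modificationD(4)[OF \<mu> d] eq[OF d] by (intro extensionalityI[of _ "Ob C"]) auto
  qed (use modificationD(3)[OF \<mu>] in auto)
  show ?thesis
    unfolding pseudo_cone_cat_def pseudo_nat_cat_def
    by unfold_locales
      (auto simp: hom_def modificationD category.assoc[OF PO] category.left_unit[OF PO]
        category.right_unit[OF PO] category.Ar_Comp[OF PO] category.Dom_Comp[OF PO]
        category.Cod_Comp[OF PO]
        intro!: modification_Idt modification_Comp[OF F C] restrict_ext eqI pseudo_coneI'[OF F C])
qed

section \<open>Composition with a pseudo cone\<close>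

context pseudo_cone
begin

text \<open>Every axiom for the composite at \<open>c\<close> is the axiom for \<alpha> at
  \<open>fob H c\<close>, and naturality along \<open>h\<close> is naturality of \<alpha> along
  \<open>far H h\<close>.\<close>

lemma pseudo_cone_cone_after:
  assumes H: "is_functor E C H"
  shows "pseudo_cone D F E (cone_after D C \<alpha> E H)"
proof -
  interpret E: category E using H by (simp add: is_functor_def)
  have u_Ob: "d \<in> Ob D" "e \<in> Ob D" "u \<in> Ar D" if "u \<in> hom D d e" for u d e
    using F.D.hom_Ob[OF that] hom_Ar[OF that] by auto
  note [simp] = functor_simps[OF H] E.cat_simps
  show ?thesis
  proof (rule pseudo_coneI[OF F.pseudo_functor_axioms E.category_axioms])
    show "is_functor E (PO F d) (TO (cone_after D C \<alpha> E H) d)" if "d \<in> Ob D" for d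
      using that functor_comp[OF H TO_functor[OF that]] by (simp add: cone_after_def)
    show "TC (cone_after D C \<alpha> E H) (v \<cdot>\<^bsub>D\<^esub> u) c \<cdot>\<^bsub>PO F k\<^esub>
        PC F v u (fob (TO (cone_after D C \<alpha> E H) d) c) =
        TC (cone_after D C \<alpha> E H) v c \<cdot>\<^bsub>PO F k\<^esub> far (PM F v) (TC (cone_after D C \<alpha> E H) u c)"
      if "u \<in> hom D d e" "v \<in> hom D e k" "c \<in> Ob E" for u v d e k c
      using that TC_Comp[OF that(1,2), of "fob H c"] u_Ob[OF that(1)] u_Ob[OF that(2)]
        u_Ob[OF F.D.Comp_in[OF that(1,2)]]
      by (simp add: cone_after_def)
    show "far (TO (cone_after D C \<alpha> E H) e) h \<cdot>\<^bsub>PO F e\<^esub> TC (cone_after D C \<alpha> E H) u (Dom E h) =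
      TC (cone_after D C \<alpha> E H) u (Cod E h) \<cdot>\<^bsub>PO F e\<^esub>
      far (PM F u) (far (TO (cone_after D C \<alpha> E H) d) h)"
      if "u \<in> hom D d e" "h \<in> Ar E" for u d e h
      using that TC_natural[OF that(1), of "far H h"] u_Ob[OF that(1)]
      by (simp add: cone_after_def)
  qed (auto simp: cone_after_def TC_simps TC_Idt u_Ob F.D.Ar_Idt hom_def[of "PO F _"])
qed

text \<open>The two conditions exchange roles: the square over \<open>u\<close> is the naturality of
  the cell \<open>TC \<alpha> u\<close> at the arrow \<open>\<theta> c\<close>, and naturality in
  the object is the naturality of \<theta> mapped by the legs of \<alpha>.\<close>

lemma modification_cone_after:
  assumes \<theta>: "is_natural E C H H' \<theta>"
  shows "is_modification D (const_pf E) F (cone_after D C \<alpha> E H) (cone_after D C \<alpha> E H')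
    (\<lambda>d\<in>Ob D. \<lambda>c\<in>Ob E. far (TO \<alpha> d) (\<theta> c))"
proof -
  have H: "is_functor E C H" "is_functor E C H'"
    using \<theta> by (auto simp: is_natural_def)
  interpret E: category E using H by (simp add: is_functor_def)
  have [simp]: "\<theta> c \<in> Ar C" "Dom C (\<theta> c) = fob H c" "Cod C (\<theta> c) = fob H' c" if "c \<in> Ob E" for c
    using natural_hom[OF \<theta> that] by (simp_all add: hom_def)
  interpret AB: pseudo_cone_pair D F E "cone_after D C \<alpha> E H" "cone_after D C \<alpha> E H'"
    using H by (intro pseudo_cone_pair.intro pseudo_cone_cone_after)
  note [simp] = functor_simps[OF H(1)] functor_simps[OF H(2)] E.cat_simps functor_simps[OF TO_functor]
  show ?thesis
  proof (rule AB.modificationI)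
    show "far (TO (cone_after D C \<alpha> E H') d) h \<cdot>\<^bsub>PO F d\<^esub> (\<lambda>d\<in>Ob D. \<lambda>c\<in>Ob E. far (TO \<alpha> d) (\<theta> c)) d (Dom E h) =
      (\<lambda>d\<in>Ob D. \<lambda>c\<in>Ob E. far (TO \<alpha> d) (\<theta> c)) d (Cod E h) \<cdot>\<^bsub>PO F d\<^esub> far (TO (cone_after D C \<alpha> E H) d) h"
      if "d \<in> Ob D" "h \<in> Ar E" for d h
      using that functor_Comp[OF TO_functor, of d "\<theta> (Dom E h)" "far H' h"]
        functor_Comp[OF TO_functor, of d "far H h" "\<theta> (Cod E h)"]
      by (simp add: cone_after_def natural_square[OF \<theta>] del: functor_Comp)
    fix u d e c
    assume u: "u \<in> hom D d e" and c: "c \<in> Ob E"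
    have "d \<in> Ob D" "e \<in> Ob D" "u \<in> Ar D"
      using F.D.hom_Ob[OF u] hom_Ar[OF u] by auto
    then show "AB.square d e u c ((\<lambda>d\<in>Ob D. \<lambda>c\<in>Ob E. far (TO \<alpha> d) (\<theta> c)) d c)
        ((\<lambda>d\<in>Ob D. \<lambda>c\<in>Ob E. far (TO \<alpha> d) (\<theta> c)) e c)"
      using u c TC_natural[OF u, of "\<theta> c"]
      unfolding AB.square_def by (simp add: cone_after_def hom_def[of "PO F _"])
  qed auto
qed

lemma functor_cone_functor:
  assumes E: "category E"
  shows "is_functor (functor_cat E C) (pseudo_cone_cat D E F) (cone_functor D C \<alpha> E)"
proof -
  interpret fc: category "functor_cat E C"
    using E C.category_axioms by (rule category_functor_cat)
  interpret pc: category "pseudo_cone_cat D E F"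
    using F.pseudo_functor_axioms E by (rule category_pseudo_cone_cat)
  have nat: "pseudo_natural D (const_pf E) F (cone_after D C \<alpha> E H)" if "is_functor E C H" for H
    using pseudo_cone_cone_after[OF that] by (simp add: pseudo_cone.natural)
  have [simp]: "\<tau> a \<in> Ar C" "Dom C (\<tau> a) = fob S a" "Cod C (\<tau> a) = fob T a"
    if "is_natural E C S T \<tau>" "a \<in> Ob E" for S T \<tau> a
    using natural_hom[OF that] by (simp_all add: hom_def)
  have [simp]: "fob (TO (cone_after D C \<alpha> E H) d) c = fob (TO \<alpha> d) (fob H c)"
    if "d \<in> Ob D" "c \<in> Ob E" for H d c
    using that by (simp add: cone_after_def)
  show ?thesis
    unfolding is_functor_def
  proof (intro conjI fc.category_axioms pc.category_axioms)
  qed (auto simp: cone_functor_def functor_cat_def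
        pseudo_cone_cat_def pseudo_nat_cat_def nat functor_simps[OF TO_functor] functor_fob
        is_natural_Idt natural_functors modification_cone_after is_natural_Comp
        intro!: restrict_ext)
qed

end

section \<open>Pseudo cones over \<open>\<J>\<close> and cocycles\<close>

lemma Ob_J [simp]: "Ob \<J> = UNIV" and Ar_J [simp]: "Ar \<J> = UNIV" and Dom_J [simp]: "Dom \<J> = jdom"
  and Cod_J [simp]: "Cod \<J> = jcod" and Idt_J [simp]: "Idt \<J> = jid" and Comp_J: "Comp \<J> = jcomp"
  by (simp_all add: \<J>_def)

lemma range_jid: "range jid = {IdX, IdY, IdZ}"
proof -
  have UNIV_eq: "UNIV = {JX, JY, JZ}" using jobj.exhaust by auto
  show ?thesis unfolding UNIV_eq by simp
qed

text \<open>Three consecutive steps up cannot fit between X and Z. Hence any three composable arrows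
  include an identity, which settles associativity both for \<J> and for the coherence of the pseudo
  functor of a cover.\<close>

lemma nonidentity_ends: "u \<notin> range jid \<Longrightarrow> jdom u \<noteq> JZ \<and> jcod u \<noteq> JX \<and> jdom u \<noteq> jcod u"
  unfolding range_jid by (cases u) auto

lemma composable_nonidentities:
  assumes "jdom v = jcod u" "u \<notin> range jid" "v \<notin> range jid"
  shows "(v, u) \<in> {(F12, F1), (F12, F2), (F13, F1), (F13, F2), (F23, F1), (F23, F2)}"
  using assms unfolding range_jid by (cases u) (cases v; simp)+

lemma hom_J: "u \<in> hom \<J> d e \<longleftrightarrow> jdom u = d \<and> jcod u = e"
  by (simp add: hom_def)

lemma category_J: "category \<J>"
proof -
  have comp: "g \<cdot>\<^bsub>\<J>\<^esub> f \<in> hom \<J> a c" if "f \<in> hom \<J> a b" "g \<in> hom \<J> b c" for f g a b c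
    using that by (cases f; cases g) (auto simp: hom_J Comp_J jcomp_def range_jid)
  have right: "g \<cdot>\<^bsub>\<J>\<^esub> f = g" if "f \<in> range jid" for f g
    using that by (simp add: Comp_J jcomp_def)
  have left: "g \<cdot>\<^bsub>\<J>\<^esub> f = f" if "g \<in> range jid" "f \<in> hom \<J> a b" "g \<in> hom \<J> b c" for f g a b c
    using that unfolding range_jid by (cases f) (auto simp: hom_J Comp_J jcomp_def range_jid)
  have id: "jid a \<in> hom \<J> a a" for a
    by (cases a) (simp_all add: hom_J)
  show ?thesis
  proof
    show "Idt \<J> a \<in> hom \<J> a a" for a
      using id by simp
    show "g \<cdot>\<^bsub>\<J>\<^esub> f \<in> hom \<J> a c" if "f \<in> hom \<J> a b" "g \<in> hom \<J> b c" for f g a b c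
      using that by (rule comp)
    show "Idt \<J> b \<cdot>\<^bsub>\<J>\<^esub> f = f" "f \<cdot>\<^bsub>\<J>\<^esub> Idt \<J> a = f" if "f \<in> hom \<J> a b" for f a b
      using left[OF _ that id] right by simp_all
    show "(h \<cdot>\<^bsub>\<J>\<^esub> g) \<cdot>\<^bsub>\<J>\<^esub> f = h \<cdot>\<^bsub>\<J>\<^esub> (g \<cdot>\<^bsub>\<J>\<^esub> f)"
      if f: "f \<in> hom \<J> a b" and g: "g \<in> hom \<J> b c" and h: "h \<in> hom \<J> c d" for f g h a b c d
    proof -
      consider "f \<in> range jid" | "g \<in> range jid" | "h \<in> range jid"
        using f g h nonidentity_ends[of f] nonidentity_ends[of g] nonidentity_ends[of h] unfolding hom_J
        by (metis jobj.exhaust)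
      then show ?thesis
      proof cases
        case 1
        then show ?thesis by (simp add: right)
      next
        case 2
        then show ?thesis using left[OF 2 f g] by (simp add: right)
      next
        case 3
        then show ?thesis using left[OF 3 g h] left[OF 3 comp[OF f g] h] by simp
      qed
    qed
  qed simp_all
qed

lemma J_arrows:
  "F1 \<in> hom \<J> JX JY" "F2 \<in> hom \<J> JX JY" "F12 \<in> hom \<J> JY JZ" "F13 \<in> hom \<J> JY JZ"
  "F23 \<in> hom \<J> JY JZ" "F12F1 \<in> hom \<J> JX JZ" "F13F2 \<in> hom \<J> JX JZ" "F23F1 \<in> hom \<J> JX JZ"
  by (simp_all add: hom_J)

lemma J_comps [simp]:
  "F12 \<cdot>\<^bsub>\<J>\<^esub> F1 = F12F1" "F13 \<cdot>\<^bsub>\<J>\<^esub> F1 = F12F1" "F13 \<cdot>\<^bsub>\<J>\<^esub> F2 = F13F2" "F23 \<cdot>\<^bsub>\<J>\<^esub> F2 = F13F2"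
  "F23 \<cdot>\<^bsub>\<J>\<^esub> F1 = F23F1" "F12 \<cdot>\<^bsub>\<J>\<^esub> F2 = F23F1"
  by (simp_all add: Comp_J jcomp_def range_jid)

section \<open>Cospans with one invertible leg\<close>

context category
begin

text \<open>A cospan with invertible leg \<open>s\<close> represents the arrow
  \<open>s\<inverse> t\<close>, as the cells at \<open>F1\<close> and \<open>F2\<close> represent
  \<phi>. A map of cospans, with middle component \<open>k\<close>, induces a commuting square
  between the represented arrows.\<close>

lemma cospan_square:
  assumes s: "is_iso C s" "s \<in> hom C p1 q" "t \<in> hom C p2 q"
    and s': "is_iso C s'" "s' \<in> hom C p1' q'" "t' \<in> hom C p2' q'"
    and f: "f1 \<in> hom C p1 p1'" "f2 \<in> hom C p2 p2'" and k: "k \<in> hom C q q'"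
    and eq: "k \<cdot> s = s' \<cdot> f1" "k \<cdot> t = t' \<cdot> f2"
  shows "f1 \<cdot> (inv_arrow C s \<cdot> t) = (inv_arrow C s' \<cdot> t') \<cdot> f2"
proof -
  note [simp] = s(1) s'(1) cat_simps iso_simps
    hom_Ar[OF s(2)] hom_Ar[OF s(3)] hom_Ar[OF s'(2)] hom_Ar[OF s'(3)] hom_Ar[OF f(1)] hom_Ar[OF f(2)]
    hom_Ar[OF k] hom_Dom[OF s(2)] hom_Dom[OF s(3)] hom_Dom[OF s'(2)] hom_Dom[OF s'(3)]
    hom_Dom[OF f(1)] hom_Dom[OF f(2)] hom_Dom[OF k]
    hom_Cod[OF s(2)] hom_Cod[OF s(3)] hom_Cod[OF s'(2)] hom_Cod[OF s'(3)]
    hom_Cod[OF f(1)] hom_Cod[OF f(2)] hom_Cod[OF k]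
  have "s' \<cdot> (f1 \<cdot> (inv_arrow C s \<cdot> t)) = (s' \<cdot> f1) \<cdot> (inv_arrow C s \<cdot> t)"
    by simp
  also have "\<dots> = s' \<cdot> ((inv_arrow C s' \<cdot> t') \<cdot> f2)"
    unfolding eq[symmetric] by (simp add: eq(2))
  finally show ?thesis
    by (rule iso_cancel_left) simp_all
qed

text \<open>As \<open>s\<close> is invertible, compatibility of \<open>k\<close> with the second
  legs can be recovered from its compatibility with the first legs and the induced square.\<close>

lemma cospan_square_converse:
  assumes s: "is_iso C s" "s \<in> hom C p1 q" "t \<in> hom C p2 q"
    and s': "is_iso C s'" "s' \<in> hom C p1' q'" "t' \<in> hom C p2' q'"
    and f: "f1 \<in> hom C p1 p1'" "f2 \<in> hom C p2 p2'" and k: "k \<in> hom C q q'"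
    and eq: "k \<cdot> s = s' \<cdot> f1" "f1 \<cdot> (inv_arrow C s \<cdot> t) = (inv_arrow C s' \<cdot> t') \<cdot> f2"
  shows "k \<cdot> t = t' \<cdot> f2"
proof -
  note [simp] = s(1) s'(1) cat_simps iso_simps
    hom_Ar[OF s(2)] hom_Ar[OF s(3)] hom_Ar[OF s'(2)] hom_Ar[OF s'(3)] hom_Ar[OF f(1)] hom_Ar[OF f(2)]
    hom_Ar[OF k] hom_Dom[OF s(2)] hom_Dom[OF s(3)] hom_Dom[OF s'(2)] hom_Dom[OF s'(3)]
    hom_Dom[OF f(1)] hom_Dom[OF f(2)] hom_Dom[OF k]
    hom_Cod[OF s(2)] hom_Cod[OF s(3)] hom_Cod[OF s'(2)] hom_Cod[OF s'(3)]
    hom_Cod[OF f(1)] hom_Cod[OF f(2)] hom_Cod[OF k]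
  have "k \<cdot> t = (k \<cdot> s) \<cdot> (inv_arrow C s \<cdot> t)"
    by simp
  also have "\<dots> = s' \<cdot> (f1 \<cdot> (inv_arrow C s \<cdot> t))"
    unfolding eq(1) by simp
  also have "\<dots> = t' \<cdot> f2"
    unfolding eq(2) by simp
  finally show ?thesis .
qed

end

section \<open>Cocycles of a pseudo functor on \<J>\<close>

definition restriction :: "(jobj, jarr, 'o, 'm) pfctr \<Rightarrow> jarr \<Rightarrow> 'o \<Rightarrow> 'm \<Rightarrow> 'm" where
  "restriction F v x \<phi> = restrict_along F (PO F JZ) v F1 F2 x x \<phi>"

text \<open>This is the descent object of the truncated diagram \<open>F(X)\<close>,
  \<open>F(Y)\<close>, \<open>F(Z)\<close>, with \<phi> pointing from the \<open>F2\<close> side to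
  the \<open>F1\<close> side as in Giraud's convention. Expressing the condition through
  \<open>restrict_along\<close> makes it match \<open>cocycle\<close> tuple by tuple.\<close>

definition cocycle_data :: "(jobj, jarr, 'o, 'm) pfctr \<Rightarrow> ('o \<times> 'm) set" where
  "cocycle_data F = {(x, \<phi>). x \<in> Ob (PO F JX) \<and>
     \<phi> \<in> hom (PO F JY) (fob (PM F F2) x) (fob (PM F F1) x) \<and> is_iso (PO F JY) \<phi> \<and>
     restriction F F13 x \<phi> = restriction F F12 x \<phi> \<cdot>\<^bsub>PO F JZ\<^esub> restriction F F23 x \<phi>}"

definition cocycle_arrow :: "(jobj, jarr, 'o, 'm) pfctr \<Rightarrow> 'o \<times> 'm \<Rightarrow> 'o \<times> 'm \<Rightarrow> 'm \<Rightarrow> bool" where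
  "cocycle_arrow F = (\<lambda>(x, \<phi>) (y, \<psi>) \<xi>. (x, \<phi>) \<in> cocycle_data F \<and> (y, \<psi>) \<in> cocycle_data F \<and>
     \<xi> \<in> hom (PO F JX) x y \<and>
     far (PM F F1) \<xi> \<cdot>\<^bsub>PO F JY\<^esub> \<phi> = \<psi> \<cdot>\<^bsub>PO F JY\<^esub> far (PM F F2) \<xi>)"

text \<open>Arrows record their ends because the same \<xi> may be an arrow between several
  cocycles: the objects \<open>x\<close> and \<open>y\<close> do not determine \<phi> and
  \<psi>.\<close>

definition cocycle_cat :: "(jobj, jarr, 'o, 'm) pfctr
    \<Rightarrow> ('o \<times> 'm, ('o \<times> 'm) \<times> 'm \<times> ('o \<times> 'm)) cat" where
  "cocycle_cat F =
     \<lparr>Ob = cocycle_data F,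
      Ar = {(x, \<xi>, y). cocycle_arrow F x y \<xi>},
      Dom = (\<lambda>(x, \<xi>, y). x),
      Cod = (\<lambda>(x, \<xi>, y). y),
      Idt = (\<lambda>x. (x, Idt (PO F JX) (fst x), x)),
      Comp = (\<lambda>(_, \<zeta>, z) (x, \<xi>, _). (x, \<zeta> \<cdot>\<^bsub>PO F JX\<^esub> \<xi>, z))\<rparr>"

definition cone_cocycle :: "(jobj, jarr, 'o, 'm) pfctr
    \<Rightarrow> (jobj, jarr, 'oc, 'mc, 'o, 'm) ptrans \<Rightarrow> 'oc \<Rightarrow> 'o \<times> 'm" where
  "cone_cocycle F \<alpha> c =
     (fob (TO \<alpha> JX) c, inv_arrow (PO F JY) (TC \<alpha> F1 c) \<cdot>\<^bsub>PO F JY\<^esub> TC \<alpha> F2 c)"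

definition cocycle_functor :: "(jobj, jarr, 'o, 'm) pfctr \<Rightarrow> ('oc, 'mc) cat
    \<Rightarrow> (jobj, jarr, 'oc, 'mc, 'o, 'm) ptrans
    \<Rightarrow> ('oc, 'mc, 'o \<times> 'm, ('o \<times> 'm) \<times> 'm \<times> ('o \<times> 'm)) fctr" where
  "cocycle_functor F C \<alpha> =
     \<lparr>fob = (\<lambda>c\<in>Ob C. cone_cocycle F \<alpha> c),
      far = (\<lambda>h\<in>Ar C. (cone_cocycle F \<alpha> (Dom C h), far (TO \<alpha> JX) h,
        cone_cocycle F \<alpha> (Cod C h)))\<rparr>"

locale J_functor = pseudo_functor \<J> F for F :: "(jobj, jarr, 'o, 'm) pfctr"
begin

lemma PO_cat: "category (PO F d)"
  by (rule PO_category) simp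

lemmas PM_J = J_arrows[THEN PM_functor]

lemmas PM_J_simps = functor_simps[OF PM_J(1)] functor_simps[OF PM_J(2)] functor_simps[OF PM_J(3)]
  functor_simps[OF PM_J(4)] functor_simps[OF PM_J(5)] functor_simps[OF PM_J(6)]
  functor_simps[OF PM_J(7)] functor_simps[OF PM_J(8)]

sublocale X: category "PO F JX" by (rule PO_cat)
sublocale Y: category "PO F JY" by (rule PO_cat)
sublocale Z: category "PO F JZ" by (rule PO_cat)

text \<open>Composability of arrows is the horizontal pasting of their squares along the middle
  cocycle; the remaining laws are those of \<open>F(X)\<close>.\<close>

lemma category_cocycle_cat: "category (cocycle_cat F)"
proof -
  have Comp: "cocycle_arrow F x z (\<zeta> \<cdot>\<^bsub>PO F JX\<^esub> \<xi>)"
    if "cocycle_arrow F x y \<xi>" "cocycle_arrow F y z \<zeta>" for x y z \<xi> \<zeta>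
  proof -
    obtain a \<phi> b \<psi> c \<chi> where eq: "x = (a, \<phi>)" "y = (b, \<psi>)" "z = (c, \<chi>)"
      by (metis surj_pair)
    have x: "(a, \<phi>) \<in> cocycle_data F" "(b, \<psi>) \<in> cocycle_data F" "(c, \<chi>) \<in> cocycle_data F"
      and h: "\<xi> \<in> hom (PO F JX) a b" "\<zeta> \<in> hom (PO F JX) b c"
      and sq1: "far (PM F F1) \<xi> \<cdot>\<^bsub>PO F JY\<^esub> \<phi> = \<psi> \<cdot>\<^bsub>PO F JY\<^esub> far (PM F F2) \<xi>"
      and sq2: "far (PM F F1) \<zeta> \<cdot>\<^bsub>PO F JY\<^esub> \<psi> = \<chi> \<cdot>\<^bsub>PO F JY\<^esub> far (PM F F2) \<zeta>"
      using that by (simp_all add: cocycle_arrow_def eq)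
    note [simp] = hom_Ar[OF h(1)] hom_Ar[OF h(2)] hom_Dom[OF h(1)] hom_Dom[OF h(2)]
      hom_Cod[OF h(1)] hom_Cod[OF h(2)] PM_J_simps Y.cat_simps X.cat_simps
    have [simp]: "\<phi> \<in> Ar (PO F JY)" "\<psi> \<in> Ar (PO F JY)" "\<chi> \<in> Ar (PO F JY)"
      "Dom (PO F JY) \<phi> = fob (PM F F2) a" "Cod (PO F JY) \<phi> = fob (PM F F1) a"
      "Dom (PO F JY) \<psi> = fob (PM F F2) b" "Cod (PO F JY) \<psi> = fob (PM F F1) b"
      "Dom (PO F JY) \<chi> = fob (PM F F2) c" "Cod (PO F JY) \<chi> = fob (PM F F1) c"
      using x by (simp_all add: cocycle_data_def hom_def)
    have "far (PM F F1) (\<zeta> \<cdot>\<^bsub>PO F JX\<^esub> \<xi>) \<cdot>\<^bsub>PO F JY\<^esub> \<phi> =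
        far (PM F F1) \<zeta> \<cdot>\<^bsub>PO F JY\<^esub> (far (PM F F1) \<xi> \<cdot>\<^bsub>PO F JY\<^esub> \<phi>)"
      by simp
    also have "\<dots> = (far (PM F F1) \<zeta> \<cdot>\<^bsub>PO F JY\<^esub> \<psi>) \<cdot>\<^bsub>PO F JY\<^esub> far (PM F F2) \<xi>"
      unfolding sq1 by simp
    also have "\<dots> = \<chi> \<cdot>\<^bsub>PO F JY\<^esub> far (PM F F2) (\<zeta> \<cdot>\<^bsub>PO F JX\<^esub> \<xi>)"
      unfolding sq2 by simp
    finally show ?thesis
      using x h X.Comp_in[OF h] by (simp add: cocycle_arrow_def eq)
  qed
  have Idt: "cocycle_arrow F x x (Idt (PO F JX) (fst x))" if "x \<in> cocycle_data F" for x
    using that by (cases x)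
      (auto simp: cocycle_arrow_def cocycle_data_def hom_def PM_J_simps Y.cat_simps X.cat_simps)
  have data: "x \<in> cocycle_data F" "y \<in> cocycle_data F" if "cocycle_arrow F x y \<xi>" for x y \<xi>
    using that by (auto simp: cocycle_arrow_def split: prod.splits)
  have h: "\<xi> \<in> Ar (PO F JX)" "Dom (PO F JX) \<xi> = fst x" "Cod (PO F JX) \<xi> = fst y"
    if "cocycle_arrow F x y \<xi>" for x y \<xi>
    using that by (cases x; cases y; simp add: cocycle_arrow_def hom_def)+
  show ?thesis
    by unfold_locales (auto simp: cocycle_cat_def hom_def h X.cat_simps intro: Comp Idt data)
qed

end

section \<open>The cocycle of a pseudo cone\<close>

locale J_cone = pseudo_cone \<J> F C \<alpha>
  for F :: "(jobj, jarr, 'o, 'm) pfctr" and C :: "('oc, 'mc) cat"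
    and \<alpha> :: "(jobj, jarr, 'oc, 'mc, 'o, 'm) ptrans"
begin

sublocale JF: J_functor F ..

lemmas TC_J_simps = TC_simps[OF J_arrows(1)] TC_simps[OF J_arrows(2)] TC_simps[OF J_arrows(3)]
  TC_simps[OF J_arrows(4)] TC_simps[OF J_arrows(5)] TC_simps[OF J_arrows(6)]
  TC_simps[OF J_arrows(7)] TC_simps[OF J_arrows(8)]

lemma TC_hom: "\<lbrakk>u \<in> hom \<J> d e; c \<in> Ob C\<rbrakk>
    \<Longrightarrow> TC \<alpha> u c \<in> hom (PO F e) (fob (PM F u) (fob (TO \<alpha> d) c)) (fob (TO \<alpha> e) c)"
  by (simp add: TC_simps hom_def[of "PO F e"])

lemmas TO_J_simps = functor_simps[OF TO_functor[of JX, simplified]]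
  functor_simps[OF TO_functor[of JY, simplified]] functor_simps[OF TO_functor[of JZ, simplified]]

text \<open>After precomposition with the invertible \<open>PC F v F2 x\<close>,
  \<open>TC_Comp\<close> rewrites both sides as \<open>TC \<alpha> v c\<close> following the image
  under \<open>v\<close> of an arrow. These arrows are \<open>TC \<alpha> F1 c\<close> after \<phi>,
  and \<open>TC \<alpha> F2 c\<close>; they are equal by the choice of \<phi>.\<close>

lemma TC_restriction:
  assumes v: "v \<in> hom \<J> JY JZ" and c: "c \<in> Ob C" and cc: "cone_cocycle F \<alpha> c = (x, \<phi>)"
  shows "TC \<alpha> (v \<cdot>\<^bsub>\<J>\<^esub> F1) c \<cdot>\<^bsub>PO F JZ\<^esub> restriction F v x \<phi> = TC \<alpha> (v \<cdot>\<^bsub>\<J>\<^esub> F2) c"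
    and "restriction F v x \<phi> \<in>
      hom (PO F JZ) (fob (PM F (v \<cdot>\<^bsub>\<J>\<^esub> F2)) x) (fob (PM F (v \<cdot>\<^bsub>\<J>\<^esub> F1)) x)"
proof -
  have x: "x = fob (TO \<alpha> JX) c"
    and phi: "\<phi> = inv_arrow (PO F JY) (TC \<alpha> F1 c) \<cdot>\<^bsub>PO F JY\<^esub> TC \<alpha> F2 c"
    using cc by (simp_all add: cone_cocycle_def)
  note comp = F.D.Comp_in[OF J_arrows(1) v] F.D.Comp_in[OF J_arrows(2) v]
  note [simp] = c F.PC_simps[OF J_arrows(1) v] F.PC_simps[OF J_arrows(2) v] JF.Z.cat_simps
    JF.Y.cat_simps TC_J_simps TC_simps[OF v] TC_simps[OF comp(1)] TC_simps[OF comp(2)] TO_J_simps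
    JF.PM_J_simps functor_simps[OF F.PM_functor[OF v]] JF.Y.iso_simps JF.Z.iso_simps
  have [simp]: "\<phi> \<in> Ar (PO F JY)" "Dom (PO F JY) \<phi> = fob (PM F F2) x"
    "Cod (PO F JY) \<phi> = fob (PM F F1) x" "x \<in> Ob (PO F JX)"
    by (simp_all add: x phi)
  have phi_eq: "TC \<alpha> F1 c \<cdot>\<^bsub>PO F JY\<^esub> \<phi> = TC \<alpha> F2 c"
    by (simp add: phi)
  show "restriction F v x \<phi> \<in> hom (PO F JZ) (fob (PM F (v \<cdot>\<^bsub>\<J>\<^esub> F2)) x) (fob (PM F (v \<cdot>\<^bsub>\<J>\<^esub> F1)) x)"
    by (simp add: restriction_def restrict_along_def hom_def)
  have "(TC \<alpha> (v \<cdot>\<^bsub>\<J>\<^esub> F1) c \<cdot>\<^bsub>PO F JZ\<^esub> restriction F v x \<phi>) \<cdot>\<^bsub>PO F JZ\<^esub> PC F v F2 x =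
      (TC \<alpha> (v \<cdot>\<^bsub>\<J>\<^esub> F1) c \<cdot>\<^bsub>PO F JZ\<^esub> PC F v F1 x) \<cdot>\<^bsub>PO F JZ\<^esub> far (PM F v) \<phi>"
    by (simp add: restriction_def restrict_along_def x[symmetric])
  also have "\<dots> = TC \<alpha> v c \<cdot>\<^bsub>PO F JZ\<^esub> far (PM F v) (TC \<alpha> F1 c \<cdot>\<^bsub>PO F JY\<^esub> \<phi>)"
    using TC_Comp[OF J_arrows(1) v c] by (simp add: x[symmetric])
  also have "\<dots> = TC \<alpha> (v \<cdot>\<^bsub>\<J>\<^esub> F2) c \<cdot>\<^bsub>PO F JZ\<^esub> PC F v F2 x"
    unfolding phi_eq using TC_Comp[OF J_arrows(2) v c] by (simp add: x[symmetric])
  finally show "TC \<alpha> (v \<cdot>\<^bsub>\<J>\<^esub> F1) c \<cdot>\<^bsub>PO F JZ\<^esub> restriction F v x \<phi> = TC \<alpha> (v \<cdot>\<^bsub>\<J>\<^esub> F2) c"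
    by (rule JF.Z.iso_cancel_right)
      (simp_all add: x[symmetric] restriction_def restrict_along_def)
qed

lemma cone_cocycle_in:
  assumes c: "c \<in> Ob C"
  shows "cone_cocycle F \<alpha> c \<in> cocycle_data F"
proof -
  obtain x \<phi> where cc: "cone_cocycle F \<alpha> c = (x, \<phi>)" by fastforce
  then have x: "x = fob (TO \<alpha> JX) c"
    and phi: "\<phi> = inv_arrow (PO F JY) (TC \<alpha> F1 c) \<cdot>\<^bsub>PO F JY\<^esub> TC \<alpha> F2 c"
    by (simp_all add: cone_cocycle_def)
  note [simp] = c JF.Z.cat_simps JF.Y.cat_simps TC_J_simps TO_J_simps JF.PM_J_simps
    JF.Y.iso_simps JF.Y.is_iso_Comp JF.Y.is_iso_inv_arrow
  note r = J_arrows(3)[THEN TC_restriction(1), OF c cc] J_arrows(4)[THEN TC_restriction(1), OF c cc]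
    J_arrows(5)[THEN TC_restriction(1), OF c cc]
  note rh = J_arrows(3)[THEN TC_restriction(2), OF c cc] J_arrows(4)[THEN TC_restriction(2), OF c cc]
    J_arrows(5)[THEN TC_restriction(2), OF c cc]
  note [simp] = rh[THEN hom_Ar] rh[THEN hom_Dom] rh[THEN hom_Cod]
  \<comment> \<open>Restricting along \<open>F12\<close> turns the cell at \<open>F12F1\<close> into
    that at \<open>F12\<close> after \<open>F2\<close>, which is \<open>F23F1\<close>; restricting
    along \<open>F23\<close> then leads to \<open>F13F2\<close>. Restricting along
    \<open>F13\<close> leads from \<open>F12F1\<close> to \<open>F13F2\<close> at once, and the
    common first cell cancels.\<close>
  have "TC \<alpha> F12F1 c \<cdot>\<^bsub>PO F JZ\<^esub> (restriction F F12 x \<phi> \<cdot>\<^bsub>PO F JZ\<^esub> restriction F F23 x \<phi>) =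
      (TC \<alpha> F12F1 c \<cdot>\<^bsub>PO F JZ\<^esub> restriction F F12 x \<phi>) \<cdot>\<^bsub>PO F JZ\<^esub> restriction F F23 x \<phi>"
    by (simp add: x[symmetric])
  also have "\<dots> = TC \<alpha> F13F2 c"
    using r by simp
  also have "\<dots> = TC \<alpha> F12F1 c \<cdot>\<^bsub>PO F JZ\<^esub> restriction F F13 x \<phi>"
    using r by simp
  finally have "restriction F F12 x \<phi> \<cdot>\<^bsub>PO F JZ\<^esub> restriction F F23 x \<phi> = restriction F F13 x \<phi>"
    by (rule JF.Z.iso_cancel_left) (simp_all add: x[symmetric])
  then show ?thesis
    unfolding cc by (simp add: cocycle_data_def hom_def x phi)
qed

text \<open>For an arrow \<open>h\<close> of \<open>C\<close>, the image of \<open>h\<close> at Y is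
  the middle component of a map of cospans, since the cells at \<open>F1\<close> and
  \<open>F2\<close> are natural in \<open>C\<close>.\<close>

lemma is_functor_cocycle_functor: "is_functor C (cocycle_cat F) (cocycle_functor F C \<alpha>)"
proof -
  interpret cc: category "cocycle_cat F" by (rule JF.category_cocycle_cat)
  note [simp] = C.cat_simps TO_J_simps
  have "cocycle_arrow F (cone_cocycle F \<alpha> (Dom C h)) (cone_cocycle F \<alpha> (Cod C h))
      (far (TO \<alpha> JX) h)" if h: "h \<in> Ar C" for h
  proof -
    let ?c = "Dom C h" and ?c' = "Cod C h"
    have "far (PM F F1) (far (TO \<alpha> JX) h) \<cdot>\<^bsub>PO F JY\<^esub>
        (inv_arrow (PO F JY) (TC \<alpha> F1 ?c) \<cdot>\<^bsub>PO F JY\<^esub> TC \<alpha> F2 ?c) =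
        (inv_arrow (PO F JY) (TC \<alpha> F1 ?c') \<cdot>\<^bsub>PO F JY\<^esub> TC \<alpha> F2 ?c') \<cdot>\<^bsub>PO F JY\<^esub>
        far (PM F F2) (far (TO \<alpha> JX) h)"
    proof (rule JF.Y.cospan_square[OF _ TC_hom[OF J_arrows(1)] TC_hom[OF J_arrows(2)] _
          TC_hom[OF J_arrows(1)] TC_hom[OF J_arrows(2)] functor_hom[OF JF.PM_J(1)]
          functor_hom[OF JF.PM_J(2)]])
      show "far (TO \<alpha> JY) h \<in> hom (PO F JY) (fob (TO \<alpha> JY) ?c) (fob (TO \<alpha> JY) ?c')"
        "far (TO \<alpha> JX) h \<in> hom (PO F JX) (fob (TO \<alpha> JX) ?c) (fob (TO \<alpha> JX) ?c')"
        "far (TO \<alpha> JX) h \<in> hom (PO F JX) (fob (TO \<alpha> JX) ?c) (fob (TO \<alpha> JX) ?c')"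
        using h by (simp_all add: hom_def)
      show "far (TO \<alpha> JY) h \<cdot>\<^bsub>PO F JY\<^esub> TC \<alpha> F1 ?c =
          TC \<alpha> F1 ?c' \<cdot>\<^bsub>PO F JY\<^esub> far (PM F F1) (far (TO \<alpha> JX) h)"
        "far (TO \<alpha> JY) h \<cdot>\<^bsub>PO F JY\<^esub> TC \<alpha> F2 ?c =
          TC \<alpha> F2 ?c' \<cdot>\<^bsub>PO F JY\<^esub> far (PM F F2) (far (TO \<alpha> JX) h)"
        using h by (simp_all add: TC_natural[OF J_arrows(1)] TC_natural[OF J_arrows(2)])
    qed (use h in \<open>simp_all add: TC_J_simps\<close>)
    then show ?thesis
      using cone_cocycle_in[of ?c] cone_cocycle_in[of ?c'] h
      by (simp add: cocycle_arrow_def cone_cocycle_def hom_def)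
  qed
  then show ?thesis
    unfolding is_functor_def
  proof (intro conjI C.category_axioms cc.category_axioms)
  qed (auto simp: cocycle_functor_def cocycle_cat_def cone_cocycle_def
      cone_cocycle_in[unfolded cone_cocycle_def])
qed

end

section \<open>Modifications and arrows of cocycles\<close>

locale J_cone_pair = pseudo_cone_pair \<J> F C \<alpha> \<beta>
  for F :: "(jobj, jarr, 'o, 'm) pfctr" and C :: "('oc, 'mc) cat"
    and \<alpha> \<beta> :: "(jobj, jarr, 'oc, 'mc, 'o, 'm) ptrans"
begin

sublocale A: J_cone F C \<alpha> ..
sublocale B: J_cone F C \<beta> ..

text \<open>The squares over \<open>F1\<close> and \<open>F2\<close> make the component at Y a map
  between the cospans that define the two cocycles.\<close>

lemma modification_cocycle_arrow:
  assumes \<mu>: "is_modification \<J> (const_pf C) F \<alpha> \<beta> \<mu>" and c: "c \<in> Ob C"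
  shows "cocycle_arrow F (cone_cocycle F \<alpha> c) (cone_cocycle F \<beta> c) (\<mu> JX c)"
proof -
  note sq = modification_square[OF \<mu> J_arrows(1) c] modification_square[OF \<mu> J_arrows(2) c]
  have h: "\<mu> JX c \<in> hom (PO F JX) (fob (TO \<alpha> JX) c) (fob (TO \<beta> JX) c)"
    using sq(1) by (simp add: square_def)
  have "far (PM F F1) (\<mu> JX c) \<cdot>\<^bsub>PO F JY\<^esub>
      (inv_arrow (PO F JY) (TC \<alpha> F1 c) \<cdot>\<^bsub>PO F JY\<^esub> TC \<alpha> F2 c) =
      (inv_arrow (PO F JY) (TC \<beta> F1 c) \<cdot>\<^bsub>PO F JY\<^esub> TC \<beta> F2 c) \<cdot>\<^bsub>PO F JY\<^esub> far (PM F F2) (\<mu> JX c)"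
    by (rule A.JF.Y.cospan_square[OF _ A.TC_hom[OF J_arrows(1) c] A.TC_hom[OF J_arrows(2) c] _
          B.TC_hom[OF J_arrows(1) c] B.TC_hom[OF J_arrows(2) c] functor_hom[OF A.JF.PM_J(1) h]
          functor_hom[OF A.JF.PM_J(2) h], where k = "\<mu> JY c"])
      (use sq c in \<open>simp_all add: square_def A.TC_J_simps B.TC_J_simps\<close>)
  then show ?thesis
    using A.cone_cocycle_in[OF c] B.cone_cocycle_in[OF c] h
    by (simp add: cocycle_arrow_def cone_cocycle_def)
qed

text \<open>
  A modification is determined by its component at \<open>X\<close>, the components at \<open>Y\<close> and \<open>Z\<close> being its
  conjugates along \<open>f\<^sub>1\<close> and \<open>f\<^sub>1\<^sub>2 f\<^sub>1\<close>.
\<close>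

definition transport :: "jarr \<Rightarrow> 'oc \<Rightarrow> 'm \<Rightarrow> 'm" where
  "transport u c m = TC \<beta> u c \<cdot>\<^bsub>PO F (jcod u)\<^esub>
     (far (PM F u) m \<cdot>\<^bsub>PO F (jcod u)\<^esub> inv_arrow (PO F (jcod u)) (TC \<alpha> u c))"

lemma square_transport_iff:
  assumes u: "u \<in> hom \<J> JX e" and c: "c \<in> Ob C"
    and m: "m \<in> hom (PO F JX) (fob (TO \<alpha> JX) c) (fob (TO \<beta> JX) c)"
  shows "square JX e u c m n \<longleftrightarrow> n = transport u c m"
proof -
  interpret e: category "PO F e" by (rule A.JF.PO_cat)
  have e: "jcod u = e" using u by (simp add: hom_J)
  note Fm = functor_hom[OF A.F.PM_functor[OF u] m]
  note [simp] = c e e.cat_simps e.iso_simps A.TC_simps[OF u] B.TC_simps[OF u] hom_Ar[OF m]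
    hom_Dom[OF m] hom_Cod[OF m] hom_Ar[OF Fm] hom_Dom[OF Fm] hom_Cod[OF Fm]
  show ?thesis
  proof
    assume sq: "square JX e u c m n"
    then have [simp]: "n \<in> Ar (PO F e)" "Dom (PO F e) n = fob (TO \<alpha> e) c"
      by (simp_all add: square_def hom_def)
    have "n = (n \<cdot>\<^bsub>PO F e\<^esub> TC \<alpha> u c) \<cdot>\<^bsub>PO F e\<^esub> inv_arrow (PO F e) (TC \<alpha> u c)"
      by simp
    also have "n \<cdot>\<^bsub>PO F e\<^esub> TC \<alpha> u c = TC \<beta> u c \<cdot>\<^bsub>PO F e\<^esub> far (PM F u) m"
      using sq by (simp add: square_def)
    finally show "n = transport u c m"
      by (simp add: transport_def)
  next
    assume "n = transport u c m"
    then show "square JX e u c m n"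
      using u m by (simp add: square_def transport_def hom_def[of "PO F e"])
  qed
qed

lemma modification_unique:
  assumes \<mu>: "is_modification \<J> (const_pf C) F \<alpha> \<beta> \<mu>"
    and \<nu>: "is_modification \<J> (const_pf C) F \<alpha> \<beta> \<nu>"
    and eq: "\<And>c. c \<in> Ob C \<Longrightarrow> \<mu> JX c = \<nu> JX c"
  shows "\<mu> = \<nu>"
proof (intro ext)
  fix d c
  show "\<mu> d c = \<nu> d c"
  proof (cases "c \<in> Ob C")
    case True
    have h: "\<mu> JX c \<in> hom (PO F JX) (fob (TO \<alpha> JX) c) (fob (TO \<beta> JX) c)"
      using modification_square[OF \<mu> J_arrows(1) True] by (simp add: square_def)
    have "\<mu> e c = \<nu> e c" if u: "u \<in> hom \<J> JX e" for u e
      using modification_square[OF \<mu> u True] modification_square[OF \<nu> u True] eq[OF True]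
        square_transport_iff[OF u True h] by simp
    \<comment> \<open>These are the arrows \<open>F1\<close> from X to Y and \<open>F12F1\<close>
      from X to Z, so all three objects are reached.\<close>
    from this[OF J_arrows(1)] this[OF J_arrows(6)] show ?thesis
      using eq[OF True] by (cases d) simp_all
  next
    case False
    then show ?thesis
      using extensional_arb[OF modificationD(4)[OF \<mu>, of d] False]
        extensional_arb[OF modificationD(4)[OF \<nu>, of d] False] by simp
  qed
qed

text \<open>With the components at Y and Z defined by conjugation, the squares over
  \<open>F1\<close> and \<open>F12F1\<close> hold by definition. The cocycle arrow condition
  supplies the one over \<open>F2\<close>, and pasting the remaining ones.\<close>

lemma modification_extend:
  assumes \<xi>: "is_natural C (PO F JX) (TO \<alpha> JX) (TO \<beta> JX) \<xi>"
    and arr: "\<And>c. c \<in> Ob C \<Longrightarrow>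
      cocycle_arrow F (cone_cocycle F \<alpha> c) (cone_cocycle F \<beta> c) (\<xi> c)"
  obtains \<mu> where "is_modification \<J> (const_pf C) F \<alpha> \<beta> \<mu>" "\<mu> JX = \<xi>"
proof -
  define \<mu> where "\<mu> = (\<lambda>d. case d of JX \<Rightarrow> \<xi> | JY \<Rightarrow> (\<lambda>c\<in>Ob C. transport F1 c (\<xi> c))
    | JZ \<Rightarrow> (\<lambda>c\<in>Ob C. transport F12F1 c (\<xi> c)))"
  have \<mu>X: "\<mu> JX = \<xi>" by (simp add: \<mu>_def)
  have h: "\<xi> c \<in> hom (PO F JX) (fob (TO \<alpha> JX) c) (fob (TO \<beta> JX) c)" if "c \<in> Ob C" for c
    using natural_hom[OF \<xi> that] .
  have sq: "square d e u c (\<mu> d c) (\<mu> e c)" if u: "u \<in> hom \<J> d e" and c: "c \<in> Ob C" for u d e c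
  proof -
    have s1: "square JX JY F1 c (\<mu> JX c) (\<mu> JY c)"
      and s121: "square JX JZ F12F1 c (\<mu> JX c) (\<mu> JZ c)"
      using square_transport_iff[OF J_arrows(1) c h[OF c]]
        square_transport_iff[OF J_arrows(6) c h[OF c]] c by (simp_all add: \<mu>_def)
    have hX: "\<mu> JX c \<in> hom (PO F JX) (fob (TO \<alpha> JX) c) (fob (TO \<beta> JX) c)"
      using h[OF c] by (simp add: \<mu>X)
    \<comment> \<open>The cocycle arrow condition is the induced square of the two cospans, and
      compatibility with the first legs is the square over \<open>F1\<close>.\<close>
    have "\<mu> JY c \<cdot>\<^bsub>PO F JY\<^esub> TC \<alpha> F2 c = TC \<beta> F2 c \<cdot>\<^bsub>PO F JY\<^esub> far (PM F F2) (\<mu> JX c)"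
      by (rule A.JF.Y.cospan_square_converse[OF _ A.TC_hom[OF J_arrows(1) c]
            A.TC_hom[OF J_arrows(2) c] _ B.TC_hom[OF J_arrows(1) c] B.TC_hom[OF J_arrows(2) c]
            functor_hom[OF A.JF.PM_J(1) hX] functor_hom[OF A.JF.PM_J(2) hX]])
        (use s1 c arr[OF c] in \<open>simp_all add: square_def A.TC_J_simps B.TC_J_simps
          cocycle_arrow_def cone_cocycle_def \<mu>X\<close>)
    then have s2: "square JX JY F2 c (\<mu> JX c) (\<mu> JY c)"
      using s1 J_arrows(2) by (simp add: square_def)
    have hZ: "\<mu> JZ c \<in> hom (PO F JZ) (fob (TO \<alpha> JZ) c) (fob (TO \<beta> JZ) c)"
      using s121 by (simp add: square_def)
    \<comment> \<open>Cancelling \<open>F1\<close> from \<open>F12F1\<close> gives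
      \<open>F12\<close> and \<open>F13\<close>, as both factor it. Composing these with
      \<open>F2\<close> gives \<open>F23F1\<close> and \<open>F13F2\<close>. Cancelling
      \<open>F1\<close> from \<open>F23F1\<close> finally gives \<open>F23\<close>.\<close>
    note past1 = square_Comp_iff[OF s1 _ hZ] and past2 = square_Comp_iff[OF s2 _ hZ]
    have s12: "square JY JZ F12 c (\<mu> JY c) (\<mu> JZ c)" and s13: "square JY JZ F13 c (\<mu> JY c) (\<mu> JZ c)"
      using past1[OF J_arrows(3)] past1[OF J_arrows(4)] s121 by simp_all
    have s132: "square JX JZ F13F2 c (\<mu> JX c) (\<mu> JZ c)"
      and s231: "square JX JZ F23F1 c (\<mu> JX c) (\<mu> JZ c)"
      using past2[OF J_arrows(4)] past2[OF J_arrows(3)] s12 s13 by simp_all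
    have s23: "square JY JZ F23 c (\<mu> JY c) (\<mu> JZ c)"
      using past1[OF J_arrows(5)] s231 by simp
    have "\<mu> d c \<in> hom (PO F d) (fob (TO \<alpha> d) c) (fob (TO \<beta> d) c)" for d
      using s1 s121 by (cases d) (simp_all add: square_def)
    then have id: "square d d (jid d) c (\<mu> d c) (\<mu> d c)" for d
      using square_Idt[of d c "\<mu> d c"] c by simp
    show ?thesis
      using u s1 s2 s121 s12 s13 s132 s231 s23 id[of JX] id[of JY] id[of JZ]
      by (cases u) (auto simp: hom_J)
  qed
  have "is_modification \<J> (const_pf C) F \<alpha> \<beta> \<mu>"
  proof (rule modificationI)
    show "\<mu> d \<in> extensional (Ob C)" for d
      using natural_extensional[OF \<xi>] by (cases d) (simp_all add: \<mu>_def)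
    show "far (TO \<beta> d) h \<cdot>\<^bsub>PO F d\<^esub> \<mu> d (Dom C h) = \<mu> d (Cod C h) \<cdot>\<^bsub>PO F d\<^esub> far (TO \<alpha> d) h"
      if h: "h \<in> Ar C" for d h
    proof -
      let ?c = "Dom C h" and ?c' = "Cod C h"
      \<comment> \<open>The component at \<open>e\<close> is a conjugate of the one at X by cells
        natural in \<open>C\<close>, so its naturality follows from that of \<xi> once the
        invertible cell of \<alpha> at the source is cancelled.\<close>
      have nat: "far (TO \<beta> e) h \<cdot>\<^bsub>PO F e\<^esub> \<mu> e ?c = \<mu> e ?c' \<cdot>\<^bsub>PO F e\<^esub> far (TO \<alpha> e) h"
        if u: "u \<in> hom \<J> JX e" for u e
      proof -
        interpret e: category "PO F e" by (rule A.JF.PO_cat)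
        have sq1: "\<mu> e ?c \<cdot>\<^bsub>PO F e\<^esub> TC \<alpha> u ?c = TC \<beta> u ?c \<cdot>\<^bsub>PO F e\<^esub> far (PM F u) (\<mu> JX ?c)"
          and sq2: "\<mu> e ?c' \<cdot>\<^bsub>PO F e\<^esub> TC \<alpha> u ?c' = TC \<beta> u ?c' \<cdot>\<^bsub>PO F e\<^esub> far (PM F u) (\<mu> JX ?c')"
          using sq[OF u, of ?c] sq[OF u, of ?c'] h by (simp_all add: square_def A.C.cat_simps)
        have [simp]: "\<mu> d c \<in> Ar (PO F d)" "Dom (PO F d) (\<mu> d c) = fob (TO \<alpha> d) c"
          "Cod (PO F d) (\<mu> d c) = fob (TO \<beta> d) c" if "c \<in> Ob C" for d c
          using sq[OF A.F.D.Idt_in[of d] that] by (simp_all add: square_def hom_def[of "PO F d"])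
        have nX: "far (TO \<beta> JX) h \<cdot>\<^bsub>PO F JX\<^esub> \<mu> JX ?c = \<mu> JX ?c' \<cdot>\<^bsub>PO F JX\<^esub> far (TO \<alpha> JX) h"
          using natural_square[OF \<xi> h] by (simp add: \<mu>X)
        note [simp] = h A.C.cat_simps A.TC_simps[OF u] B.TC_simps[OF u] e.cat_simps
          functor_simps[OF A.F.PM_functor[OF u]] functor_simps[OF A.TO_functor]
          functor_simps[OF B.TO_functor]
        have "(far (TO \<beta> e) h \<cdot>\<^bsub>PO F e\<^esub> \<mu> e ?c) \<cdot>\<^bsub>PO F e\<^esub> TC \<alpha> u ?c =
            (far (TO \<beta> e) h \<cdot>\<^bsub>PO F e\<^esub> TC \<beta> u ?c) \<cdot>\<^bsub>PO F e\<^esub> far (PM F u) (\<mu> JX ?c)"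
          by (simp add: sq1)
        also have "\<dots> = TC \<beta> u ?c' \<cdot>\<^bsub>PO F e\<^esub> far (PM F u) (far (TO \<beta> JX) h \<cdot>\<^bsub>PO F JX\<^esub> \<mu> JX ?c)"
          unfolding B.TC_natural[OF u h] by simp
        also have "\<dots> = (\<mu> e ?c' \<cdot>\<^bsub>PO F e\<^esub> TC \<alpha> u ?c') \<cdot>\<^bsub>PO F e\<^esub> far (PM F u) (far (TO \<alpha> JX) h)"
          unfolding sq2 nX by simp
        also have "\<dots> = \<mu> e ?c' \<cdot>\<^bsub>PO F e\<^esub> (far (TO \<alpha> e) h \<cdot>\<^bsub>PO F e\<^esub> TC \<alpha> u ?c)"
          unfolding A.TC_natural[OF u h] by simp
        also have "\<dots> = (\<mu> e ?c' \<cdot>\<^bsub>PO F e\<^esub> far (TO \<alpha> e) h) \<cdot>\<^bsub>PO F e\<^esub> TC \<alpha> u ?c"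
          by simp
        finally show ?thesis
          by (rule e.iso_cancel_right) simp_all
      qed
      show ?thesis
      proof (cases d)
        case JX
        then show ?thesis using natural_square[OF \<xi> h] by (simp add: \<mu>_def)
      qed (use nat[OF J_arrows(1)] nat[OF J_arrows(6)] in simp_all)
    qed
  qed (use sq in auto)
  then show ?thesis
    by (rule that) (simp add: \<mu>_def)
qed

end

section \<open>Bilimits over \<open>\<J>\<close>\<close>

text \<open>The terminal category, built from \<open>undefined\<close> because this is the one
  element that an arbitrary type is known to have.\<close>

definition point_cat :: "('oc, 'mc) cat" where
  "point_cat = \<lparr>Ob = {undefined}, Ar = {undefined}, Dom = (\<lambda>_. undefined), Cod = (\<lambda>_. undefined),
     Idt = (\<lambda>_. undefined), Comp = (\<lambda>_ _. undefined)\<rparr>"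

lemma point_cat_simps [simp]:
  "Ob point_cat = {undefined}" "Ar point_cat = {undefined}" "Dom point_cat h = undefined"
  "Cod point_cat h = undefined" "Idt point_cat c = undefined"
  "h \<cdot>\<^bsub>point_cat\<^esub> k = undefined"
  by (simp_all add: point_cat_def)

lemma category_point_cat: "category point_cat"
  by unfold_locales (auto simp: hom_def)

definition point_fctr :: "('o, 'm) cat \<Rightarrow> 'o \<Rightarrow> ('oc, 'mc, 'o, 'm) fctr" where
  "point_fctr D x = \<lparr>fob = (\<lambda>_\<in>{undefined}. x), far = (\<lambda>_\<in>{undefined}. Idt D x)\<rparr>"

lemma point_fctr_simps [simp]: "fob (point_fctr D x) undefined = x"
  "far (point_fctr D x) undefined = Idt D x"
  by (simp_all add: point_fctr_def)

lemma is_functor_point_fctr: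
  assumes "category D" "x \<in> Ob D"
  shows "is_functor point_cat D (point_fctr D x)"
proof -
  interpret D: category D by fact
  show ?thesis
    unfolding is_functor_def
    using assms by (simp add: category_point_cat point_fctr_def D.cat_simps)
qed

lemma is_natural_point:
  assumes "category D" "m \<in> hom D x y"
  shows "is_natural point_cat D (point_fctr D x) (point_fctr D y) (\<lambda>_\<in>{undefined}. m)"
proof -
  interpret D: category D by fact
  show ?thesis
    using assms D.hom_Ob[OF assms(2)]
    by (simp add: is_natural_def is_functor_point_fctr D.cat_simps hom_def)
qed

section \<open>Cocycles as pseudo cones on the point\<close>

context J_functor
begin

text \<open>The last equation is the definition of the restriction with the inverse multiplied out.
  In this form it is the composition axiom of a pseudo cone whose cells at \<open>F1\<close> and the
  target composite are identities or restrictions.\<close>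

lemma restriction_in:
  assumes x: "(x, \<phi>) \<in> cocycle_data F" and v: "v \<in> hom \<J> JY JZ"
  shows "restriction F v x \<phi> \<in>
      hom (PO F JZ) (fob (PM F (v \<cdot>\<^bsub>\<J>\<^esub> F2)) x) (fob (PM F (v \<cdot>\<^bsub>\<J>\<^esub> F1)) x)"
    and "is_iso (PO F JZ) (restriction F v x \<phi>)"
    and "restriction F v x \<phi> \<cdot>\<^bsub>PO F JZ\<^esub> PC F v F2 x = PC F v F1 x \<cdot>\<^bsub>PO F JZ\<^esub> far (PM F v) \<phi>"
proof -
  have [simp]: "x \<in> Ob (PO F JX)" "\<phi> \<in> Ar (PO F JY)" "Dom (PO F JY) \<phi> = fob (PM F F2) x"
    "Cod (PO F JY) \<phi> = fob (PM F F1) x" "is_iso (PO F JY) \<phi>"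
    using x by (simp_all add: cocycle_data_def hom_def)
  note [simp] = PC_simps[OF J_arrows(1) v] PC_simps[OF J_arrows(2) v] functor_simps[OF PM_functor[OF v]]
    PM_J_simps Z.cat_simps Z.iso_simps functor_is_iso[OF PM_functor[OF v]] Z.is_iso_Comp
    Z.is_iso_inv_arrow
  show "restriction F v x \<phi> \<in>
      hom (PO F JZ) (fob (PM F (v \<cdot>\<^bsub>\<J>\<^esub> F2)) x) (fob (PM F (v \<cdot>\<^bsub>\<J>\<^esub> F1)) x)"
    "is_iso (PO F JZ) (restriction F v x \<phi>)"
    "restriction F v x \<phi> \<cdot>\<^bsub>PO F JZ\<^esub> PC F v F2 x = PC F v F1 x \<cdot>\<^bsub>PO F JZ\<^esub> far (PM F v) \<phi>"
    by (simp_all add: restriction_def restrict_along_def hom_def)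
qed

text \<open>
  A cocycle \<open>(x, \<phi>)\<close> is the cocycle of a pseudo cone on the point whose coherence isomorphisms at
  \<open>f\<^sub>1\<close> and \<open>f\<^sub>1\<^sub>2 f\<^sub>1\<close> are identities; the coherence conditions force the others.
\<close>

definition apex :: "'o \<Rightarrow> jobj \<Rightarrow> 'o" where
  "apex x d = (case d of JX \<Rightarrow> x | JY \<Rightarrow> fob (PM F F1) x | JZ \<Rightarrow> fob (PM F F12F1) x)"

definition cell :: "'o \<Rightarrow> 'm \<Rightarrow> jarr \<Rightarrow> 'm" where
  "cell x \<phi> u = (case u of
      IdX \<Rightarrow> inv_arrow (PO F JX) (PU F JX (apex x JX))
    | IdY \<Rightarrow> inv_arrow (PO F JY) (PU F JY (apex x JY))
    | IdZ \<Rightarrow> inv_arrow (PO F JZ) (PU F JZ (apex x JZ))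
    | F1 \<Rightarrow> Idt (PO F JY) (apex x JY)
    | F2 \<Rightarrow> \<phi>
    | F12 \<Rightarrow> PC F F12 F1 x
    | F13 \<Rightarrow> PC F F13 F1 x
    | F23 \<Rightarrow> restriction F F12 x \<phi> \<cdot>\<^bsub>PO F JZ\<^esub> PC F F23 F1 x
    | F12F1 \<Rightarrow> Idt (PO F JZ) (apex x JZ)
    | F13F2 \<Rightarrow> restriction F F13 x \<phi>
    | F23F1 \<Rightarrow> restriction F F12 x \<phi>)"

definition point_cone :: "'o \<Rightarrow> 'm \<Rightarrow> (jobj, jarr, 'oc, 'mc, 'o, 'm) ptrans" where
  "point_cone x \<phi> = \<lparr>TO = (\<lambda>d. point_fctr (PO F d) (apex x d)),
     TC = (\<lambda>u. \<lambda>_\<in>{undefined}. cell x \<phi> u)\<rparr>"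

text \<open>The cells at identities are forced to be inverse to the units. Of the six composable
  pairs, those with \<open>F1\<close> determine the cells at \<open>F12\<close>, \<open>F13\<close>
  and \<open>F23\<close>, while \<open>(F12, F2)\<close> and \<open>(F13, F2)\<close> determine
  those at \<open>F23F1\<close> and \<open>F13F2\<close>. The pair \<open>(F23, F2)\<close> is then
  the cocycle condition.\<close>

lemma pseudo_cone_point_cone:
  assumes x: "(x, \<phi>) \<in> cocycle_data F"
  shows "pseudo_cone \<J> F point_cat (point_cone x \<phi>)"
proof -
  have x_data [simp]: "x \<in> Ob (PO F JX)" "\<phi> \<in> Ar (PO F JY)" "Dom (PO F JY) \<phi> = fob (PM F F2) x"
    "Cod (PO F JY) \<phi> = fob (PM F F1) x" "is_iso (PO F JY) \<phi>"
    using x by (simp_all add: cocycle_data_def hom_def)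
  have cocycle: "restriction F F13 x \<phi> = restriction F F12 x \<phi> \<cdot>\<^bsub>PO F JZ\<^esub> restriction F F23 x \<phi>"
    using x by (simp add: cocycle_data_def)
  note r = restriction_in[OF x J_arrows(3)] restriction_in[OF x J_arrows(4)]
    restriction_in[OF x J_arrows(5)]
  note rh = r(1)[simplified] r(4)[simplified] r(7)[simplified]
  note [simp] = rh[THEN hom_Ar] rh[THEN hom_Dom] rh[THEN hom_Cod] r(2,5,8)
  have apex [simp]: "apex x d \<in> Ob (PO F d)" for d
    by (cases d) (simp_all add: apex_def PM_J_simps)
  note PC_J = PC_simps[OF J_arrows(1) J_arrows(3)] PC_simps[OF J_arrows(1) J_arrows(4)]
    PC_simps[OF J_arrows(1) J_arrows(5)] PC_simps[OF J_arrows(2) J_arrows(3)]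
    PC_simps[OF J_arrows(2) J_arrows(4)] PC_simps[OF J_arrows(2) J_arrows(5)]
  note [simp] = Z.cat_simps Y.cat_simps X.cat_simps X.iso_simps Y.iso_simps Z.iso_simps
    PC_J[simplified] PM_J_simps
    X.is_iso_inv_arrow Y.is_iso_inv_arrow Z.is_iso_inv_arrow Y.is_iso_Idt Z.is_iso_Idt
    Z.is_iso_Comp
  have PU [simp]: "PU F d (apex x d) \<in> Ar (PO F d)" "Dom (PO F d) (PU F d (apex x d)) = apex x d"
    "Cod (PO F d) (PU F d (apex x d)) = fob (PM F (jid d)) (apex x d)"
    "is_iso (PO F d) (PU F d (apex x d))" for d
    using PU_simps[of d "apex x d"] by simp_all
  have cell: "cell x \<phi> u \<in> hom (PO F (jcod u)) (fob (PM F u) (apex x (jdom u))) (apex x (jcod u))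
      \<and> is_iso (PO F (jcod u)) (cell x \<phi> u)" for u
    using PU[of JX] PU[of JY] PU[of JZ]
    by (cases u) (simp_all add: cell_def hom_def, simp_all add: apex_def)
  have cell_Comp: "cell x \<phi> (v \<cdot>\<^bsub>\<J>\<^esub> u) \<cdot>\<^bsub>PO F k\<^esub> PC F v u (apex x d) =
      cell x \<phi> v \<cdot>\<^bsub>PO F k\<^esub> far (PM F v) (cell x \<phi> u)"
    if u: "u \<in> hom \<J> d e" "u \<notin> range jid" and v: "v \<in> hom \<J> e k" "v \<notin> range jid" for u v d e k
  proof -
    have "(v, u) \<in> {(F12, F1), (F12, F2), (F13, F1), (F13, F2), (F23, F1), (F23, F2)} \<and> d = JX \<and> k = JZ"
      using composable_nonidentities[of v u] u v by (auto simp: hom_J)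
    \<comment> \<open>The remaining pair \<open>(F23, F2)\<close>: both cells are already fixed, so
      this is where the cocycle condition enters.\<close>
    moreover have "restriction F F13 x \<phi> \<cdot>\<^bsub>PO F JZ\<^esub> PC F F23 F2 x =
        (restriction F F12 x \<phi> \<cdot>\<^bsub>PO F JZ\<^esub> PC F F23 F1 x) \<cdot>\<^bsub>PO F JZ\<^esub> far (PM F F23) \<phi>"
      unfolding cocycle using r(9) by simp
    ultimately show ?thesis
      using r(3) r(6) by (auto simp: cell_def apex_def)
  qed
  show ?thesis
  proof (rule pseudo_coneI[OF pseudo_functor_axioms category_point_cat])
    show "is_functor point_cat (PO F d) (TO (point_cone x \<phi>) d)" for d
      by (simp add: point_cone_def is_functor_point_fctr PO_cat)
    show "TC (point_cone x \<phi>) (v \<cdot>\<^bsub>\<J>\<^esub> u) c \<cdot>\<^bsub>PO F k\<^esub> PC F v u (fob (TO (point_cone x \<phi>) d) c) =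
      TC (point_cone x \<phi>) v c \<cdot>\<^bsub>PO F k\<^esub> far (PM F v) (TC (point_cone x \<phi>) u c)"
      if "u \<in> hom \<J> d e" "v \<in> hom \<J> e k" "u \<notin> Idt \<J> ` Ob \<J>" "v \<notin> Idt \<J> ` Ob \<J>" "c \<in> Ob point_cat"
      for u v d e k c
      using cell_Comp[of u d e v k] that by (simp add: point_cone_def)
    show "TC (point_cone x \<phi>) (Idt \<J> d) c \<cdot>\<^bsub>PO F d\<^esub> PU F d (fob (TO (point_cone x \<phi>) d) c) =
      Idt (PO F d) (fob (TO (point_cone x \<phi>) d) c)" if "c \<in> Ob point_cat" for d c
      using that PU[of d] by (cases d) (simp_all add: point_cone_def cell_def)
    show "far (TO (point_cone x \<phi>) e) h \<cdot>\<^bsub>PO F e\<^esub> TC (point_cone x \<phi>) u (Dom point_cat h) =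
      TC (point_cone x \<phi>) u (Cod point_cat h) \<cdot>\<^bsub>PO F e\<^esub> far (PM F u) (far (TO (point_cone x \<phi>) d) h)"
      if u: "u \<in> hom \<J> d e" and h: "h \<in> Ar point_cat" for u d e h
    proof -
      interpret e: category "PO F e" by (rule PO_cat)
      have "jdom u = d" "jcod u = e" using u by (simp_all add: hom_J)
      then show ?thesis
        using h cell[of u] by (simp add: point_cone_def functor_simps[OF PM_functor[OF u]]
            hom_def e.cat_simps)
    qed
  qed (use cell in \<open>auto simp: point_cone_def hom_J\<close>)
qed

text \<open>As the cell at \<open>F1\<close> is an identity, the cocycle is recovered on the nose
  and not only up to isomorphism.\<close>

lemma cone_cocycle_point_cone:
  assumes x: "(x, \<phi>) \<in> cocycle_data F"
  shows "cone_cocycle F (point_cone x \<phi>) undefined = (x, \<phi>)"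
proof -
  have "x \<in> Ob (PO F JX)" "\<phi> \<in> Ar (PO F JY)" "Cod (PO F JY) \<phi> = fob (PM F F1) x"
    using x by (simp_all add: cocycle_data_def hom_def)
  then show ?thesis
    by (simp add: cone_cocycle_def point_cone_def cell_def apex_def Y.inv_arrow_Idt PM_J_simps
        Y.cat_simps)
qed

end

section \<open>From bilimits to equivalences with cocycles\<close>

context J_cone
begin

text \<open>Functors from the point to \<open>C\<close> and their transformations are the objects
  and arrows of \<open>C\<close>, and modifications between the resulting cones are arrows of
  cocycles. So full faithfulness and essential surjectivity carry over by evaluation at the single
  object.\<close>

lemma bilimit_imp_equivalence:
  assumes eq: "is_equivalence (functor_cat (point_cat :: ('oe, 'me) cat) C)
      (pseudo_cone_cat \<J> (point_cat :: ('oe, 'me) cat) F) (cone_functor \<J> C \<alpha> point_cat)"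
  shows "is_equivalence C (cocycle_cat F) (cocycle_functor F C \<alpha>)"
proof -
  let ?P = "point_cat :: ('oe, 'me) cat"
  let ?L = "cone_functor \<J> C \<alpha> ?P"
  let ?\<Phi> = "cocycle_functor F C \<alpha>"
  let ?pt = "point_fctr C :: 'oc \<Rightarrow> ('oe, 'me, 'oc, 'mc) fctr"
  have ff: "fully_faithful (functor_cat ?P C) (pseudo_cone_cat \<J> ?P F) ?L"
    and es: "essentially_surjective (functor_cat ?P C) (pseudo_cone_cat \<J> ?P F) ?L"
    using eq by (simp_all add: equivalence_iff)
  have \<Phi>: "is_functor C (cocycle_cat F) ?\<Phi>" by (rule is_functor_cocycle_functor)
  interpret cc: category "cocycle_cat F" by (rule JF.category_cocycle_cat)
  have pt: "is_functor ?P C (?pt c)" if "c \<in> Ob C" for c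
    by (rule is_functor_point_fctr[OF C.category_axioms that])
  have cone: "pseudo_cone \<J> F ?P (cone_after \<J> C \<alpha> ?P H)" if "is_functor ?P C H" for H
    by (rule pseudo_cone_cone_after[OF that])
  have cc_after: "cone_cocycle F (cone_after \<J> C \<alpha> ?P H) undefined = cone_cocycle F \<alpha> (fob H undefined)"
    for H
    by (simp add: cone_cocycle_def cone_after_def)
  have L_far: "far ?L (H, \<theta>, H') = (cone_after \<J> C \<alpha> ?P H,
      \<lambda>d\<in>UNIV. \<lambda>c\<in>{undefined}. far (TO \<alpha> d) (\<theta> c), cone_after \<J> C \<alpha> ?P H')"
    if "is_natural ?P C H H' \<theta>" for H H' \<theta>
    using that by (simp add: cone_functor_def functor_cat_def)
  have L_fob: "fob ?L H = cone_after \<J> C \<alpha> ?P H" if "is_functor ?P C H" for H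
    using that by (simp add: cone_functor_def functor_cat_def)
  have "fully_faithful C (cocycle_cat F) ?\<Phi>"
  proof (rule fully_faithfulI[OF \<Phi>])
    fix a b f f'
    assume ab: "a \<in> Ob C" "b \<in> Ob C" and f: "f \<in> hom C a b" "f' \<in> hom C a b"
      and far_eq: "far ?\<Phi> f = far ?\<Phi> f'"
    interpret AB: J_cone_pair F ?P "cone_after \<J> C \<alpha> ?P (?pt a)" "cone_after \<J> C \<alpha> ?P (?pt b)"
      using ab pt by (intro J_cone_pair.intro pseudo_cone_pair.intro cone)
    have nat: "is_natural ?P C (?pt a) (?pt b) (\<lambda>_\<in>{undefined}. f)"
      "is_natural ?P C (?pt a) (?pt b) (\<lambda>_\<in>{undefined}. f')"
      using f is_natural_point[OF C.category_axioms] by auto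
    have "far (TO \<alpha> JX) f = far (TO \<alpha> JX) f'"
      using far_eq f by (simp add: cocycle_functor_def hom_def)
    then have "(\<lambda>d\<in>UNIV. \<lambda>c\<in>{undefined :: 'oe}. far (TO \<alpha> d) ((\<lambda>_\<in>{undefined}. f) c)) =
        (\<lambda>d\<in>UNIV. \<lambda>c\<in>{undefined :: 'oe}. far (TO \<alpha> d) ((\<lambda>_\<in>{undefined}. f') c))"
      using AB.modification_unique[OF modification_cone_after[OF nat(1)]
          modification_cone_after[OF nat(2)]] by simp
    then have "far ?L (?pt a, \<lambda>_\<in>{undefined}. f, ?pt b) = far ?L (?pt a, \<lambda>_\<in>{undefined}. f', ?pt b)"
      using L_far[OF nat(1)] L_far[OF nat(2)] by simp
    then have "(?pt a, \<lambda>_\<in>{undefined :: 'oe}. f, ?pt b) = (?pt a, \<lambda>_\<in>{undefined}. f', ?pt b)"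
      using pt[OF ab(1)] pt[OF ab(2)] nat
      by (intro fully_faithful_inj[OF ff, of "?pt a" "?pt b"])
        (simp_all add: functor_cat_def hom_def)
    then have "(\<lambda>_\<in>{undefined :: 'oe}. f) undefined = (\<lambda>_\<in>{undefined :: 'oe}. f') undefined"
      by (simp only: prod.inject)
    then show "f = f'" by simp
  next
    fix a b h
    assume ab: "a \<in> Ob C" "b \<in> Ob C" and h: "h \<in> hom (cocycle_cat F) (fob ?\<Phi> a) (fob ?\<Phi> b)"
    interpret AB: J_cone_pair F ?P "cone_after \<J> C \<alpha> ?P (?pt a)" "cone_after \<J> C \<alpha> ?P (?pt b)"
      using ab pt by (intro J_cone_pair.intro pseudo_cone_pair.intro cone)
    obtain \<xi> where h_eq: "h = (cone_cocycle F \<alpha> a, \<xi>, cone_cocycle F \<alpha> b)"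
      and \<xi>: "cocycle_arrow F (cone_cocycle F \<alpha> a) (cone_cocycle F \<alpha> b) \<xi>"
      using h ab by (auto simp: hom_def cocycle_cat_def cocycle_functor_def)
    have \<xi>_hom: "\<xi> \<in> hom (PO F JX) (fob (TO \<alpha> JX) a) (fob (TO \<alpha> JX) b)"
      using \<xi> by (simp add: cocycle_arrow_def cone_cocycle_def)
    have TO_eq: "TO (cone_after \<J> C \<alpha> ?P (?pt c)) JX = point_fctr (PO F JX) (fob (TO \<alpha> JX) c)"
      if "c \<in> Ob C" for c
      using that by (auto simp: cone_after_def comp_fctr_def point_fctr_def TO_J_simps
          intro!: restrict_ext)
    \<comment> \<open>A cocycle arrow is a natural family over the point, so it extends to a
      modification. This lifts through \<open>?L\<close>, and the value of the lift at the single
      object is the required arrow of \<open>C\<close>.\<close>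
    obtain \<mu> where \<mu>: "is_modification \<J> (const_pf ?P) F (cone_after \<J> C \<alpha> ?P (?pt a))
        (cone_after \<J> C \<alpha> ?P (?pt b)) \<mu>" "\<mu> JX = (\<lambda>_\<in>{undefined}. \<xi>)"
    proof (rule AB.modification_extend)
      show "is_natural ?P (PO F JX) (TO (cone_after \<J> C \<alpha> ?P (?pt a)) JX)
          (TO (cone_after \<J> C \<alpha> ?P (?pt b)) JX) (\<lambda>_\<in>{undefined}. \<xi>)"
        unfolding TO_eq[OF ab(1)] TO_eq[OF ab(2)] using JF.PO_cat \<xi>_hom by (rule is_natural_point)
    qed (use \<xi> in \<open>simp_all add: cc_after\<close>)
    have pt_Ob: "?pt a \<in> Ob (functor_cat ?P C)" "?pt b \<in> Ob (functor_cat ?P C)"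
      using pt ab by (simp_all add: functor_cat_def)
    have "(cone_after \<J> C \<alpha> ?P (?pt a), \<mu>, cone_after \<J> C \<alpha> ?P (?pt b)) \<in>
        hom (pseudo_cone_cat \<J> ?P F) (fob ?L (?pt a)) (fob ?L (?pt b))"
      using \<mu>(1) pt ab by (simp add: L_fob hom_def pseudo_cone_cat_def pseudo_nat_cat_def)
    then obtain t where t: "t \<in> hom (functor_cat ?P C) (?pt a) (?pt b)"
      "far ?L t = (cone_after \<J> C \<alpha> ?P (?pt a), \<mu>, cone_after \<J> C \<alpha> ?P (?pt b))"
      by (rule fully_faithful_surj[OF ff pt_Ob(1) pt_Ob(2)])
    then obtain \<theta> where \<theta>: "is_natural ?P C (?pt a) (?pt b) \<theta>" "t = (?pt a, \<theta>, ?pt b)"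
      by (auto simp: functor_cat_def hom_def)
    have "\<mu> = (\<lambda>d\<in>UNIV. \<lambda>c\<in>{undefined}. far (TO \<alpha> d) (\<theta> c))"
      using t(2) L_far[OF \<theta>(1)] \<theta>(2) by simp
    then have "\<mu> JX undefined = far (TO \<alpha> JX) (\<theta> undefined)" by simp
    then have "far (TO \<alpha> JX) (\<theta> undefined) = \<xi>" using \<mu>(2) by simp
    moreover have "\<theta> undefined \<in> hom C a b"
      using natural_hom[OF \<theta>(1), of undefined] by simp
    ultimately show "\<exists>f\<in>hom C a b. far ?\<Phi> f = h"
      by (intro bexI[of _ "\<theta> undefined"]) (auto simp: cocycle_functor_def hom_def h_eq)
  qed
  moreover have "essentially_surjective C (cocycle_cat F) ?\<Phi>"
    unfolding essentially_surjective_def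
  proof
    fix d assume "d \<in> Ob (cocycle_cat F)"
    then obtain x \<phi> where d: "d = (x, \<phi>)" "(x, \<phi>) \<in> cocycle_data F"
      by (cases d) (auto simp: cocycle_cat_def)
    \<comment> \<open>Realising the cocycle as a cone on the point gives essential surjectivity
      something to act on: the cone is isomorphic to the image of some \<open>H\<close>, and
      \<open>fob H undefined\<close> is the object sought.\<close>
    let ?\<beta> = "JF.point_cone x \<phi> :: (jobj, jarr, 'oe, 'me, 'o, 'm) ptrans"
    have \<beta>: "pseudo_cone \<J> F ?P ?\<beta>" by (rule JF.pseudo_cone_point_cone[OF d(2)])
    then have "?\<beta> \<in> Ob (pseudo_cone_cat \<J> ?P F)"
      by (simp add: pseudo_cone_cat_def pseudo_nat_cat_def pseudo_cone.natural)
    then obtain H k where H: "is_functor ?P C H" and k: "is_iso (pseudo_cone_cat \<J> ?P F) k"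
        "k \<in> hom (pseudo_cone_cat \<J> ?P F) (fob ?L H) ?\<beta>"
      using es unfolding essentially_surjective_def by (auto simp: functor_cat_def)
    let ?\<gamma> = "cone_after \<J> C \<alpha> ?P H"
    have kh: "k \<in> hom (pseudo_cone_cat \<J> ?P F) ?\<gamma> ?\<beta>"
      using k(2) L_fob[OF H] by simp
    then obtain \<mu> where \<mu>: "k = (?\<gamma>, \<mu>, ?\<beta>)" "is_modification \<J> (const_pf ?P) F ?\<gamma> ?\<beta> \<mu>"
      by (auto simp: hom_def pseudo_cone_cat_def pseudo_nat_cat_def)
    obtain k' where k': "k' \<in> hom (pseudo_cone_cat \<J> ?P F) ?\<beta> ?\<gamma>"
      "k' \<cdot>\<^bsub>pseudo_cone_cat \<J> ?P F\<^esub> k = Idt (pseudo_cone_cat \<J> ?P F) ?\<gamma>"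
      "k \<cdot>\<^bsub>pseudo_cone_cat \<J> ?P F\<^esub> k' = Idt (pseudo_cone_cat \<J> ?P F) ?\<beta>"
      using k(1) hom_Dom[OF kh] hom_Cod[OF kh] by (auto simp: is_iso_def inverse_arrows_def)
    then obtain \<nu> where \<nu>: "k' = (?\<beta>, \<nu>, ?\<gamma>)" "is_modification \<J> (const_pf ?P) F ?\<beta> ?\<gamma> \<nu>"
      by (auto simp: hom_def pseudo_cone_cat_def pseudo_nat_cat_def)
    interpret BG: J_cone_pair F ?P ?\<beta> ?\<gamma>
      using \<beta> cone[OF H] by (intro J_cone_pair.intro pseudo_cone_pair.intro)
    interpret GB: J_cone_pair F ?P ?\<gamma> ?\<beta>
      using \<beta> cone[OF H] by (intro J_cone_pair.intro pseudo_cone_pair.intro)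
    let ?c = "fob H undefined"
    have c: "?c \<in> Ob C" using functor_fob[OF H, of undefined] by simp
    have cc_\<beta>: "cone_cocycle F ?\<beta> undefined = (x, \<phi>)"
      by (rule JF.cone_cocycle_point_cone[OF d(2)])
    \<comment> \<open>The components at X of the isomorphism of cones and of its inverse are arrows
      of cocycles, and reading the inverse laws at X makes them mutually inverse.\<close>
    have arr: "cocycle_arrow F (cone_cocycle F \<alpha> ?c) (x, \<phi>) (\<mu> JX undefined)"
      "cocycle_arrow F (x, \<phi>) (cone_cocycle F \<alpha> ?c) (\<nu> JX undefined)"
      using GB.modification_cocycle_arrow[OF \<mu>(2), of undefined]
        BG.modification_cocycle_arrow[OF \<nu>(2), of undefined] by (simp_all add: cc_after cc_\<beta>)
    have "(\<lambda>d\<in>UNIV. \<lambda>c\<in>{undefined}. \<nu> d c \<cdot>\<^bsub>PO F d\<^esub> \<mu> d c) =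
        (\<lambda>d\<in>UNIV. \<lambda>c\<in>{undefined}. Idt (PO F d) (fob (TO ?\<gamma> d) c))"
      "(\<lambda>d\<in>UNIV. \<lambda>c\<in>{undefined}. \<mu> d c \<cdot>\<^bsub>PO F d\<^esub> \<nu> d c) =
        (\<lambda>d\<in>UNIV. \<lambda>c\<in>{undefined}. Idt (PO F d) (fob (TO ?\<beta> d) c))"
      using k'(2,3) unfolding \<mu>(1) \<nu>(1) by (simp_all add: pseudo_cone_cat_def pseudo_nat_cat_def)
    from this[THEN fun_cong, of JX, THEN fun_cong, of undefined]
    have inv: "\<nu> JX undefined \<cdot>\<^bsub>PO F JX\<^esub> \<mu> JX undefined = Idt (PO F JX) (fst (cone_cocycle F \<alpha> ?c))"
      "\<mu> JX undefined \<cdot>\<^bsub>PO F JX\<^esub> \<nu> JX undefined = Idt (PO F JX) x"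
      using cc_after[of H] cc_\<beta> by (simp_all add: cone_cocycle_def)
    have "is_iso (cocycle_cat F) (cone_cocycle F \<alpha> ?c, \<mu> JX undefined, (x, \<phi>))"
      unfolding is_iso_def inverse_arrows_def using arr inv
      by (intro exI[of _ "((x, \<phi>), \<nu> JX undefined, cone_cocycle F \<alpha> ?c)"])
        (simp add: cocycle_cat_def hom_def)
    moreover have "(cone_cocycle F \<alpha> ?c, \<mu> JX undefined, (x, \<phi>)) \<in> hom (cocycle_cat F) (fob ?\<Phi> ?c) d"
      using arr c by (simp add: cocycle_cat_def hom_def cocycle_functor_def d)
    ultimately show "\<exists>c\<in>Ob C. \<exists>f\<in>hom (cocycle_cat F) (fob ?\<Phi> c) d. is_iso (cocycle_cat F) f"
      using c by blast
  qed
  ultimately show ?thesis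
    using \<Phi> by (simp add: equivalence_iff)
qed

end

section \<open>From equivalences with cocycles to bilimits\<close>

lemma is_natural_inverse:
  assumes \<tau>: "is_natural_iso C D S T \<tau>"
  shows "is_natural C D T S (\<lambda>a\<in>Ob C. inv_arrow D (\<tau> a))"
proof -
  have nat: "is_natural C D S T \<tau>" using \<tau> by (simp add: is_natural_iso_def)
  then have S: "is_functor C D S" and T: "is_functor C D T" by (simp_all add: is_natural_def)
  interpret C: category C using S by (simp add: is_functor_def)
  interpret D: category D using S by (simp add: is_functor_def)
  note [simp] = C.cat_simps D.cat_simps D.iso_simps functor_simps[OF S] functor_simps[OF T]
    is_natural_isoD[OF \<tau>]
  have "far S f \<cdot>\<^bsub>D\<^esub> inv_arrow D (\<tau> (Dom C f)) = inv_arrow D (\<tau> (Cod C f)) \<cdot>\<^bsub>D\<^esub> far T f"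
    if f: "f \<in> Ar C" for f
  proof -
    have "\<tau> (Cod C f) \<cdot>\<^bsub>D\<^esub> (far S f \<cdot>\<^bsub>D\<^esub> inv_arrow D (\<tau> (Dom C f))) =
        (\<tau> (Cod C f) \<cdot>\<^bsub>D\<^esub> far S f) \<cdot>\<^bsub>D\<^esub> inv_arrow D (\<tau> (Dom C f))"
      using f by simp
    also have "\<dots> = \<tau> (Cod C f) \<cdot>\<^bsub>D\<^esub> (inv_arrow D (\<tau> (Cod C f)) \<cdot>\<^bsub>D\<^esub> far T f)"
      unfolding natural_square[OF nat f, symmetric] using f by simp
    finally show ?thesis
      by (rule D.iso_cancel_left) (use f in simp_all)
  qed
  then show ?thesis
    using S T by (simp add: is_natural_def hom_def)
qed

text \<open>The forgetful functor to \<open>F(X)\<close>; it turns naturality squares and inverses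
  in the cocycle category into statements about components at X.\<close>

definition cocycle_forget :: "(jobj, jarr, 'o, 'm) pfctr
    \<Rightarrow> ('o \<times> 'm, ('o \<times> 'm) \<times> 'm \<times> ('o \<times> 'm), 'o, 'm) fctr" where
  "cocycle_forget F = \<lparr>fob = (\<lambda>x\<in>Ob (cocycle_cat F). fst x),
     far = (\<lambda>k\<in>Ar (cocycle_cat F). fst (snd k))\<rparr>"

lemma (in J_functor) is_functor_cocycle_forget:
  "is_functor (cocycle_cat F) (PO F JX) (cocycle_forget F)"
  unfolding is_functor_def
proof (intro conjI category_cocycle_cat PO_cat)
  interpret cc: category "cocycle_cat F" by (rule category_cocycle_cat)
  show "\<forall>f\<in>Ar (cocycle_cat F). \<forall>g\<in>Ar (cocycle_cat F). Dom (cocycle_cat F) g = Cod (cocycle_cat F) f \<longrightarrow>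
      far (cocycle_forget F) (g \<cdot>\<^bsub>cocycle_cat F\<^esub> f) =
      far (cocycle_forget F) g \<cdot>\<^bsub>PO F JX\<^esub> far (cocycle_forget F) f"
  proof (intro ballI impI)
    fix f g
    assume f: "f \<in> Ar (cocycle_cat F)" and g: "g \<in> Ar (cocycle_cat F)"
      and gf: "Dom (cocycle_cat F) g = Cod (cocycle_cat F) f"
    have "g \<cdot>\<^bsub>cocycle_cat F\<^esub> f \<in> Ar (cocycle_cat F)"
      using f g gf by (rule cc.Ar_Comp)
    moreover have "fst (snd (g \<cdot>\<^bsub>cocycle_cat F\<^esub> f)) = fst (snd g) \<cdot>\<^bsub>PO F JX\<^esub> fst (snd f)"
      by (auto simp: cocycle_cat_def split: prod.splits)
    ultimately show "far (cocycle_forget F) (g \<cdot>\<^bsub>cocycle_cat F\<^esub> f) =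
        far (cocycle_forget F) g \<cdot>\<^bsub>PO F JX\<^esub> far (cocycle_forget F) f"
      using f g by (simp add: cocycle_forget_def)
  qed
  show "\<forall>a\<in>Ob (cocycle_cat F). far (cocycle_forget F) (Idt (cocycle_cat F) a) =
      Idt (PO F JX) (fob (cocycle_forget F) a)"
    using cc.Ar_Idt by (auto simp: cocycle_forget_def) (simp add: cocycle_cat_def)
qed (auto simp: cocycle_forget_def cocycle_cat_def cocycle_arrow_def cocycle_data_def hom_def)

context J_cone
begin

lemma far_cocycle_functor: "h \<in> Ar C \<Longrightarrow> far (cocycle_functor F C \<alpha>) h =
    (cone_cocycle F \<alpha> (Dom C h), far (TO \<alpha> JX) h, cone_cocycle F \<alpha> (Cod C h))"
  by (simp add: cocycle_functor_def)

lemma fob_cocycle_functor: "c \<in> Ob C \<Longrightarrow> fob (cocycle_functor F C \<alpha>) c = cone_cocycle F \<alpha> c"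
  by (simp add: cocycle_functor_def)

lemma cone_cocycle_cone_after:
  "c \<in> Ob E \<Longrightarrow> cone_cocycle F (cone_after \<J> C \<alpha> E H) c = cone_cocycle F \<alpha> (fob H c)"
  by (simp add: cone_cocycle_def cone_after_def)

text \<open>The component at X of a modification is, at every object of \<open>E\<close>, a cocycle
  arrow, so it lifts uniquely to \<open>C\<close>. Faithfulness makes the lifts natural. The
  modification that they induce agrees with the given one at X and hence everywhere.\<close>

lemma fully_faithful_cone_functor:
  assumes ff: "fully_faithful C (cocycle_cat F) (cocycle_functor F C \<alpha>)" and E: "category E"
  shows "fully_faithful (functor_cat E C) (pseudo_cone_cat \<J> E F) (cone_functor \<J> C \<alpha> E)"
proof (rule fully_faithfulI[OF functor_cone_functor[OF E]])
  interpret E: category E by fact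
  let ?L = "cone_functor \<J> C \<alpha> E"
  let ?\<Phi> = "cocycle_functor F C \<alpha>"
  have L_far: "far ?L (H, \<theta>, H') = (cone_after \<J> C \<alpha> E H,
      \<lambda>d\<in>UNIV. \<lambda>c\<in>Ob E. far (TO \<alpha> d) (\<theta> c), cone_after \<J> C \<alpha> E H')"
    if "is_natural E C H H' \<theta>" for H H' \<theta>
    using that by (simp add: cone_functor_def functor_cat_def)
  have L_fob: "fob ?L H = cone_after \<J> C \<alpha> E H" if "is_functor E C H" for H
    using that by (simp add: cone_functor_def functor_cat_def)
  have faithful: "f = f'" if "a \<in> Ob C" "b \<in> Ob C" "f \<in> hom C a b" "f' \<in> hom C a b"
    "far (TO \<alpha> JX) f = far (TO \<alpha> JX) f'" for a b f f'
    using that by (intro fully_faithful_inj[OF ff that(1-4)]) (simp add: far_cocycle_functor hom_def)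
  fix H H'
  assume "H \<in> Ob (functor_cat E C)" "H' \<in> Ob (functor_cat E C)"
  then have H: "is_functor E C H" "is_functor E C H'"
    by (simp_all add: functor_cat_def)
  note [simp] = functor_simps[OF H(1)] functor_simps[OF H(2)] E.cat_simps C.cat_simps TO_J_simps
  show "t = t'" if t: "t \<in> hom (functor_cat E C) H H'" "t' \<in> hom (functor_cat E C) H H'"
    and eq: "far ?L t = far ?L t'" for t t'
  proof -
    obtain \<theta> \<theta>' where \<theta>: "t = (H, \<theta>, H')" "is_natural E C H H' \<theta>"
      and \<theta>': "t' = (H, \<theta>', H')" "is_natural E C H H' \<theta>'"
      using t by (auto simp: functor_cat_def hom_def)
    have "(\<lambda>d\<in>UNIV. \<lambda>c\<in>Ob E. far (TO \<alpha> d) (\<theta> c)) = (\<lambda>d\<in>UNIV. \<lambda>c\<in>Ob E. far (TO \<alpha> d) (\<theta>' c))"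
      using eq by (simp add: \<theta> \<theta>' L_far)
    from this[THEN fun_cong, of JX, THEN fun_cong]
    have "(\<lambda>c\<in>Ob E. far (TO \<alpha> JX) (\<theta> c)) c = (\<lambda>c\<in>Ob E. far (TO \<alpha> JX) (\<theta>' c)) c" for c
      by simp
    then have "far (TO \<alpha> JX) (\<theta> c) = far (TO \<alpha> JX) (\<theta>' c)" if "c \<in> Ob E" for c
      using that by (metis restrict_apply')
    then have "\<theta> c = \<theta>' c" if "c \<in> Ob E" for c
      using that natural_hom[OF \<theta>(2) that] natural_hom[OF \<theta>'(2) that]
      by (intro faithful[of "fob H c" "fob H' c"]) simp_all
    then have "\<theta> = \<theta>'"
      using natural_extensional[OF \<theta>(2)] natural_extensional[OF \<theta>'(2)]
      by (intro extensionalityI[of _ "Ob E"]) auto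
    then show "t = t'" by (simp add: \<theta> \<theta>')
  qed
  fix k
  assume "k \<in> hom (pseudo_cone_cat \<J> E F) (fob ?L H) (fob ?L H')"
  then obtain \<mu> where k: "k = (cone_after \<J> C \<alpha> E H, \<mu>, cone_after \<J> C \<alpha> E H')"
    and \<mu>: "is_modification \<J> (const_pf E) F (cone_after \<J> C \<alpha> E H) (cone_after \<J> C \<alpha> E H') \<mu>"
    by (auto simp: L_fob H hom_def pseudo_cone_cat_def pseudo_nat_cat_def)
  interpret AB: J_cone_pair F E "cone_after \<J> C \<alpha> E H" "cone_after \<J> C \<alpha> E H'"
    using H by (intro J_cone_pair.intro pseudo_cone_pair.intro pseudo_cone_cone_after)
  have "\<forall>c\<in>Ob E. \<exists>t. t \<in> hom C (fob H c) (fob H' c) \<and> far (TO \<alpha> JX) t = \<mu> JX c"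
  proof
    fix c assume c: "c \<in> Ob E"
    have "cocycle_arrow F (cone_cocycle F \<alpha> (fob H c)) (cone_cocycle F \<alpha> (fob H' c)) (\<mu> JX c)"
      using AB.modification_cocycle_arrow[OF \<mu> c] by (simp add: cone_cocycle_cone_after c)
    then have "(cone_cocycle F \<alpha> (fob H c), \<mu> JX c, cone_cocycle F \<alpha> (fob H' c)) \<in>
        hom (cocycle_cat F) (fob ?\<Phi> (fob H c)) (fob ?\<Phi> (fob H' c))"
      using c by (simp add: fob_cocycle_functor hom_def cocycle_cat_def)
    then obtain t where "t \<in> hom C (fob H c) (fob H' c)"
      "far ?\<Phi> t = (cone_cocycle F \<alpha> (fob H c), \<mu> JX c, cone_cocycle F \<alpha> (fob H' c))"
      by (rule fully_faithful_surj[OF ff functor_fob[OF H(1) c] functor_fob[OF H(2) c]])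
    then show "\<exists>t. t \<in> hom C (fob H c) (fob H' c) \<and> far (TO \<alpha> JX) t = \<mu> JX c"
      by (auto simp: far_cocycle_functor hom_Ar)
  qed
  then obtain t where t: "\<And>c. c \<in> Ob E \<Longrightarrow> t c \<in> hom C (fob H c) (fob H' c)"
    and far_t: "\<And>c. c \<in> Ob E \<Longrightarrow> far (TO \<alpha> JX) (t c) = \<mu> JX c"
    by metis
  have [simp]: "t c \<in> Ar C" "Dom C (t c) = fob H c" "Cod C (t c) = fob H' c" if "c \<in> Ob E" for c
    using t[OF that] by (simp_all add: hom_def)
  have "far H' f \<cdot>\<^bsub>C\<^esub> t (Dom E f) = t (Cod E f) \<cdot>\<^bsub>C\<^esub> far H f" if f: "f \<in> Ar E" for f
  proof (rule faithful[of "fob H (Dom E f)" "fob H' (Cod E f)"])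
    show "far (TO \<alpha> JX) (far H' f \<cdot>\<^bsub>C\<^esub> t (Dom E f)) = far (TO \<alpha> JX) (t (Cod E f) \<cdot>\<^bsub>C\<^esub> far H f)"
      using f natural_square[OF modificationD(5)[OF \<mu>, of JX] f]
      by (simp add: cone_after_def far_t)
  qed (use f in \<open>simp_all add: hom_def\<close>)
  then have nat: "is_natural E C H H' (\<lambda>c\<in>Ob E. t c)"
    using H t by (simp add: is_natural_def)
  moreover have "(\<lambda>d\<in>UNIV. \<lambda>c\<in>Ob E. far (TO \<alpha> d) ((\<lambda>c\<in>Ob E. t c) c)) = \<mu>"
    using modification_cone_after[OF nat] by (intro AB.modification_unique[OF _ \<mu>]) (simp_all add: far_t)
  ultimately show "\<exists>t\<in>hom (functor_cat E C) H H'. far ?L t = k"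
    by (intro bexI[of _ "(H, \<lambda>c\<in>Ob E. t c, H')"]) (simp_all add: L_far k, simp add: functor_cat_def hom_def)
qed

text \<open>Essential surjectivity is the remaining point. A cone on \<open>E\<close> yields a
  functor from \<open>E\<close> to cocycles, which a quasi-inverse turns into a functor to
  \<open>C\<close>. The counit compares the cocycles of the two cones, and this comparison extends
  to an isomorphism of cones.\<close>

lemma equivalence_imp_bilimit:
  assumes eq: "is_equivalence C (cocycle_cat F) (cocycle_functor F C \<alpha>)" and E: "category E"
  shows "is_equivalence (functor_cat E C) (pseudo_cone_cat \<J> E F) (cone_functor \<J> C \<alpha> E)"
proof -
  interpret E: category E by fact
  let ?L = "cone_functor \<J> C \<alpha> E"
  let ?\<Phi> = "cocycle_functor F C \<alpha>"
  let ?cc = "cocycle_cat F"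
  obtain S \<epsilon> where S: "is_functor ?cc C S"
    and \<epsilon>: "is_natural_iso ?cc ?cc (comp_fctr ?cc ?\<Phi> S) (id_fctr ?cc) \<epsilon>"
    using eq by (auto simp: is_equivalence_def)
  have \<epsilon>_nat: "is_natural ?cc ?cc (comp_fctr ?cc ?\<Phi> S) (id_fctr ?cc) \<epsilon>"
    using \<epsilon> by (simp add: is_natural_iso_def)
  have "essentially_surjective (functor_cat E C) (pseudo_cone_cat \<J> E F) ?L"
    unfolding essentially_surjective_def
  proof
    fix \<beta> assume "\<beta> \<in> Ob (pseudo_cone_cat \<J> E F)"
    then have \<beta>: "pseudo_cone \<J> F E \<beta>"
      by (intro pseudo_coneI'[OF F.pseudo_functor_axioms E])
        (simp add: pseudo_cone_cat_def pseudo_nat_cat_def)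
    interpret B: J_cone F E \<beta> using \<beta> by (rule J_cone.intro)
    let ?\<Psi> = "cocycle_functor F E \<beta>"
    have \<Psi>: "is_functor E ?cc ?\<Psi>" by (rule B.is_functor_cocycle_functor)
    \<comment> \<open>Using a functor \<open>S\<close> instead of choosing objects of
      \<open>C\<close> one at a time makes \<open>H\<close> functorial and the comparison natural at
      once.\<close>
    define H where "H = comp_fctr E S ?\<Psi>"
    have H: "is_functor E C H" unfolding H_def using \<Psi> S by (rule functor_comp)
    let ?\<gamma> = "cone_after \<J> C \<alpha> E H"
    have \<gamma>: "pseudo_cone \<J> F E ?\<gamma>" by (rule pseudo_cone_cone_after[OF H])
    interpret BG: J_cone_pair F E \<beta> ?\<gamma>
      using \<beta> \<gamma> by (intro J_cone_pair.intro pseudo_cone_pair.intro)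
    interpret GB: J_cone_pair F E ?\<gamma> \<beta>
      using \<beta> \<gamma> by (intro J_cone_pair.intro pseudo_cone_pair.intro)
    interpret cc: category ?cc by (rule JF.category_cocycle_cat)
    let ?U = "cocycle_forget F"
    have U: "is_functor ?cc (PO F JX) ?U" by (rule JF.is_functor_cocycle_forget)
    have far_U: "far ?U k = fst (snd k)" if "k \<in> Ar ?cc" for k
      using that by (simp add: cocycle_forget_def)
    define \<kappa> where "\<kappa> c = \<epsilon> (cone_cocycle F \<beta> c)" for c
    have \<kappa>: "\<kappa> c \<in> Ar ?cc" "Dom ?cc (\<kappa> c) = cone_cocycle F \<alpha> (fob H c)"
      "Cod ?cc (\<kappa> c) = cone_cocycle F \<beta> c" "is_iso ?cc (\<kappa> c)" if c: "c \<in> Ob E" for c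
    proof -
      have x: "cone_cocycle F \<beta> c \<in> Ob ?cc" using B.cone_cocycle_in[OF c] by (simp add: cocycle_cat_def)
      have "fob H c = fob S (cone_cocycle F \<beta> c)" using c by (simp add: H_def B.fob_cocycle_functor)
      then show "\<kappa> c \<in> Ar ?cc" "Dom ?cc (\<kappa> c) = cone_cocycle F \<alpha> (fob H c)"
        "Cod ?cc (\<kappa> c) = cone_cocycle F \<beta> c" "is_iso ?cc (\<kappa> c)"
        using is_natural_isoD[OF \<epsilon> x] x by (simp_all add: \<kappa>_def fob_cocycle_functor functor_fob[OF S])
    qed
    define \<xi> where "\<xi> = (\<lambda>c\<in>Ob E. fst (snd (\<kappa> c)))"
    have \<xi>_U: "\<xi> c = far ?U (\<kappa> c)" if "c \<in> Ob E" for c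
      using that \<kappa> by (simp add: \<xi>_def far_U)
    have arr: "cocycle_arrow F (cone_cocycle F ?\<gamma> c) (cone_cocycle F \<beta> c) (\<xi> c)"
      if c: "c \<in> Ob E" for c
      using \<kappa>[OF c] c by (auto simp: \<xi>_def cocycle_cat_def cone_cocycle_cone_after)
    have arr': "cocycle_arrow F (cone_cocycle F \<beta> c) (cone_cocycle F ?\<gamma> c) (inv_arrow (PO F JX) (\<xi> c))"
      if c: "c \<in> Ob E" for c
    proof -
      \<comment> \<open>The forgetful functor preserves inverses, so the inverse of the X component
        is again an arrow of cocycles and can be extended as well.\<close>
      have "inv_arrow (PO F JX) (\<xi> c) = fst (snd (inv_arrow ?cc (\<kappa> c)))"
        using functor_inv_arrow[OF U \<kappa>(4)[OF c]] \<kappa>[OF c] by (simp add: \<xi>_U c far_U cc.iso_simps)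
      then show ?thesis
        using cc.inv_arrow_Ar[OF \<kappa>(4)[OF c]] cc.Dom_inv_arrow[OF \<kappa>(4)[OF c]]
          cc.Cod_inv_arrow[OF \<kappa>(4)[OF c]] \<kappa>[OF c]
        by (cases "inv_arrow ?cc (\<kappa> c)") (auto simp: cocycle_cat_def cone_cocycle_cone_after c)
    qed
    have \<xi>_iso: "is_iso (PO F JX) (\<xi> c)" if c: "c \<in> Ob E" for c
      using functor_is_iso[OF U \<kappa>(4)[OF c]] by (simp add: \<xi>_U c)
    have TO_\<gamma>: "TO ?\<gamma> JX = comp_fctr E (TO \<alpha> JX) H" by (simp add: cone_after_def)
    have \<xi>_square: "far (TO \<beta> JX) h \<cdot>\<^bsub>PO F JX\<^esub> \<xi> (Dom E h) = \<xi> (Cod E h) \<cdot>\<^bsub>PO F JX\<^esub> far (TO ?\<gamma> JX) h"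
      if h: "h \<in> Ar E" for h
    proof -
      let ?k = "far ?\<Psi> h"
      have k: "?k \<in> Ar ?cc" "Dom ?cc ?k = cone_cocycle F \<beta> (Dom E h)"
        "Cod ?cc ?k = cone_cocycle F \<beta> (Cod E h)"
        using h functor_simps[OF \<Psi>] by (simp_all add: E.cat_simps B.fob_cocycle_functor)
      have Sk: "far H h = far S ?k" using h by (simp add: H_def)
      \<comment> \<open>Naturality of the counit at the image of \<open>h\<close> under the cocycle
        functor of \<beta>; the forgetful functor then carries it to \<open>F(X)\<close>.\<close>
      have "?k \<cdot>\<^bsub>?cc\<^esub> \<kappa> (Dom E h) = \<kappa> (Cod E h) \<cdot>\<^bsub>?cc\<^esub> far ?\<Phi> (far H h)"
        using natural_square[OF \<epsilon>_nat k(1)] k by (simp add: \<kappa>_def Sk)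
      then have "far ?U (?k \<cdot>\<^bsub>?cc\<^esub> \<kappa> (Dom E h)) = far ?U (\<kappa> (Cod E h) \<cdot>\<^bsub>?cc\<^esub> far ?\<Phi> (far H h))"
        by simp
      moreover have Hh: "far H h \<in> Ar C" "Dom C (far H h) = fob H (Dom E h)"
        "Cod C (far H h) = fob H (Cod E h)" "fob H (Cod E h) \<in> Ob C"
        using h by (simp_all add: functor_simps[OF H] E.cat_simps)
      moreover have "far ?\<Phi> (far H h) \<in> Ar ?cc" "Cod ?cc (far ?\<Phi> (far H h)) = cone_cocycle F \<alpha> (fob H (Cod E h))"
        "fst (snd (far ?\<Phi> (far H h))) = far (TO \<alpha> JX) (far H h)"
        using functor_far[OF is_functor_cocycle_functor Hh(1)]
          functor_Cod[OF is_functor_cocycle_functor Hh(1)] Hh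
        by (simp_all add: fob_cocycle_functor far_cocycle_functor)
      moreover have "fst (snd ?k) = far (TO \<beta> JX) h"
        using h by (simp add: B.far_cocycle_functor)
      ultimately show ?thesis
        using h k \<kappa> functor_Comp[OF U] by (simp add: E.cat_simps \<xi>_U far_U TO_\<gamma>)
    qed
    have \<xi>_nat: "is_natural E (PO F JX) (TO ?\<gamma> JX) (TO \<beta> JX) \<xi>"
      unfolding is_natural_def
    proof (intro conjI ballI pseudo_cone.TO_functor[OF \<gamma>]
        pseudo_cone.TO_functor[OF \<beta>] \<xi>_square)
      show "\<xi> c \<in> hom (PO F JX) (fob (TO ?\<gamma> JX) c) (fob (TO \<beta> JX) c)" if "c \<in> Ob E" for c
        using arr[OF that] by (simp add: cocycle_arrow_def cone_cocycle_def)
    qed (simp_all add: \<xi>_def)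
    then have nat_iso: "is_natural_iso E (PO F JX) (TO ?\<gamma> JX) (TO \<beta> JX) \<xi>"
      using \<xi>_iso by (simp add: is_natural_iso_def)
    obtain \<mu> where \<mu>: "is_modification \<J> (const_pf E) F ?\<gamma> \<beta> \<mu>" "\<mu> JX = \<xi>"
      using GB.modification_extend[OF \<xi>_nat arr] by blast
    obtain \<nu> where \<nu>: "is_modification \<J> (const_pf E) F \<beta> ?\<gamma> \<nu>"
      "\<nu> JX = (\<lambda>c\<in>Ob E. inv_arrow (PO F JX) (\<xi> c))"
      using BG.modification_extend[OF is_natural_inverse[OF nat_iso]] arr' by auto
    interpret GG: J_cone_pair F E ?\<gamma> ?\<gamma> ..
    interpret BB: J_cone_pair F E \<beta> \<beta> ..
    note \<xi>_simps = is_natural_isoD[OF nat_iso]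
    \<comment> \<open>The extensions of \<xi> and of its inverse were made separately. That they are
      inverse to each other need only be seen at X, since modifications are determined
      there.\<close>
    have "(\<lambda>d\<in>Ob \<J>. \<lambda>c\<in>Ob E. \<nu> d c \<cdot>\<^bsub>PO F d\<^esub> \<mu> d c) =
        (\<lambda>d\<in>Ob \<J>. \<lambda>c\<in>Ob E. Idt (PO F d) (fob (TO ?\<gamma> d) c))"
      by (rule GG.modification_unique[OF modification_Comp[OF F.pseudo_functor_axioms E \<mu>(1) \<nu>(1)]
            modification_Idt[OF \<gamma>]])
        (simp add: \<mu> \<nu> JF.X.iso_simps \<xi>_simps)
    moreover have "(\<lambda>d\<in>Ob \<J>. \<lambda>c\<in>Ob E. \<mu> d c \<cdot>\<^bsub>PO F d\<^esub> \<nu> d c) =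
        (\<lambda>d\<in>Ob \<J>. \<lambda>c\<in>Ob E. Idt (PO F d) (fob (TO \<beta> d) c))"
      by (rule BB.modification_unique[OF modification_Comp[OF F.pseudo_functor_axioms E \<nu>(1) \<mu>(1)]
            modification_Idt[OF \<beta>]])
        (simp add: \<mu> \<nu> JF.X.iso_simps \<xi>_simps)
    ultimately have "is_iso (pseudo_cone_cat \<J> E F) (?\<gamma>, \<mu>, \<beta>)"
      unfolding is_iso_def inverse_arrows_def using \<mu>(1) \<nu>(1)
      by (intro exI[of _ "(\<beta>, \<nu>, ?\<gamma>)"]) (simp add: pseudo_cone_cat_def pseudo_nat_cat_def hom_def)
    moreover have "(?\<gamma>, \<mu>, \<beta>) \<in> hom (pseudo_cone_cat \<J> E F) (fob ?L H) \<beta>"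
      using \<mu>(1) H by (simp add: pseudo_cone_cat_def pseudo_nat_cat_def hom_def cone_functor_def
          functor_cat_def)
    moreover have "H \<in> Ob (functor_cat E C)" using H by (simp add: functor_cat_def)
    ultimately show "\<exists>H\<in>Ob (functor_cat E C). \<exists>f\<in>hom (pseudo_cone_cat \<J> E F) (fob ?L H) \<beta>.
        is_iso (pseudo_cone_cat \<J> E F) f"
      by blast
  qed
  then show ?thesis
    using fully_faithful_cone_functor[OF equivalence_imp_fully_faithful[OF eq] E]
      functor_cone_functor[OF E] by (simp add: equivalence_iff)
qed

text \<open>The right-hand side mentions no test category. So the bilimit property is the same for
  every choice of the types \<open>'oe\<close> and \<open>'me\<close>.\<close>

theorem is_bilimit_iff:
  "is_bilimit TYPE(('oe, 'me) cat) \<J> F C \<alpha> \<longleftrightarrow>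
    is_equivalence C (cocycle_cat F) (cocycle_functor F C \<alpha>)"
proof
  assume "is_bilimit TYPE(('oe, 'me) cat) \<J> F C \<alpha>"
  then have "is_equivalence (functor_cat (point_cat :: ('oe, 'me) cat) C)
      (pseudo_cone_cat \<J> (point_cat :: ('oe, 'me) cat) F) (cone_functor \<J> C \<alpha> point_cat)"
    by (simp add: is_bilimit_def category_point_cat)
  then show "is_equivalence C (cocycle_cat F) (cocycle_functor F C \<alpha>)"
    by (rule bilimit_imp_equivalence)
next
  assume "is_equivalence C (cocycle_cat F) (cocycle_functor F C \<alpha>)"
  then show "is_bilimit TYPE(('oe, 'me) cat) \<J> F C \<alpha>"
    by (simp add: is_bilimit_def F.pseudo_functor_axioms C.category_axioms natural
        equivalence_imp_bilimit)
qed

end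

section \<open>Isomorphisms and products of categories, pullbacks\<close>

text \<open>Transport of structure: \<open>B\<close> is merely a record, and its category laws are
  carried over along the bijections. This later shows that \<open>descent_cat\<close> is a category
  without checking its laws by hand.\<close>

lemma category_isomorphism:
  assumes A: "category A"
    and ext: "fob R \<in> extensional (Ob A)" "far R \<in> extensional (Ar A)"
    and ob: "bij_betw (fob R) (Ob A) (Ob B)" and ar: "bij_betw (far R) (Ar A) (Ar B)"
    and Dom: "\<And>f. f \<in> Ar A \<Longrightarrow> Dom B (far R f) = fob R (Dom A f)"
    and Cod: "\<And>f. f \<in> Ar A \<Longrightarrow> Cod B (far R f) = fob R (Cod A f)"
    and Idt: "\<And>a. a \<in> Ob A \<Longrightarrow> Idt B (fob R a) = far R (Idt A a)"
    and Comp: "\<And>f g. \<lbrakk>f \<in> Ar A; g \<in> Ar A; Dom A g = Cod A f\<rbrakk>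
      \<Longrightarrow> far R g \<cdot>\<^bsub>B\<^esub> far R f = far R (g \<cdot>\<^bsub>A\<^esub> f)"
  shows "is_functor A B R" and "fully_faithful A B R"
proof -
  interpret A: category A by fact
  have inj: "a = a'" if "a \<in> Ob A" "a' \<in> Ob A" "fob R a = fob R a'" for a a'
    using ob that unfolding bij_betw_def inj_on_def by blast
  have Ar: "\<exists>f'\<in>Ar A. f = far R f'" if "f \<in> Ar B" for f
    using ar that unfolding bij_betw_def by blast
  have Ob: "\<exists>a'\<in>Ob A. a = fob R a'" if "a \<in> Ob B" for a
    using ob that unfolding bij_betw_def by blast
  have fob: "fob R a \<in> Ob B" if "a \<in> Ob A" for a
    using ob that unfolding bij_betw_def by blast
  have far: "far R f \<in> Ar B" if "f \<in> Ar A" for f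
    using ar that unfolding bij_betw_def by blast
  have hom_B: "\<exists>f'. f' \<in> Ar A \<and> f = far R f' \<and> fob R (Dom A f') = a \<and> fob R (Cod A f') = c"
    if f: "f \<in> hom B a c" for f a c
  proof -
    obtain f' where "f' \<in> Ar A" "f = far R f'" using Ar[OF hom_Ar[OF f]] by blast
    then show ?thesis using f by (auto simp: hom_def Dom Cod)
  qed
  have B: "category B"
  proof
    show "Dom B f \<in> Ob B" "Cod B f \<in> Ob B" if "f \<in> Ar B" for f
      using Ar[OF that] by (auto simp: Dom Cod fob A.cat_simps)
    show "Idt B a \<in> hom B a a" if "a \<in> Ob B" for a
      using Ob[OF that] by (auto simp: Idt hom_def far Dom Cod A.cat_simps)
    show "Idt B c \<cdot>\<^bsub>B\<^esub> f = f" "f \<cdot>\<^bsub>B\<^esub> Idt B a = f" if "f \<in> hom B a c" for f a c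
      using hom_B[OF that] by (auto simp: Idt Comp A.cat_simps)
    show "g \<cdot>\<^bsub>B\<^esub> f \<in> hom B a d" if f: "f \<in> hom B a c" and g: "g \<in> hom B c d" for f g a c d
    proof -
      obtain f' g' where fg: "f' \<in> Ar A" "g' \<in> Ar A" "f = far R f'" "g = far R g'"
        and eq: "fob R (Dom A f') = a" "fob R (Cod A f') = c" "fob R (Dom A g') = c"
          "fob R (Cod A g') = d"
        using hom_B[OF f] hom_B[OF g] by blast
      \<comment> \<open>Composability in \<open>B\<close> only equates the images of the two
        objects; injectivity on objects makes the preimages composable.\<close>
      then have "Dom A g' = Cod A f'"
        using inj[of "Dom A g'" "Cod A f'"] by (simp add: A.cat_simps)
      then show ?thesis
        using fg eq by (auto simp: Comp hom_def far Dom Cod A.cat_simps)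
    qed
    show "(h \<cdot>\<^bsub>B\<^esub> g) \<cdot>\<^bsub>B\<^esub> f = h \<cdot>\<^bsub>B\<^esub> (g \<cdot>\<^bsub>B\<^esub> f)"
      if f: "f \<in> hom B a c" and g: "g \<in> hom B c d" and h: "h \<in> hom B d e" for f g h a c d e
    proof -
      obtain f' g' h' where fg: "f' \<in> Ar A" "g' \<in> Ar A" "h' \<in> Ar A" "f = far R f'" "g = far R g'"
          "h = far R h'"
        and eq: "fob R (Cod A f') = c" "fob R (Dom A g') = c" "fob R (Cod A g') = d"
          "fob R (Dom A h') = d"
        using hom_B[OF f] hom_B[OF g] hom_B[OF h] by blast
      then have "Dom A g' = Cod A f'" "Dom A h' = Cod A g'"
        using inj[of "Dom A g'" "Cod A f'"] inj[of "Dom A h'" "Cod A g'"]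
        by (simp_all add: A.cat_simps)
      then show ?thesis
        using fg by (simp add: Comp A.cat_simps)
    qed
  qed
  show R: "is_functor A B R"
    unfolding is_functor_def using ext fob far
    by (auto simp: A B Dom Cod Idt Comp PiE_def)
  show "fully_faithful A B R"
  proof (rule fully_faithfulI[OF R])
    show "f = f'" if "f \<in> hom A a c" "f' \<in> hom A a c" "far R f = far R f'" for f f' a c
      using ar that unfolding bij_betw_def inj_on_def hom_def by blast
    show "\<exists>f\<in>hom A a c. far R f = h"
      if ac: "a \<in> Ob A" "c \<in> Ob A" and h: "h \<in> hom B (fob R a) (fob R c)" for a c h
    proof -
      obtain f where f: "f \<in> Ar A" "h = far R f" "fob R (Dom A f) = fob R a" "fob R (Cod A f) = fob R c"
        using hom_B[OF h] by blast
      then have "Dom A f = a" "Cod A f = c"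
        using ac inj[of "Dom A f" a] inj[of "Cod A f" c] by (simp_all add: A.cat_simps)
      then show ?thesis using f by (auto simp: hom_def)
    qed
  qed
qed

text \<open>On hom-sets \<open>R\<close> is a bijection, so composing with it neither creates nor
  destroys bijectivity. On objects it is onto, and it preserves and reflects isomorphisms.\<close>

lemma equivalence_comp_isomorphism_iff:
  assumes R: "is_functor A B R" "fully_faithful A B R" and surj: "fob R ` Ob A = Ob B"
    and T: "is_functor C A T"
  shows "is_equivalence C B (comp_fctr C R T) \<longleftrightarrow> is_equivalence C A T"
proof -
  interpret C: category C using T by (simp add: is_functor_def)
  interpret A: category A using T by (simp add: is_functor_def)
  have bij_iff: "bij_betw (far (comp_fctr C R T)) (hom C a c)
      (hom B (fob (comp_fctr C R T) a) (fob (comp_fctr C R T) c)) \<longleftrightarrow>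
      bij_betw (far T) (hom C a c) (hom A (fob T a) (fob T c))" if ac: "a \<in> Ob C" "c \<in> Ob C" for a c
  proof -
    have R_bij: "bij_betw (far R) (hom A (fob T a) (fob T c)) (hom B (fob R (fob T a)) (fob R (fob T c)))"
      using R(2) ac functor_fob[OF T] by (simp add: fully_faithful_def)
    have "bij_betw (far (comp_fctr C R T)) (hom C a c) X \<longleftrightarrow> bij_betw (far R \<circ> far T) (hom C a c) X" for X
      by (rule bij_betw_cong) (simp add: hom_Ar)
    moreover have "far T ` hom C a c \<subseteq> hom A (fob T a) (fob T c)"
      using functor_hom[OF T] by blast
    ultimately show ?thesis
      using bij_betw_comp_iff2[OF R_bij, of "far T" "hom C a c"] ac by simp
  qed
  have "fully_faithful C B (comp_fctr C R T) \<longleftrightarrow> fully_faithful C A T"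
    unfolding fully_faithful_def using bij_iff by blast
  moreover have "essentially_surjective C B (comp_fctr C R T) \<longleftrightarrow> essentially_surjective C A T"
  proof
    assume es: "essentially_surjective C B (comp_fctr C R T)"
    show "essentially_surjective C A T"
      unfolding essentially_surjective_def
    proof
      fix d assume d: "d \<in> Ob A"
      then have "fob R d \<in> Ob B" using surj by blast
      then obtain c f where c: "c \<in> Ob C" and f: "f \<in> hom B (fob R (fob T c)) (fob R d)" "is_iso B f"
        using es unfolding essentially_surjective_def by fastforce
      obtain f' where f': "f' \<in> hom A (fob T c) d" "far R f' = f"
        using fully_faithful_surj[OF R(2) functor_fob[OF T c] d f(1)] .
      then show "\<exists>c\<in>Ob C. \<exists>f\<in>hom A (fob T c) d. is_iso A f"
        using c f(2) fully_faithful_reflects_iso[OF R hom_Ar[OF f'(1)]] by auto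
    qed
  next
    assume es: "essentially_surjective C A T"
    show "essentially_surjective C B (comp_fctr C R T)"
      unfolding essentially_surjective_def
    proof
      fix e assume "e \<in> Ob B"
      then obtain d where d: "d \<in> Ob A" "e = fob R d" using surj by blast
      obtain c f where c: "c \<in> Ob C" and f: "f \<in> hom A (fob T c) d" "is_iso A f"
        using es d(1) unfolding essentially_surjective_def by blast
      then show "\<exists>c\<in>Ob C. \<exists>f\<in>hom B (fob (comp_fctr C R T) c) e. is_iso B f"
        using functor_hom[OF R(1) f(1)] functor_is_iso[OF R(1) f(2)] d(2)
        by (intro bexI[of _ c] bexI[of _ "far R f"]) simp_all
    qed
  qed
  ultimately show ?thesis
    using functor_comp[OF T R(1)] T by (simp add: equivalence_iff)
qed

section \<open>Products of categories\<close>

lemma prod_cat_simps: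
  "Ob (prod_cat S C) = (\<Pi>\<^sub>E s\<in>S. Ob (C s))" "Ar (prod_cat S C) = (\<Pi>\<^sub>E s\<in>S. Ar (C s))"
  "Dom (prod_cat S C) f = (\<lambda>s\<in>S. Dom (C s) (f s))" "Cod (prod_cat S C) f = (\<lambda>s\<in>S. Cod (C s) (f s))"
  "Idt (prod_cat S C) a = (\<lambda>s\<in>S. Idt (C s) (a s))"
  "g \<cdot>\<^bsub>prod_cat S C\<^esub> f = (\<lambda>s\<in>S. g s \<cdot>\<^bsub>C s\<^esub> f s)"
  by (simp_all add: prod_cat_def)

lemma restrict_eq_iff: "(\<lambda>s\<in>S. f s) = a \<longleftrightarrow> a \<in> extensional S \<and> (\<forall>s\<in>S. f s = a s)"
  by (auto intro: extensionalityI[of _ S])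

lemma hom_prod_cat: "f \<in> hom (prod_cat S C) a b \<longleftrightarrow>
    f \<in> extensional S \<and> a \<in> extensional S \<and> b \<in> extensional S \<and>
    (\<forall>s\<in>S. f s \<in> hom (C s) (a s) (b s))"
  by (auto simp: hom_def prod_cat_simps restrict_eq_iff PiE_iff)

lemma category_prod_cat:
  assumes C: "\<And>s. s \<in> S \<Longrightarrow> category (C s)"
  shows "category (prod_cat S C)"
proof
  show "Dom (prod_cat S C) f \<in> Ob (prod_cat S C)" "Cod (prod_cat S C) f \<in> Ob (prod_cat S C)"
    if "f \<in> Ar (prod_cat S C)" for f
    using that category.Dom_in[OF C] category.Cod_in[OF C] by (auto simp: prod_cat_simps PiE_iff)
  show "Idt (prod_cat S C) a \<in> hom (prod_cat S C) a a" if "a \<in> Ob (prod_cat S C)" for a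
    using that category.Idt_in[OF C] by (auto simp: hom_prod_cat prod_cat_simps PiE_iff)
  show "g \<cdot>\<^bsub>prod_cat S C\<^esub> f \<in> hom (prod_cat S C) a c"
    if "f \<in> hom (prod_cat S C) a b" "g \<in> hom (prod_cat S C) b c" for f g a b c
    using that category.Comp_in[OF C] by (auto simp: hom_prod_cat prod_cat_simps)
  show "Idt (prod_cat S C) b \<cdot>\<^bsub>prod_cat S C\<^esub> f = f" "f \<cdot>\<^bsub>prod_cat S C\<^esub> Idt (prod_cat S C) a = f"
    if f: "f \<in> hom (prod_cat S C) a b" for f a b
  proof -
    have "f \<in> extensional S" and h: "\<And>s. s \<in> S \<Longrightarrow> f s \<in> hom (C s) (a s) (b s)"
      using f by (simp_all add: hom_prod_cat)
    moreover have "Idt (C s) (b s) \<cdot>\<^bsub>C s\<^esub> f s = f s" "f s \<cdot>\<^bsub>C s\<^esub> Idt (C s) (a s) = f s" if "s \<in> S" for s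
      using category.Idt_left[OF C[OF that] h[OF that]] category.Idt_right[OF C[OF that] h[OF that]] .
    ultimately show "Idt (prod_cat S C) b \<cdot>\<^bsub>prod_cat S C\<^esub> f = f"
      "f \<cdot>\<^bsub>prod_cat S C\<^esub> Idt (prod_cat S C) a = f"
      by (simp_all add: prod_cat_simps restrict_eq_iff)
  qed
  show "(h \<cdot>\<^bsub>prod_cat S C\<^esub> g) \<cdot>\<^bsub>prod_cat S C\<^esub> f = h \<cdot>\<^bsub>prod_cat S C\<^esub> (g \<cdot>\<^bsub>prod_cat S C\<^esub> f)"
    if f: "f \<in> hom (prod_cat S C) a b" and g: "g \<in> hom (prod_cat S C) b c"
      and h: "h \<in> hom (prod_cat S C) c d" for f g h a b c d
  proof -
    have "(h s \<cdot>\<^bsub>C s\<^esub> g s) \<cdot>\<^bsub>C s\<^esub> f s = h s \<cdot>\<^bsub>C s\<^esub> (g s \<cdot>\<^bsub>C s\<^esub> f s)" if s: "s \<in> S" for s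
      by (rule category.Comp_assoc[OF C[OF s]]) (use f g h s in \<open>auto simp: hom_prod_cat\<close>)
    then show ?thesis by (simp add: prod_cat_simps restrict_eq_iff)
  qed
qed

text \<open>The formula for the inverse is what allows a restriction in \<open>F(Z)\<close>, which
  contains an inverse coherence cell, to be computed at each tuple.\<close>

lemma iso_prod_cat:
  assumes C: "\<And>s. s \<in> S \<Longrightarrow> category (C s)" and f: "f \<in> extensional S"
    and iso: "\<And>s. s \<in> S \<Longrightarrow> is_iso (C s) (f s)"
  shows "is_iso (prod_cat S C) f" and "inv_arrow (prod_cat S C) f = (\<lambda>s\<in>S. inv_arrow (C s) (f s))"
proof -
  have Ar: "f s \<in> Ar (C s)" "inv_arrow (C s) (f s) \<in> Ar (C s)" if "s \<in> S" for s
    using category.is_iso_Ar[OF C iso] category.inv_arrow_Ar[OF C iso] that by auto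
  have "inverse_arrows (prod_cat S C) f (\<lambda>s\<in>S. inv_arrow (C s) (f s))"
    using f Ar category.Dom_inv_arrow[OF C iso] category.Cod_inv_arrow[OF C iso]
      category.inv_arrow_left[OF C iso] category.inv_arrow_right[OF C iso]
    by (auto simp: inverse_arrows_def hom_def prod_cat_simps PiE_iff intro!: restrict_ext)
  then show "is_iso (prod_cat S C) f" "inv_arrow (prod_cat S C) f = (\<lambda>s\<in>S. inv_arrow (C s) (f s))"
    using category.inv_arrow_eq[OF category_prod_cat[OF C]] by (auto simp: is_iso_def)
qed

lemma is_iso_prod_cat_component:
  assumes "is_iso (prod_cat S C) f" "s \<in> S"
  shows "is_iso (C s) (f s)"
proof -
  obtain g where "inverse_arrows (prod_cat S C) f g" using assms(1) by (auto simp: is_iso_def)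
  then have f: "f \<in> (\<Pi>\<^sub>E s\<in>S. Ar (C s))" "g \<in> (\<Pi>\<^sub>E s\<in>S. Ar (C s))"
    and eq: "(\<lambda>s\<in>S. Dom (C s) (g s)) = (\<lambda>s\<in>S. Cod (C s) (f s))"
      "(\<lambda>s\<in>S. Cod (C s) (g s)) = (\<lambda>s\<in>S. Dom (C s) (f s))"
      "(\<lambda>s\<in>S. g s \<cdot>\<^bsub>C s\<^esub> f s) = (\<lambda>s\<in>S. Idt (C s) ((\<lambda>s\<in>S. Dom (C s) (f s)) s))"
      "(\<lambda>s\<in>S. f s \<cdot>\<^bsub>C s\<^esub> g s) = (\<lambda>s\<in>S. Idt (C s) ((\<lambda>s\<in>S. Cod (C s) (f s)) s))"
    by (simp_all add: inverse_arrows_def hom_def prod_cat_simps)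
  from eq[THEN fun_cong, of s] have "inverse_arrows (C s) (f s) (g s)"
    using f assms(2) by (auto simp: inverse_arrows_def hom_def)
  then show ?thesis by (auto simp: is_iso_def)
qed

lemma dual_simps [simp]:
  "Ob (dual C) = Ob C" "Ar (dual C) = Ar C" "Dom (dual C) = Cod C" "Cod (dual C) = Dom C"
  "Idt (dual C) = Idt C" "g \<cdot>\<^bsub>dual C\<^esub> f = f \<cdot>\<^bsub>C\<^esub> g" "hom (dual C) a b = hom C b a"
  by (auto simp: dual_def hom_def)

section \<open>Chosen pullbacks and the fibre products of a family\<close>

lemma is_pullback_pb:
  assumes "has_pullbacks \<B>" "f \<in> Ar \<B>" "g \<in> Ar \<B>" "Cod \<B> f = Cod \<B> g"
  shows "is_pullback \<B> f g (fst (pb \<B> f g)) (snd (pb \<B> f g))"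
proof -
  have "\<exists>x. case x of (p, q) \<Rightarrow> is_pullback \<B> f g p q"
    using assms by (auto simp: has_pullbacks_def)
  from someI_ex[OF this] show ?thesis
    unfolding pb_def by (auto split: prod.splits)
qed

text \<open>Phrased for the description operator so that it applies directly to the definitions of
  \<open>pi13\<close> and \<open>pi23\<close>.\<close>

lemma pullback_mediating:
  fixes \<B> :: "('b, 'f) cat"
  assumes pb: "is_pullback \<B> f g p q"
    and u: "u \<in> Ar \<B>" "Cod \<B> u = Dom \<B> f" and v: "v \<in> Ar \<B>" "Cod \<B> v = Dom \<B> g"
    and uv: "Dom \<B> u = Dom \<B> v" "f \<cdot>\<^bsub>\<B>\<^esub> u = g \<cdot>\<^bsub>\<B>\<^esub> v"
  defines "m \<equiv> THE h. h \<in> hom \<B> (Dom \<B> u) (Dom \<B> p) \<and> p \<cdot>\<^bsub>\<B>\<^esub> h = u \<and> q \<cdot>\<^bsub>\<B>\<^esub> h = v"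
  shows "m \<in> Ar \<B>" "Dom \<B> m = Dom \<B> u" "Cod \<B> m = Dom \<B> p" "p \<cdot>\<^bsub>\<B>\<^esub> m = u" "q \<cdot>\<^bsub>\<B>\<^esub> m = v"
proof -
  have "\<exists>!h. h \<in> hom \<B> (Dom \<B> u) (Dom \<B> p) \<and> p \<cdot>\<^bsub>\<B>\<^esub> h = u \<and> q \<cdot>\<^bsub>\<B>\<^esub> h = v"
    using pb u v uv unfolding is_pullback_def by metis
  from theI'[OF this]
  show "m \<in> Ar \<B>" "Dom \<B> m = Dom \<B> u" "Cod \<B> m = Dom \<B> p" "p \<cdot>\<^bsub>\<B>\<^esub> m = u" "q \<cdot>\<^bsub>\<B>\<^esub> m = v"
    unfolding m_def by (simp_all add: hom_def)
qed

locale base_cover = B: category \<B> for \<B> :: "('b, 'f) cat" +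
  fixes b :: 'b and I :: "'i set" and g :: "'i \<Rightarrow> 'f"
  assumes pullbacks: "has_pullbacks \<B>"
    and cover_Ar: "i \<in> I \<Longrightarrow> g i \<in> Ar \<B>" and cover_Cod: "i \<in> I \<Longrightarrow> Cod \<B> (g i) = b"
begin

lemma pullback2: "\<lbrakk>i \<in> I; j \<in> I\<rbrakk> \<Longrightarrow> is_pullback \<B> (g i) (g j) (pi1 \<B> g i j) (pi2 \<B> g i j)"
  unfolding pi1_def pi2_def using pullbacks by (rule is_pullback_pb) (simp_all add: cover_Ar cover_Cod)

lemma pi_simps:
  assumes "i \<in> I" "j \<in> I"
  shows "pi1 \<B> g i j \<in> Ar \<B>" "Cod \<B> (pi1 \<B> g i j) = Dom \<B> (g i)"
    "pi2 \<B> g i j \<in> Ar \<B>" "Dom \<B> (pi2 \<B> g i j) = Dom \<B> (pi1 \<B> g i j)" "Cod \<B> (pi2 \<B> g i j) = Dom \<B> (g j)"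
    "g j \<cdot>\<^bsub>\<B>\<^esub> pi2 \<B> g i j = g i \<cdot>\<^bsub>\<B>\<^esub> pi1 \<B> g i j"
  using pullback2[OF assms] by (simp_all add: is_pullback_def)

text \<open>The triple product is formed asymmetrically, over the pair \<open>i\<close>,
  \<open>j\<close> first, so two of its projections are mediating arrows. The equations are oriented
  so that each of the three maps down to the members of the family has a single normal form.\<close>

lemma triple_simps:
  assumes i: "i \<in> I" and j: "j \<in> I" and k: "k \<in> I"
  shows "pi12 \<B> g i j k \<in> Ar \<B>" "Cod \<B> (pi12 \<B> g i j k) = Dom \<B> (pi1 \<B> g i j)"
    "proj3 \<B> g i j k \<in> Ar \<B>" "Dom \<B> (proj3 \<B> g i j k) = Dom \<B> (pi12 \<B> g i j k)"
    "Cod \<B> (proj3 \<B> g i j k) = Dom \<B> (g k)"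
    "g k \<cdot>\<^bsub>\<B>\<^esub> proj3 \<B> g i j k = g i \<cdot>\<^bsub>\<B>\<^esub> (pi1 \<B> g i j \<cdot>\<^bsub>\<B>\<^esub> pi12 \<B> g i j k)"
    "pi13 \<B> g i j k \<in> Ar \<B>" "Dom \<B> (pi13 \<B> g i j k) = Dom \<B> (pi12 \<B> g i j k)"
    "Cod \<B> (pi13 \<B> g i j k) = Dom \<B> (pi1 \<B> g i k)"
    "pi1 \<B> g i k \<cdot>\<^bsub>\<B>\<^esub> pi13 \<B> g i j k = pi1 \<B> g i j \<cdot>\<^bsub>\<B>\<^esub> pi12 \<B> g i j k"
    "pi2 \<B> g i k \<cdot>\<^bsub>\<B>\<^esub> pi13 \<B> g i j k = proj3 \<B> g i j k"
    "pi23 \<B> g i j k \<in> Ar \<B>" "Dom \<B> (pi23 \<B> g i j k) = Dom \<B> (pi12 \<B> g i j k)"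
    "Cod \<B> (pi23 \<B> g i j k) = Dom \<B> (pi1 \<B> g j k)"
    "pi1 \<B> g j k \<cdot>\<^bsub>\<B>\<^esub> pi23 \<B> g i j k = pi2 \<B> g i j \<cdot>\<^bsub>\<B>\<^esub> pi12 \<B> g i j k"
    "pi2 \<B> g j k \<cdot>\<^bsub>\<B>\<^esub> pi23 \<B> g i j k = proj3 \<B> g i j k"
    "g j \<cdot>\<^bsub>\<B>\<^esub> (pi2 \<B> g i j \<cdot>\<^bsub>\<B>\<^esub> pi12 \<B> g i j k) =
      g i \<cdot>\<^bsub>\<B>\<^esub> (pi1 \<B> g i j \<cdot>\<^bsub>\<B>\<^esub> pi12 \<B> g i j k)"
proof -
  note [simp] = i j k cover_Ar cover_Cod pi_simps B.cat_simps
  have "is_pullback \<B> (g i \<cdot>\<^bsub>\<B>\<^esub> pi1 \<B> g i j) (g k) (pi12 \<B> g i j k) (proj3 \<B> g i j k)"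
    unfolding pi12_def proj3_def using pullbacks by (rule is_pullback_pb) simp_all
  then have p [simp]: "pi12 \<B> g i j k \<in> Ar \<B>" "Cod \<B> (pi12 \<B> g i j k) = Dom \<B> (pi1 \<B> g i j)"
    "proj3 \<B> g i j k \<in> Ar \<B>" "Dom \<B> (proj3 \<B> g i j k) = Dom \<B> (pi12 \<B> g i j k)"
    "Cod \<B> (proj3 \<B> g i j k) = Dom \<B> (g k)"
    and raw: "(g i \<cdot>\<^bsub>\<B>\<^esub> pi1 \<B> g i j) \<cdot>\<^bsub>\<B>\<^esub> pi12 \<B> g i j k = g k \<cdot>\<^bsub>\<B>\<^esub> proj3 \<B> g i j k"
    by (simp_all add: is_pullback_def)
  show "pi12 \<B> g i j k \<in> Ar \<B>" "Cod \<B> (pi12 \<B> g i j k) = Dom \<B> (pi1 \<B> g i j)"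
    "proj3 \<B> g i j k \<in> Ar \<B>" "Dom \<B> (proj3 \<B> g i j k) = Dom \<B> (pi12 \<B> g i j k)"
    "Cod \<B> (proj3 \<B> g i j k) = Dom \<B> (g k)"
    by (rule p)+
  show eq: "g k \<cdot>\<^bsub>\<B>\<^esub> proj3 \<B> g i j k = g i \<cdot>\<^bsub>\<B>\<^esub> (pi1 \<B> g i j \<cdot>\<^bsub>\<B>\<^esub> pi12 \<B> g i j k)"
    unfolding raw[symmetric] by simp
  \<comment> \<open>\<open>proj3\<close> and the second projection after \<open>pi12\<close> agree
    over the base; this is the compatibility that the mediating arrow \<open>pi23\<close>
    requires.\<close>
  have "g j \<cdot>\<^bsub>\<B>\<^esub> (pi2 \<B> g i j \<cdot>\<^bsub>\<B>\<^esub> pi12 \<B> g i j k) = (g j \<cdot>\<^bsub>\<B>\<^esub> pi2 \<B> g i j) \<cdot>\<^bsub>\<B>\<^esub> pi12 \<B> g i j k"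
    by (rule B.assoc[symmetric]) simp_all
  also have "\<dots> = g i \<cdot>\<^bsub>\<B>\<^esub> (pi1 \<B> g i j \<cdot>\<^bsub>\<B>\<^esub> pi12 \<B> g i j k)"
    by simp
  finally show eq': "g j \<cdot>\<^bsub>\<B>\<^esub> (pi2 \<B> g i j \<cdot>\<^bsub>\<B>\<^esub> pi12 \<B> g i j k) =
      g i \<cdot>\<^bsub>\<B>\<^esub> (pi1 \<B> g i j \<cdot>\<^bsub>\<B>\<^esub> pi12 \<B> g i j k)" .
  show "pi13 \<B> g i j k \<in> Ar \<B>" "Dom \<B> (pi13 \<B> g i j k) = Dom \<B> (pi12 \<B> g i j k)"
    "Cod \<B> (pi13 \<B> g i j k) = Dom \<B> (pi1 \<B> g i k)"
    "pi1 \<B> g i k \<cdot>\<^bsub>\<B>\<^esub> pi13 \<B> g i j k = pi1 \<B> g i j \<cdot>\<^bsub>\<B>\<^esub> pi12 \<B> g i j k"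
    "pi2 \<B> g i k \<cdot>\<^bsub>\<B>\<^esub> pi13 \<B> g i j k = proj3 \<B> g i j k"
    using pullback_mediating[OF pullback2[OF i k], of "pi1 \<B> g i j \<cdot>\<^bsub>\<B>\<^esub> pi12 \<B> g i j k" "proj3 \<B> g i j k"] eq
    by (simp_all add: pi13_def)
  show "pi23 \<B> g i j k \<in> Ar \<B>" "Dom \<B> (pi23 \<B> g i j k) = Dom \<B> (pi12 \<B> g i j k)"
    "Cod \<B> (pi23 \<B> g i j k) = Dom \<B> (pi1 \<B> g j k)"
    "pi1 \<B> g j k \<cdot>\<^bsub>\<B>\<^esub> pi23 \<B> g i j k = pi2 \<B> g i j \<cdot>\<^bsub>\<B>\<^esub> pi12 \<B> g i j k"
    "pi2 \<B> g j k \<cdot>\<^bsub>\<B>\<^esub> pi23 \<B> g i j k = proj3 \<B> g i j k"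
    using pullback_mediating[OF pullback2[OF j k], of "pi2 \<B> g i j \<cdot>\<^bsub>\<B>\<^esub> pi12 \<B> g i j k" "proj3 \<B> g i j k"] eq' eq
    by (simp_all add: pi23_def)
qed

lemma to_base_in:
  assumes "t \<in> tuples I x"
  shows "to_base \<B> g t \<in> Ar \<B>" "Cod \<B> (to_base \<B> g t) = b"
  using assms by (cases x; auto simp: cover_Ar cover_Cod pi_simps triple_simps B.cat_simps)+

lemma face_in: "t \<in> tuples I (jcod u) \<Longrightarrow> face u t \<in> tuples I (jdom u)"
  by (cases u) auto

text \<open>The last equation says that all projections are maps over the base, so that
  \<open>to_base\<close> is a cocone on the fibre products; the pseudo cone of the cover is its
  image under \<open>G\<close>.\<close>

lemma proj_in:
  assumes "t \<in> tuples I (jcod u)"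
  shows "proj \<B> g u t \<in> Ar \<B>" "Dom \<B> (proj \<B> g u t) = Dom \<B> (to_base \<B> g t)"
    "Cod \<B> (proj \<B> g u t) = Dom \<B> (to_base \<B> g (face u t))"
    "to_base \<B> g (face u t) \<cdot>\<^bsub>\<B>\<^esub> proj \<B> g u t = to_base \<B> g t"
  using assms
  by (cases u; auto simp: cover_Ar cover_Cod pi_simps triple_simps to_base_in B.cat_simps; fail)+

lemma proj_hom:
  "t \<in> tuples I (jcod u) \<Longrightarrow>
    proj \<B> g u t \<in> hom (dual \<B>) (Dom \<B> (to_base \<B> g (face u t))) (Dom \<B> (to_base \<B> g t))"
  by (simp add: proj_in hom_def)

lemma to_base_hom: "t \<in> tuples I x \<Longrightarrow> to_base \<B> g t \<in> hom (dual \<B>) b (Dom \<B> (to_base \<B> g t))"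
  by (simp add: to_base_in hom_def)

text \<open>The relations of \<J> mirror the pullback identities, so the two factorisations of a
  composite give the same projection.\<close>

lemma face_proj_jcomp:
  assumes "t \<in> tuples I (jcod v)" "jdom v = jcod u" "u \<notin> range jid" "v \<notin> range jid"
  shows "face u (face v t) = face (jcomp v u) t"
    and "proj \<B> g u (face v t) \<cdot>\<^bsub>\<B>\<^esub> proj \<B> g v t = proj \<B> g (jcomp v u) t"
proof -
  have "(v, u) \<in> {(F12, F1), (F12, F2), (F13, F1), (F13, F2), (F23, F1), (F23, F2)}"
    using assms(2-4) by (rule composable_nonidentities)
  then show "face u (face v t) = face (jcomp v u) t"
    "proj \<B> g u (face v t) \<cdot>\<^bsub>\<B>\<^esub> proj \<B> g v t = proj \<B> g (jcomp v u) t"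
    using assms(1) by (auto simp: jcomp_def range_jid triple_simps)
qed

end

section \<open>The pseudo functor of a cover\<close>

locale cover = base_cover \<B> b I g + G: pseudo_functor "dual \<B>" G
  for \<B> :: "('b, 'f) cat" and b :: 'b and I :: "'i set" and g :: "'i \<Rightarrow> 'f"
    and G :: "('b, 'f, 'o, 'm) pfctr" +
  assumes b_in: "b \<in> Ob \<B>"
begin

abbreviation F where "F \<equiv> cover_pf \<B> G I g"

abbreviation ob where "ob \<equiv> cover_ob \<B> G I g"

lemma category_fibre: "t \<in> tuples I x \<Longrightarrow> category (fibre \<B> G g t)"
  unfolding fibre_def by (rule G.PO_category) (simp add: to_base_in B.cat_simps)

lemma category_ob: "category (ob x)"
  unfolding cover_ob_def by (rule category_prod_cat) (rule category_fibre)

lemma proj_functor: "t \<in> tuples I (jcod u) \<Longrightarrow>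
    is_functor (fibre \<B> G g (face u t)) (fibre \<B> G g t) (PM G (proj \<B> g u t))"
  unfolding fibre_def by (rule G.PM_functor[OF proj_hom])

lemma cover_map_id: "u \<in> range jid \<Longrightarrow> cover_map \<B> G I g u = id_fctr (ob (jdom u))"
  by (simp add: cover_map_def)

lemma cover_map_simps:
  assumes "u \<notin> range jid"
  shows "a \<in> Ob (ob (jdom u)) \<Longrightarrow> fob (cover_map \<B> G I g u) a =
      (\<lambda>t\<in>tuples I (jcod u). fob (PM G (proj \<B> g u t)) (a (face u t)))"
    and "\<xi> \<in> Ar (ob (jdom u)) \<Longrightarrow> far (cover_map \<B> G I g u) \<xi> =
      (\<lambda>t\<in>tuples I (jcod u). far (PM G (proj \<B> g u t)) (\<xi> (face u t)))"
  using assms by (simp_all add: cover_map_def)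

lemma Ob_ob: "a \<in> Ob (ob x) \<longleftrightarrow>
    a \<in> extensional (tuples I x) \<and> (\<forall>t\<in>tuples I x. a t \<in> Ob (fibre \<B> G g t))"
  by (auto simp: cover_ob_def prod_cat_simps PiE_iff)

lemma Ar_ob: "\<xi> \<in> Ar (ob x) \<longleftrightarrow>
    \<xi> \<in> extensional (tuples I x) \<and> (\<forall>t\<in>tuples I x. \<xi> t \<in> Ar (fibre \<B> G g t))"
  by (auto simp: cover_ob_def prod_cat_simps PiE_iff)

lemma hom_ob: "\<xi> \<in> hom (ob x) a c \<longleftrightarrow>
    \<xi> \<in> extensional (tuples I x) \<and> a \<in> extensional (tuples I x) \<and> c \<in> extensional (tuples I x) \<and>
    (\<forall>t\<in>tuples I x. \<xi> t \<in> hom (fibre \<B> G g t) (a t) (c t))"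
  by (simp add: cover_ob_def hom_prod_cat)

lemma ob_simps:
  "Dom (ob x) \<xi> = (\<lambda>t\<in>tuples I x. Dom (fibre \<B> G g t) (\<xi> t))"
  "Cod (ob x) \<xi> = (\<lambda>t\<in>tuples I x. Cod (fibre \<B> G g t) (\<xi> t))"
  "Idt (ob x) a = (\<lambda>t\<in>tuples I x. Idt (fibre \<B> G g t) (a t))"
  "\<zeta> \<cdot>\<^bsub>ob x\<^esub> \<xi> = (\<lambda>t\<in>tuples I x. \<zeta> t \<cdot>\<^bsub>fibre \<B> G g t\<^esub> \<xi> t)"
  by (simp_all add: cover_ob_def prod_cat_simps)

lemma iso_ob:
  assumes "f \<in> extensional (tuples I x)" "\<And>t. t \<in> tuples I x \<Longrightarrow> is_iso (fibre \<B> G g t) (f t)"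
  shows "is_iso (ob x) f" "inv_arrow (ob x) f = (\<lambda>t\<in>tuples I x. inv_arrow (fibre \<B> G g t) (f t))"
  unfolding cover_ob_def using iso_prod_cat[OF category_fibre assms] by simp_all

lemma cover_map_functor: "is_functor (ob (jdom u)) (ob (jcod u)) (cover_map \<B> G I g u)"
proof (cases "u \<in> range jid")
  case True
  then have "jcod u = jdom u" by (auto simp: range_jid)
  then show ?thesis using True by (simp add: cover_map_id functor_id category_ob)
next
  case False
  interpret X: category "ob (jdom u)" by (rule category_ob)
  note map = cover_map_simps[OF False]
  \<comment> \<open>Composability in a product is an equation of restricted families; it has to be
    read at each tuple before \<open>G\<close> can be applied to a composite.\<close>
  have comp: "Dom (fibre \<B> G g t) (f t) = Cod (fibre \<B> G g t) (h t)"
    if "(\<lambda>t\<in>tuples I x. Dom (fibre \<B> G g t) (f t)) = (\<lambda>t\<in>tuples I x. Cod (fibre \<B> G g t) (h t))"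
      "t \<in> tuples I x" for f h x t
    using fun_cong[OF that(1), of t] that(2) by simp
  show ?thesis
    unfolding is_functor_def
  proof (intro conjI ballI impI category_ob)
    show "fob (cover_map \<B> G I g u) \<in> Ob (ob (jdom u)) \<rightarrow>\<^sub>E Ob (ob (jcod u))"
    proof
      show "fob (cover_map \<B> G I g u) a \<in> Ob (ob (jcod u))" if "a \<in> Ob (ob (jdom u))" for a
        unfolding map(1)[OF that] using that face_in functor_fob[OF proj_functor] by (simp add: Ob_ob)
    qed (simp add: cover_map_def False)
    show "far (cover_map \<B> G I g u) \<in> Ar (ob (jdom u)) \<rightarrow>\<^sub>E Ar (ob (jcod u))"
    proof
      show "far (cover_map \<B> G I g u) a \<in> Ar (ob (jcod u))" if "a \<in> Ar (ob (jdom u))" for a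
        unfolding map(2)[OF that] using that face_in functor_far[OF proj_functor] by (simp add: Ar_ob)
    qed (simp add: cover_map_def False)
    fix f assume f: "f \<in> Ar (ob (jdom u))"
    then have f': "f (face u t) \<in> Ar (fibre \<B> G g (face u t))" if "t \<in> tuples I (jcod u)" for t
      using face_in[OF that] by (simp add: Ar_ob)
    show "Dom (ob (jcod u)) (far (cover_map \<B> G I g u) f) = fob (cover_map \<B> G I g u) (Dom (ob (jdom u)) f)"
      unfolding map(2)[OF f] map(1)[OF X.Dom_in[OF f]]
      by (rule extensionalityI[of _ "tuples I (jcod u)"])
        (simp_all add: ob_simps face_in functor_Dom[OF proj_functor] f')
    show "Cod (ob (jcod u)) (far (cover_map \<B> G I g u) f) = fob (cover_map \<B> G I g u) (Cod (ob (jdom u)) f)"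
      unfolding map(2)[OF f] map(1)[OF X.Cod_in[OF f]]
      by (rule extensionalityI[of _ "tuples I (jcod u)"])
        (simp_all add: ob_simps face_in functor_Cod[OF proj_functor] f')
    fix h assume h: "h \<in> Ar (ob (jdom u))" and hf: "Dom (ob (jdom u)) h = Cod (ob (jdom u)) f"
    then have h': "h (face u t) \<in> Ar (fibre \<B> G g (face u t))"
      and hf': "Dom (fibre \<B> G g (face u t)) (h (face u t)) = Cod (fibre \<B> G g (face u t)) (f (face u t))"
      if "t \<in> tuples I (jcod u)" for t
      using face_in[OF that] comp[OF hf[unfolded ob_simps] face_in[OF that]] by (simp_all add: Ar_ob)
    show "far (cover_map \<B> G I g u) (h \<cdot>\<^bsub>ob (jdom u)\<^esub> f) =
        far (cover_map \<B> G I g u) h \<cdot>\<^bsub>ob (jcod u)\<^esub> far (cover_map \<B> G I g u) f"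
      unfolding map(2)[OF f] map(2)[OF h] map(2)[OF X.Ar_Comp[OF f h hf]]
      by (rule extensionalityI[of _ "tuples I (jcod u)"])
        (simp_all add: ob_simps face_in functor_Comp[OF proj_functor] f' h' hf')
  next
    fix a assume a: "a \<in> Ob (ob (jdom u))"
    then have a': "a (face u t) \<in> Ob (fibre \<B> G g (face u t))" if "t \<in> tuples I (jcod u)" for t
      using face_in[OF that] by (simp add: Ob_ob)
    show "far (cover_map \<B> G I g u) (Idt (ob (jdom u)) a) = Idt (ob (jcod u)) (fob (cover_map \<B> G I g u) a)"
      unfolding map(1)[OF a] map(2)[OF X.Ar_Idt[OF a]]
      by (rule extensionalityI[of _ "tuples I (jcod u)"])
        (simp_all add: ob_simps face_in functor_Idt[OF proj_functor] a')
  qed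
qed

lemma F_simps [simp]: "PO F x = ob x" "PM F u = cover_map \<B> G I g u"
  "a \<in> Ob (ob x) \<Longrightarrow> PU F x a = Idt (ob x) a"
  by (simp_all add: cover_pf_def)

lemma PC_F_id:
  "\<lbrakk>a \<in> Ob (ob (jdom u)); u \<in> range jid \<or> v \<in> range jid\<rbrakk> \<Longrightarrow>
    PC F v u a = Idt (ob (jcod v)) (fob (cover_map \<B> G I g (jcomp v u)) a)"
  by (simp add: cover_pf_def)

lemma PC_F:
  "\<lbrakk>a \<in> Ob (ob (jdom u)); u \<notin> range jid; v \<notin> range jid\<rbrakk> \<Longrightarrow>
    PC F v u a = (\<lambda>t\<in>tuples I (jcod v).
      PC G (proj \<B> g v t) (proj \<B> g u (face v t)) (a (face u (face v t))))"
  by (simp add: cover_pf_def)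

lemma PC_G_simps:
  assumes t: "t \<in> tuples I (jcod v)" and vu: "jdom v = jcod u" "u \<notin> range jid" "v \<notin> range jid"
    and a: "a \<in> Ob (fibre \<B> G g (face u (face v t)))"
  defines "P \<equiv> PC G (proj \<B> g v t) (proj \<B> g u (face v t)) a"
  shows "P \<in> Ar (fibre \<B> G g t)"
    "Dom (fibre \<B> G g t) P = fob (PM G (proj \<B> g v t)) (fob (PM G (proj \<B> g u (face v t))) a)"
    "Cod (fibre \<B> G g t) P = fob (PM G (proj \<B> g (jcomp v u) t)) a"
    "is_iso (fibre \<B> G g t) P"
  using G.PC_simps[OF proj_hom proj_hom, OF _ t, of u a] face_in[OF t] a vu
    face_proj_jcomp(2)[OF t vu]
  unfolding P_def fibre_def by simp_all

text \<open>If one factor is an identity, the two functors coincide and the cell is an identity.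
  Otherwise the cell is a tuple of coherence cells of \<open>G\<close>, whose naturality is that of
  \<open>G\<close> at each tuple.\<close>

lemma PC_F_natural_iso:
  assumes vu: "jdom v = jcod u"
  shows "is_natural_iso (ob (jdom u)) (ob (jcod v))
    (comp_fctr (ob (jdom u)) (cover_map \<B> G I g v) (cover_map \<B> G I g u))
    (cover_map \<B> G I g (jcomp v u)) (PC F v u)"
proof (cases "u \<in> range jid \<or> v \<in> range jid")
  case True
  have ends: "jdom (jcomp v u) = jdom u" "jcod (jcomp v u) = jcod v"
    using category.Comp_in[OF category_J, of u "jdom u" "jcod u" v "jcod v"] vu
    by (simp_all add: hom_J Comp_J)
  have eq: "PC F v u = (\<lambda>a\<in>Ob (ob (jdom u)). Idt (ob (jcod v)) (fob (cover_map \<B> G I g (jcomp v u)) a))"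
    using True by (auto simp: cover_pf_def intro!: restrict_ext)
  have "comp_fctr (ob (jdom u)) (cover_map \<B> G I g v) (cover_map \<B> G I g u) = cover_map \<B> G I g (jcomp v u)"
  proof (cases "u \<in> range jid")
    case True
    then have "jdom u = jdom v" using vu by (auto simp: range_jid)
    then show ?thesis
      using True comp_fctr_id(1)[OF cover_map_functor[of v]] by (simp add: cover_map_id jcomp_def)
  next
    case False
    then have v: "v \<in> range jid" using True by simp
    then show ?thesis
      using False vu comp_fctr_id(2)[OF cover_map_functor[of u]] by (simp add: cover_map_id jcomp_def)
  qed
  then show ?thesis
    unfolding eq using is_natural_iso_Idt[OF cover_map_functor[of "jcomp v u"]] by (simp add: ends)
next
  case False
  then have nid: "u \<notin> range jid" "v \<notin> range jid" by auto
  \<comment> \<open>The value of \<open>cover_map\<close> is given by cases, so a composite has to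
    be recognised as a non-identity before it can be unfolded.\<close>
  have vu_nid: "jcomp v u \<notin> range jid"
    using nid vu unfolding range_jid by (auto simp: jcomp_def)
  have ends: "jdom (jcomp v u) = jdom u" "jcod (jcomp v u) = jcod v"
    using category.Comp_in[OF category_J, of u "jdom u" "jcod u" v "jcod v"] vu
    by (simp_all add: hom_J Comp_J)
  have comp: "is_functor (ob (jdom u)) (ob (jcod v))
      (comp_fctr (ob (jdom u)) (cover_map \<B> G I g v) (cover_map \<B> G I g u))"
    using functor_comp[OF cover_map_functor[of u]] cover_map_functor[of v] vu by simp
  interpret X: category "ob (jdom u)" by (rule category_ob)
  interpret Y: category "ob (jcod u)" by (rule category_ob)
  have face: "face v t \<in> tuples I (jcod u)" "face u (face v t) \<in> tuples I (jdom u)"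
    if "t \<in> tuples I (jcod v)" for t
    using face_in[OF that] face_in[of "face v t" u] vu by simp_all
  have fob_u: "fob (cover_map \<B> G I g u) a \<in> Ob (ob (jdom v))" if "a \<in> Ob (ob (jdom u))" for a
    using functor_fob[OF cover_map_functor that] vu by simp
  have far_u: "far (cover_map \<B> G I g u) a \<in> Ar (ob (jdom v))" if "a \<in> Ar (ob (jdom u))" for a
    using functor_far[OF cover_map_functor that] vu by simp
  show ?thesis
    unfolding is_natural_iso_def is_natural_def
  proof (intro conjI ballI comp)
    show "is_functor (ob (jdom u)) (ob (jcod v)) (cover_map \<B> G I g (jcomp v u))"
      using cover_map_functor[of "jcomp v u"] by (simp add: ends)
    show "PC F v u \<in> extensional (Ob (ob (jdom u)))"
      by (simp add: cover_pf_def)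
    fix a assume a: "a \<in> Ob (ob (jdom u))"
    then have a': "a (face u (face v t)) \<in> Ob (fibre \<B> G g (face u (face v t)))"
      if "t \<in> tuples I (jcod v)" for t
      using face[OF that] by (simp add: Ob_ob)
    note P = PC_G_simps[OF _ vu nid a']
    show "PC F v u a \<in> hom (ob (jcod v))
        (fob (comp_fctr (ob (jdom u)) (cover_map \<B> G I g v) (cover_map \<B> G I g u)) a)
        (fob (cover_map \<B> G I g (jcomp v u)) a)"
      using a fob_u[OF a] face P vu
      by (simp add: PC_F nid hom_ob cover_map_simps vu_nid ends)
        (simp add: hom_def face_proj_jcomp(1)[OF _ vu nid])
    show "is_iso (ob (jcod v)) (PC F v u a)"
      unfolding PC_F[OF a nid] by (rule iso_ob(1)) (simp_all add: P)
  next
    fix f assume f: "f \<in> Ar (ob (jdom u))"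
    then have f': "f (face u (face v t)) \<in> Ar (fibre \<B> G g (face u (face v t)))"
      if "t \<in> tuples I (jcod v)" for t
      using face[OF that] by (simp add: Ar_ob)
    have nat: "far (PM G (proj \<B> g (jcomp v u) t)) (f (face (jcomp v u) t)) \<cdot>\<^bsub>fibre \<B> G g t\<^esub>
        PC G (proj \<B> g v t) (proj \<B> g u (face v t))
          (Dom (fibre \<B> G g (face u (face v t))) (f (face u (face v t)))) =
        PC G (proj \<B> g v t) (proj \<B> g u (face v t))
          (Cod (fibre \<B> G g (face u (face v t))) (f (face u (face v t)))) \<cdot>\<^bsub>fibre \<B> G g t\<^esub>
        far (PM G (proj \<B> g v t)) (far (PM G (proj \<B> g u (face v t))) (f (face u (face v t))))"
      if t: "t \<in> tuples I (jcod v)" for t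
      using G.PC_natural[OF proj_hom[OF face(1)[OF t]] proj_hom[OF t], of "f (face u (face v t))"] f'[OF t]
      by (simp add: fibre_def face_proj_jcomp[OF t vu nid])
    show "far (cover_map \<B> G I g (jcomp v u)) f \<cdot>\<^bsub>ob (jcod v)\<^esub> PC F v u (Dom (ob (jdom u)) f) =
        PC F v u (Cod (ob (jdom u)) f) \<cdot>\<^bsub>ob (jcod v)\<^esub>
        far (comp_fctr (ob (jdom u)) (cover_map \<B> G I g v) (cover_map \<B> G I g u)) f"
      unfolding PC_F[OF X.Dom_in[OF f] nid] PC_F[OF X.Cod_in[OF f] nid] far_comp[OF f]
      using f far_u[OF f] nat face vu
      by (auto simp: cover_map_simps nid vu_nid ends ob_simps intro!: restrict_ext)
  qed
qed

text \<open>In the associativity law one of the three arrows is an identity, whose functor and cells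
  are identities; each of the three positions then leaves the same cell on both sides.\<close>

lemma pseudo_functor_F: "pseudo_functor \<J> F"
proof -
  interpret J: category \<J> by (rule category_J)
  have far_Idt: "far (cover_map \<B> G I g u) (Idt (ob (jdom u)) a) = Idt (ob (jcod u)) (fob (cover_map \<B> G I g u) a)"
    if "a \<in> Ob (ob (jdom u))" for u a
    using functor_Idt[OF cover_map_functor that] .
  have fob: "fob (cover_map \<B> G I g u) a \<in> Ob (ob (jcod u))" if "a \<in> Ob (ob (jdom u))" for u a
    using functor_fob[OF cover_map_functor that] .
  have ends: "jdom (jcomp v u) = jdom u" "jcod (jcomp v u) = jcod v" if "jdom v = jcod u" for u v
    using J.Comp_in[of u "jdom u" "jcod u" v "jcod v"] that by (simp_all add: hom_J Comp_J)
  have right: "jcomp v u = v" if "u \<in> range jid" for u v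
    using that by (simp add: jcomp_def)
  have id_ends: "jdom (jid x) = x" "jcod (jid x) = x" for x
    by (cases x; simp)+
  have left: "jcomp v u = u" if "v \<in> range jid" "jdom v = jcod u" for u v
  proof -
    from that obtain x where "v = jid x" by auto
    then have "v = jid (jcod u)" using that(2) by (simp add: id_ends)
    then show ?thesis
      using J.Idt_left[of u "jdom u" "jcod u"] by (simp add: hom_J Comp_J)
  qed
  have PC: "PC F v u a \<in> Ar (ob (jcod v))"
    "Dom (ob (jcod v)) (PC F v u a) = fob (cover_map \<B> G I g v) (fob (cover_map \<B> G I g u) a)"
    "Cod (ob (jcod v)) (PC F v u a) = fob (cover_map \<B> G I g (jcomp v u)) a"
    if "jdom v = jcod u" "a \<in> Ob (ob (jdom u))" for u v a
    using is_natural_isoD[OF PC_F_natural_iso[OF that(1)] that(2)] that(2) by simp_all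
  have assoc: "PC F p (jcomp q r) a \<cdot>\<^bsub>ob (jcod p)\<^esub> far (cover_map \<B> G I g p) (PC F q r a) =
      PC F (jcomp p q) r a \<cdot>\<^bsub>ob (jcod p)\<^esub> PC F p q (fob (cover_map \<B> G I g r) a)"
    if q: "jdom q = jcod r" and p: "jdom p = jcod q" and a: "a \<in> Ob (ob (jdom r))" for p q r a
  proof -
    have a': "fob (cover_map \<B> G I g r) a \<in> Ob (ob (jdom q))" using fob[OF a] q by simp
    consider "r \<in> range jid" | "q \<in> range jid" | "p \<in> range jid"
      using q p nonidentity_ends[of r] nonidentity_ends[of q] nonidentity_ends[of p]
      by (metis jobj.exhaust)
    then show ?thesis
    proof cases
      case 1
      then have d: "jcod r = jdom r" "cover_map \<B> G I g r = id_fctr (ob (jdom r))"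
        by (auto simp: range_jid cover_map_id)
      have "PC F q r a = Idt (ob (jcod q)) (fob (cover_map \<B> G I g q) a)"
        "PC F (jcomp p q) r a = Idt (ob (jcod p)) (fob (cover_map \<B> G I g (jcomp p q)) a)"
        using 1 a by (simp_all add: PC_F_id right ends p)
      then show ?thesis
        using 1 a d q p PC[of p q a] far_Idt[of "fob (cover_map \<B> G I g q) a" p] fob[of a q]
        by (simp add: right category.left_unit[OF category_ob] category.right_unit[OF category_ob])
    next
      case 2
      then have d: "jcod q = jdom q" "cover_map \<B> G I g q = id_fctr (ob (jdom q))"
        by (auto simp: range_jid cover_map_id)
      have "PC F q r a = Idt (ob (jcod q)) (fob (cover_map \<B> G I g r) a)"
        "PC F p q (fob (cover_map \<B> G I g r) a) =
          Idt (ob (jcod p)) (fob (cover_map \<B> G I g p) (fob (cover_map \<B> G I g r) a))"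
        using 2 a a' q by (simp_all add: PC_F_id left right)
      then show ?thesis
        using 2 a d q p PC[of p r a] far_Idt[of "fob (cover_map \<B> G I g r) a" p] a'
        by (simp add: left right category.left_unit[OF category_ob] category.right_unit[OF category_ob])
    next
      case 3
      then have d: "jcod p = jdom p" "cover_map \<B> G I g p = id_fctr (ob (jdom p))"
        by (auto simp: range_jid cover_map_id)
      have "PC F p (jcomp q r) a = Idt (ob (jcod p)) (fob (cover_map \<B> G I g (jcomp q r)) a)"
        "PC F p q (fob (cover_map \<B> G I g r) a) =
          Idt (ob (jcod p)) (fob (cover_map \<B> G I g q) (fob (cover_map \<B> G I g r) a))"
        using 3 a a' q p by (simp_all add: PC_F_id left ends)
      then show ?thesis
        using 3 a d q p PC[of q r a] a'
        by (simp add: left category.left_unit[OF category_ob] category.right_unit[OF category_ob])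
    qed
  qed
  show ?thesis
    unfolding pseudo_functor_def pseudo_functor_axioms_def
  proof (intro conjI allI impI category_J)
    show "category (PO F x)" for x by (simp add: category_ob)
    show "is_functor (PO F d) (PO F e) (PM F p)" if "p \<in> hom \<J> d e" for p d e
      using that cover_map_functor[of p] by (auto simp: hom_J)
    show "is_natural_iso (PO F c) (PO F e) (comp_fctr (PO F c) (PM F p) (PM F q)) (PM F (p \<cdot>\<^bsub>\<J>\<^esub> q)) (PC F p q)"
      if "q \<in> hom \<J> c d" "p \<in> hom \<J> d e" for p q c d e
      using that PC_F_natural_iso[of p q] by (auto simp: hom_J Comp_J)
    show "is_natural_iso (PO F d) (PO F d) (id_fctr (PO F d)) (PM F (Idt \<J> d)) (PU F d)" for d
    proof -
      have "PU F d = (\<lambda>a\<in>Ob (ob d). Idt (ob d) (fob (id_fctr (ob d)) a))"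
        by (auto simp: cover_pf_def intro!: restrict_ext)
      then show ?thesis
        using is_natural_iso_Idt[OF functor_id[OF category_ob]] by (simp add: cover_map_id id_ends)
    qed
    show "PC F p (q \<cdot>\<^bsub>\<J>\<^esub> r) a \<cdot>\<^bsub>PO F e\<^esub> far (PM F p) (PC F q r a) =
        PC F (p \<cdot>\<^bsub>\<J>\<^esub> q) r a \<cdot>\<^bsub>PO F e\<^esub> PC F p q (fob (PM F r) a)"
      if "r \<in> hom \<J> b c" "q \<in> hom \<J> c d" "p \<in> hom \<J> d e" "a \<in> Ob (PO F b)" for r q p b c d e a
      using that assoc[of q r p a] by (auto simp: hom_J Comp_J)
    show "PC F p (Idt \<J> d) a \<cdot>\<^bsub>PO F e\<^esub> far (PM F p) (PU F d a) = Idt (PO F e) (fob (PM F p) a)"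
      if "p \<in> hom \<J> d e" "a \<in> Ob (PO F d)" for p d e a
      using that far_Idt[of a p] fob[of a p]
      by (auto simp: hom_J PC_F_id id_ends right category.Ar_Idt[OF category_ob]
          category.Cod_Idt[OF category_ob] category.left_unit[OF category_ob])
    show "PC F (Idt \<J> e) p a \<cdot>\<^bsub>PO F e\<^esub> PU F e (fob (PM F p) a) = Idt (PO F e) (fob (PM F p) a)"
      if "p \<in> hom \<J> d e" "a \<in> Ob (PO F d)" for p d e a
      using that fob[of a p]
      by (auto simp: hom_J PC_F_id id_ends left category.Ar_Idt[OF category_ob]
            category.Cod_Idt[OF category_ob] category.left_unit[OF category_ob])
  qed
qed

sublocale J_functor F
  using pseudo_functor_F by (rule J_functor.intro)

end

section \<open>The pseudo cone of a cover and its cocycles\<close>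

context cover
begin

text \<open>With the unfolding of \<open>tuples\<close> switched off below, arguments stay uniform
  in the tuple; these rules are the passage from tuples to indices.\<close>

lemma tuples_all:
  "(\<forall>t\<in>tuples I JX. P t) \<longleftrightarrow> (\<forall>i\<in>I. P [i])"
  "(\<forall>t\<in>tuples I JY. P t) \<longleftrightarrow> (\<forall>i\<in>I. \<forall>j\<in>I. P [i, j])"
  "(\<forall>t\<in>tuples I JZ. P t) \<longleftrightarrow> (\<forall>i\<in>I. \<forall>j\<in>I. \<forall>k\<in>I. P [i, j, k])"
  by auto

lemma in_tuples [simp]:
  "[i] \<in> tuples I JX \<longleftrightarrow> i \<in> I" "[i, j] \<in> tuples I JY \<longleftrightarrow> i \<in> I \<and> j \<in> I"
  "[i, j, k] \<in> tuples I JZ \<longleftrightarrow> i \<in> I \<and> j \<in> I \<and> k \<in> I"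
  by auto

declare tuples.simps [simp del]

section \<open>The pseudo cone over the base\<close>

abbreviation W where "W \<equiv> PO G b"

abbreviation leg where "leg \<equiv> cover_leg \<B> G b I g"

lemma category_W: "category W"
  using G.PO_category b_in by simp

lemma to_base_functor: "t \<in> tuples I x \<Longrightarrow> is_functor W (fibre \<B> G g t) (PM G (to_base \<B> g t))"
  unfolding fibre_def by (rule G.PM_functor[OF to_base_hom])

lemma leg_simps:
  "a \<in> Ob W \<Longrightarrow> fob (leg x) a = (\<lambda>t\<in>tuples I x. fob (PM G (to_base \<B> g t)) a)"
  "\<xi> \<in> Ar W \<Longrightarrow> far (leg x) \<xi> = (\<lambda>t\<in>tuples I x. far (PM G (to_base \<B> g t)) \<xi>)"
  by (simp_all add: cover_leg_def)

lemma leg_functor: "is_functor W (ob x) (leg x)"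
proof -
  interpret W: category W by (rule category_W)
  show ?thesis
    unfolding is_functor_def
  proof (intro conjI ballI impI category_W category_ob)
    show "fob (leg x) \<in> Ob W \<rightarrow>\<^sub>E Ob (ob x)"
      using functor_fob[OF to_base_functor] by (auto simp: leg_simps Ob_ob) (simp add: cover_leg_def)
    show "far (leg x) \<in> Ar W \<rightarrow>\<^sub>E Ar (ob x)"
      using functor_far[OF to_base_functor] by (auto simp: leg_simps Ar_ob) (simp add: cover_leg_def)
  qed (auto simp: leg_simps ob_simps W.cat_simps functor_simps[OF to_base_functor] intro!: restrict_ext)
qed

lemma PC_leg_simps:
  assumes t: "t \<in> tuples I (jcod u)" and a: "a \<in> Ob W"
  defines "P \<equiv> PC G (proj \<B> g u t) (to_base \<B> g (face u t)) a"
  shows "P \<in> Ar (fibre \<B> G g t)"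
    "Dom (fibre \<B> G g t) P = fob (PM G (proj \<B> g u t)) (fob (PM G (to_base \<B> g (face u t))) a)"
    "Cod (fibre \<B> G g t) P = fob (PM G (to_base \<B> g t)) a"
    "is_iso (fibre \<B> G g t) P"
  using G.PC_simps[OF to_base_hom[OF face_in[OF t]] proj_hom[OF t] a] proj_in(4)[OF t]
  unfolding P_def fibre_def by simp_all

abbreviation cone where "cone \<equiv> cover_cone \<B> G b I g"

lemma cone_simps:
  "TO cone x = leg x"
  "\<lbrakk>a \<in> Ob W; u \<in> range jid\<rbrakk> \<Longrightarrow> TC cone u a = Idt (ob (jcod u)) (fob (leg (jcod u)) a)"
  "\<lbrakk>a \<in> Ob W; u \<notin> range jid\<rbrakk> \<Longrightarrow> TC cone u a =
    (\<lambda>t\<in>tuples I (jcod u). PC G (proj \<B> g u t) (to_base \<B> g (face u t)) a)"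
  by (simp_all add: cover_cone_def)

text \<open>Cells at non-identity arrows are tuples of coherence cells of \<open>G\<close> for a
  projection followed by the map to the base. Naturality holds tuple by tuple, and the composition
  law is the associativity of the coherence of \<open>G\<close>.\<close>

lemma pseudo_cone_cone: "pseudo_cone \<J> F W cone"
proof (rule pseudo_coneI[OF pseudo_functor_F category_W])
  interpret W: category W by (rule category_W)
  have leg_in: "fob (leg x) a \<in> Ob (ob x)" if "a \<in> Ob W" for x a
    using functor_fob[OF leg_functor that] .
  have TC: "TC cone u c \<in> hom (ob (jcod u)) (fob (cover_map \<B> G I g u) (fob (leg (jdom u)) c))
      (fob (leg (jcod u)) c) \<and> is_iso (ob (jcod u)) (TC cone u c)" if c: "c \<in> Ob W" for u c
  proof (cases "u \<in> range jid")
    case True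
    then have "jdom u = jcod u" by (auto simp: range_jid)
    then show ?thesis
      using True c leg_in category.Idt_in[OF category_ob] category.is_iso_Idt[OF category_ob]
      by (simp add: cone_simps cover_map_id)
  next
    case False
    have "is_iso (ob (jcod u)) (TC cone u c)"
      unfolding cone_simps(3)[OF c False] by (rule iso_ob(1)) (simp_all add: PC_leg_simps c)
    then show ?thesis
      using False c PC_leg_simps[OF _ c] face_in leg_in[OF c]
      by (simp add: cone_simps hom_ob cover_map_simps) (simp add: leg_simps hom_def)
  qed
  show "is_functor W (PO F d) (TO cone d)" for d
    using leg_functor by (simp add: cone_simps)
  show "TC cone u c \<in> hom (PO F e) (fob (PM F u) (fob (TO cone d) c)) (fob (TO cone e) c)"
    "is_iso (PO F e) (TC cone u c)" if "u \<in> hom \<J> d e" "c \<in> Ob W" for u d e c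
    using TC[OF that(2), of u] that(1) by (auto simp: hom_J cone_simps)
  show "far (TO cone e) h \<cdot>\<^bsub>PO F e\<^esub> TC cone u (Dom W h) =
      TC cone u (Cod W h) \<cdot>\<^bsub>PO F e\<^esub> far (PM F u) (far (TO cone d) h)"
    if u: "u \<in> hom \<J> d e" and h: "h \<in> Ar W" for u d e h
  proof -
    interpret e: category "ob e" by (rule category_ob)
    have d: "jdom u = d" "jcod u = e" using u by (simp_all add: hom_J)
    have leg_h: "far (leg x) h \<in> Ar (ob x)" for x using functor_far[OF leg_functor h] .
    show ?thesis
    proof (cases "u \<in> range jid")
      case True
      then have de: "d = e" using d by (auto simp: range_jid)
      show ?thesis
        using True h d de leg_h functor_Dom[OF leg_functor h] functor_Cod[OF leg_functor h]
        by (simp add: cone_simps cover_map_id W.cat_simps e.left_unit e.right_unit)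
    next
      case False
      have nat: "far (PM G (to_base \<B> g t)) h \<cdot>\<^bsub>fibre \<B> G g t\<^esub>
          PC G (proj \<B> g u t) (to_base \<B> g (face u t)) (Dom W h) =
          PC G (proj \<B> g u t) (to_base \<B> g (face u t)) (Cod W h) \<cdot>\<^bsub>fibre \<B> G g t\<^esub>
          far (PM G (proj \<B> g u t)) (far (PM G (to_base \<B> g (face u t))) h)"
        if t: "t \<in> tuples I (jcod u)" for t
        using G.PC_natural[OF to_base_hom[OF face_in[OF t]] proj_hom[OF t] h] proj_in(4)[OF t]
        by (simp add: fibre_def)
      show ?thesis
        using False h leg_h nat face_in unfolding d[symmetric]
        by (auto simp: cone_simps cover_map_simps W.cat_simps ob_simps)
          (auto simp: leg_simps intro!: restrict_ext)
    qed
  qed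
  show "TC cone (Idt \<J> d) c \<cdot>\<^bsub>PO F d\<^esub> PU F d (fob (TO cone d) c) = Idt (PO F d) (fob (TO cone d) c)"
    if "c \<in> Ob W" for d c
  proof -
    interpret d: category "ob d" by (rule category_ob)
    have "jcod (jid d) = d" by (cases d) simp_all
    then show ?thesis
      using that leg_in by (simp add: cone_simps d.cat_simps)
  qed
  show "TC cone (v \<cdot>\<^bsub>\<J>\<^esub> u) c \<cdot>\<^bsub>PO F k\<^esub> PC F v u (fob (TO cone d) c) =
      TC cone v c \<cdot>\<^bsub>PO F k\<^esub> far (PM F v) (TC cone u c)"
    if u: "u \<in> hom \<J> d e" and v: "v \<in> hom \<J> e k" and "u \<notin> Idt \<J> ` Ob \<J>" "v \<notin> Idt \<J> ` Ob \<J>"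
      and c: "c \<in> Ob W" for u v d e k c
  proof -
    have nid: "u \<notin> range jid" "v \<notin> range jid" using that by simp_all
    have d: "jdom u = d" "jcod u = e" "jdom v = e" "jcod v = k" using u v by (simp_all add: hom_J)
    have vu: "jdom (jcomp v u) = d" "jcod (jcomp v u) = k" "jcomp v u \<notin> range jid"
      using category.Comp_in[OF category_J u v] nid d unfolding range_jid
      by (auto simp: hom_J Comp_J jcomp_def)
    have dvu: "jdom v = jcod u" using d by simp
    \<comment> \<open>This is \<open>G.PC_assoc\<close> for the two projections followed by the map
      to the base, with \<open>face_proj_jcomp\<close> and \<open>proj_in\<close> identifying the
      composites.\<close>
    have comp: "PC G (proj \<B> g (jcomp v u) t) (to_base \<B> g (face (jcomp v u) t)) c \<cdot>\<^bsub>fibre \<B> G g t\<^esub>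
        PC G (proj \<B> g v t) (proj \<B> g u (face v t)) (fob (PM G (to_base \<B> g (face u (face v t)))) c) =
        PC G (proj \<B> g v t) (to_base \<B> g (face v t)) c \<cdot>\<^bsub>fibre \<B> G g t\<^esub>
        far (PM G (proj \<B> g v t)) (PC G (proj \<B> g u (face v t)) (to_base \<B> g (face u (face v t))) c)"
      if t: "t \<in> tuples I k" for t
    proof -
      have t1: "t \<in> tuples I (jcod v)" using t d by simp
      have t2: "face v t \<in> tuples I (jcod u)" using face_in[OF t1] d by simp
      show ?thesis
        using G.PC_assoc[OF to_base_hom[OF face_in[OF t2]] proj_hom[OF t2] proj_hom[OF t1] c]
          face_proj_jcomp[OF t1 dvu nid] proj_in(4)[OF t2]
        by (simp add: fibre_def)
    qed
    have TCu: "TC cone u c \<in> Ar (ob (jdom v))"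
      using hom_Ar[OF conjunct1[OF TC[OF c, of u]]] dvu by simp
    have face: "face v t \<in> tuples I e" "face u (face v t) \<in> tuples I d" if "t \<in> tuples I k" for t
      using that face_in[of t v] face_in[of "face v t" u] d by simp_all
    show ?thesis
      using c nid vu d leg_in[OF c, of d] comp face
      unfolding F_simps cover_map_simps(2)[OF nid(2) TCu]
      by (auto simp: Comp_J cone_simps PC_F ob_simps leg_simps intro!: restrict_ext)
  qed
qed (auto simp: cover_cone_def)

sublocale J_cone F W cone
  using pseudo_cone_cone by (rule J_cone.intro)

section \<open>Cocycles of a cover as descent data\<close>

definition reindex :: "('i list \<Rightarrow> 'o) \<times> ('i list \<Rightarrow> 'm) \<Rightarrow> ('i \<Rightarrow> 'o) \<times> ('i \<times> 'i \<Rightarrow> 'm)" where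
  "reindex x = (\<lambda>i\<in>I. fst x [i], \<lambda>(i, j)\<in>I \<times> I. snd x [i, j])"

definition reindex_fctr where
  "reindex_fctr = \<lparr>fob = (\<lambda>x\<in>Ob (cocycle_cat F). reindex x),
     far = (\<lambda>k\<in>Ar (cocycle_cat F).
       (reindex (fst k), \<lambda>i\<in>I. fst (snd k) [i], reindex (snd (snd k))))\<rparr>"

lemma nid_simps [simp]:
  "F1 \<notin> range jid" "F2 \<notin> range jid" "F12 \<notin> range jid" "F13 \<notin> range jid" "F23 \<notin> range jid"
  by (simp_all add: range_jid)

text \<open>Every ingredient of the restriction in \<open>F(Z)\<close> is a tuple, including the
  inverse coherence cell, which is a tuple of inverses by \<open>iso_ob\<close>.\<close>

lemma restriction_F:
  assumes x: "x \<in> Ob (ob JX)"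
    and \<phi>: "\<phi> \<in> Ar (ob JY)" and v: "v \<in> {F12, F13, F23}" and t: "t \<in> tuples I JZ"
  shows "restriction F v x \<phi> t = restrict_along G (fibre \<B> G g t) (proj \<B> g v t)
    (proj \<B> g F1 (face v t)) (proj \<B> g F2 (face v t)) (x (face F1 (face v t)))
    (x (face F2 (face v t))) (\<phi> (face v t))"
proof -
  have v': "jdom v = JY" "jcod v = JZ" "v \<notin> range jid" using v by (auto simp: range_jid)
  have "PC F v F2 x \<in> extensional (tuples I JZ)"
    using PC_F[of x F2 v] x v' by simp
  moreover have "is_iso (fibre \<B> G g s) (PC F v F2 x s)" if s: "s \<in> tuples I JZ" for s
  proof -
    have "face v s \<in> tuples I JY" using face_in[of s v] s v' by simp
    then have "x (face F2 (face v s)) \<in> Ob (fibre \<B> G g (face F2 (face v s)))"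
      using x face_in[of "face v s" F2] by (simp add: Ob_ob)
    then show ?thesis
      using PC_G_simps(4)[of s v F2 "x (face F2 (face v s))"] PC_F[of x F2 v] x v' s by simp
  qed
  ultimately have inv: "inv_arrow (ob JZ) (PC F v F2 x) t =
      inv_arrow (fibre \<B> G g t) (PC F v F2 x t)"
    using iso_ob(2)[of "PC F v F2 x" JZ] t by simp
  have "restriction F v x \<phi> t = PC F v F1 x t \<cdot>\<^bsub>fibre \<B> G g t\<^esub> far (cover_map \<B> G I g v) \<phi> t
      \<cdot>\<^bsub>fibre \<B> G g t\<^esub> inv_arrow (ob JZ) (PC F v F2 x) t"
    using t by (simp add: restriction_def restrict_along_def ob_simps)
  also have "\<dots> = restrict_along G (fibre \<B> G g t) (proj \<B> g v t)
    (proj \<B> g F1 (face v t)) (proj \<B> g F2 (face v t)) (x (face F1 (face v t)))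
    (x (face F2 (face v t))) (\<phi> (face v t))"
    unfolding inv
    using t x \<phi> v' PC_F[of x F2 v] PC_F[of x F1 v] cover_map_simps(2)[of v \<phi>]
    by (simp add: restrict_along_def)
  finally show ?thesis .
qed

lemma restriction_F_extensional: "restriction F v x \<phi> \<in> extensional (tuples I JZ)"
  by (simp add: restriction_def restrict_along_def ob_simps)

lemma extensional_eq_iff: "\<lbrakk>f \<in> extensional S; h \<in> extensional S\<rbrakk> \<Longrightarrow> f = h \<longleftrightarrow> (\<forall>s\<in>S. f s = h s)"
  by (auto intro: extensionalityI[of _ S])

text \<open>Membership, typing, invertibility and the cocycle equation in a product all split into
  conditions at each tuple. Extensionality supplies the values off the tuples, which
  \<open>reindex\<close> discards.\<close>

lemma reindex_descent_data:
  assumes x: "x \<in> extensional (tuples I JX)" and \<phi>: "\<phi> \<in> extensional (tuples I JY)"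
  shows "reindex (x, \<phi>) \<in> descent_data \<B> G I g \<longleftrightarrow> (x, \<phi>) \<in> cocycle_data F"
proof -
  let ?fib = "fibre \<B> G g"
  have Ob_iff: "x \<in> Ob (ob JX) \<longleftrightarrow> (\<forall>i\<in>I. x [i] \<in> Ob (?fib [i]))"
    using x unfolding Ob_ob tuples_all by blast
  have hom_iff: "\<phi> \<in> hom (ob JY) (fob (cover_map \<B> G I g F2) x) (fob (cover_map \<B> G I g F1) x) \<and>
        is_iso (ob JY) \<phi> \<longleftrightarrow>
      (\<forall>i\<in>I. \<forall>j\<in>I. \<phi> [i, j] \<in> hom (?fib [i, j]) (fob (PM G (pi2 \<B> g i j)) (x [j]))
        (fob (PM G (pi1 \<B> g i j)) (x [i])) \<and> is_iso (?fib [i, j]) (\<phi> [i, j]))" (is "?l \<longleftrightarrow> ?r")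
    if "x \<in> Ob (ob JX)"
  proof -
    have "?l \<longleftrightarrow> (\<forall>t\<in>tuples I JY. \<phi> t \<in> hom (?fib t) (fob (PM G (proj \<B> g F2 t)) (x (face F2 t)))
        (fob (PM G (proj \<B> g F1 t)) (x (face F1 t))) \<and> is_iso (?fib t) (\<phi> t))"
      using that \<phi> iso_ob(1)[OF \<phi>]
        is_iso_prod_cat_component[of "tuples I JY" ?fib \<phi>, folded cover_ob_def]
        cover_map_simps(1)[of F1 x] cover_map_simps(1)[of F2 x]
      by (auto simp: hom_ob)
    then show ?thesis by (simp add: tuples_all)
  qed
  have cocycle_iff: "restriction F F13 x \<phi> = restriction F F12 x \<phi> \<cdot>\<^bsub>ob JZ\<^esub> restriction F F23 x \<phi> \<longleftrightarrow>
      cocycle \<B> G I g (\<lambda>i\<in>I. x [i]) (\<lambda>(i, j)\<in>I \<times> I. \<phi> [i, j])"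
    if x': "x \<in> Ob (ob JX)" and \<phi>': "\<phi> \<in> Ar (ob JY)"
  proof -
    have "restriction F F13 x \<phi> = restriction F F12 x \<phi> \<cdot>\<^bsub>ob JZ\<^esub> restriction F F23 x \<phi> \<longleftrightarrow>
        (\<forall>t\<in>tuples I JZ. restriction F F13 x \<phi> t =
          restriction F F12 x \<phi> t \<cdot>\<^bsub>?fib t\<^esub> restriction F F23 x \<phi> t)"
      by (subst extensional_eq_iff[of _ "tuples I JZ"])
        (simp_all add: restriction_F_extensional ob_simps)
    also have "\<dots> \<longleftrightarrow> cocycle \<B> G I g (\<lambda>i\<in>I. x [i]) (\<lambda>(i, j)\<in>I \<times> I. \<phi> [i, j])"
      unfolding cocycle_def tuples_all Let_def
      by (intro ball_cong refl) (simp add: restriction_F[OF x' \<phi>'])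
    finally show ?thesis .
  qed
  have "(x, \<phi>) \<in> cocycle_data F \<longleftrightarrow> (\<forall>i\<in>I. x [i] \<in> Ob (?fib [i])) \<and>
      (\<forall>i\<in>I. \<forall>j\<in>I. \<phi> [i, j] \<in> hom (?fib [i, j]) (fob (PM G (pi2 \<B> g i j)) (x [j]))
        (fob (PM G (pi1 \<B> g i j)) (x [i])) \<and> is_iso (?fib [i, j]) (\<phi> [i, j])) \<and>
      cocycle \<B> G I g (\<lambda>i\<in>I. x [i]) (\<lambda>(i, j)\<in>I \<times> I. \<phi> [i, j])"
    using Ob_iff hom_iff cocycle_iff hom_Ar[of \<phi> "ob JY"] unfolding cocycle_data_def
    by (auto simp: hom_Ar)
  also have "\<dots> \<longleftrightarrow> reindex (x, \<phi>) \<in> descent_data \<B> G I g"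
    by (auto simp: reindex_def descent_data_def)
  finally show ?thesis by simp
qed

lemma cocycle_data_extensional:
  assumes "(x, \<phi>) \<in> cocycle_data F"
  shows "x \<in> extensional (tuples I JX)" "\<phi> \<in> extensional (tuples I JY)"
  using assms by (auto simp: cocycle_data_def Ob_ob hom_ob)

lemma reindex_descent_arrow:
  assumes x: "(x, \<phi>) \<in> cocycle_data F" and y: "(y, \<psi>) \<in> cocycle_data F"
    and \<xi>: "\<xi> \<in> extensional (tuples I JX)"
  shows "descent_arrow \<B> G I g (reindex (x, \<phi>)) (reindex (y, \<psi>)) (\<lambda>i\<in>I. \<xi> [i]) \<longleftrightarrow>
    cocycle_arrow F (x, \<phi>) (y, \<psi>) \<xi>"
proof -
  let ?fib = "fibre \<B> G g"
  note ext = cocycle_data_extensional[OF x] cocycle_data_extensional[OF y]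
  have hom_iff: "\<xi> \<in> hom (ob JX) x y \<longleftrightarrow> (\<forall>i\<in>I. \<xi> [i] \<in> hom (?fib [i]) (x [i]) (y [i]))"
    unfolding hom_ob tuples_all using \<xi> ext by blast
  have sq_iff: "far (cover_map \<B> G I g F1) \<xi> \<cdot>\<^bsub>ob JY\<^esub> \<phi> = \<psi> \<cdot>\<^bsub>ob JY\<^esub> far (cover_map \<B> G I g F2) \<xi> \<longleftrightarrow>
      (\<forall>i\<in>I. \<forall>j\<in>I. far (PM G (pi1 \<B> g i j)) (\<xi> [i]) \<cdot>\<^bsub>?fib [i, j]\<^esub> \<phi> [i, j] =
        \<psi> [i, j] \<cdot>\<^bsub>?fib [i, j]\<^esub> far (PM G (pi2 \<B> g i j)) (\<xi> [j]))" if "\<xi> \<in> Ar (ob JX)"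
  proof -
    have "far (cover_map \<B> G I g F1) \<xi> \<cdot>\<^bsub>ob JY\<^esub> \<phi> = \<psi> \<cdot>\<^bsub>ob JY\<^esub> far (cover_map \<B> G I g F2) \<xi> \<longleftrightarrow>
      (\<forall>t\<in>tuples I JY. far (PM G (proj \<B> g F1 t)) (\<xi> (face F1 t)) \<cdot>\<^bsub>?fib t\<^esub> \<phi> t =
        \<psi> t \<cdot>\<^bsub>?fib t\<^esub> far (PM G (proj \<B> g F2 t)) (\<xi> (face F2 t)))"
      using that cover_map_simps(2)[of F1 \<xi>] cover_map_simps(2)[of F2 \<xi>]
      by (subst extensional_eq_iff[of _ "tuples I JY"]) (simp_all add: ob_simps)
    then show ?thesis by (simp add: tuples_all)
  qed
  have dx: "reindex (x, \<phi>) \<in> descent_data \<B> G I g" "reindex (y, \<psi>) \<in> descent_data \<B> G I g"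
    using reindex_descent_data ext x y by simp_all
  have "cocycle_arrow F (x, \<phi>) (y, \<psi>) \<xi> \<longleftrightarrow> (\<forall>i\<in>I. \<xi> [i] \<in> hom (?fib [i]) (x [i]) (y [i])) \<and>
      (\<forall>i\<in>I. \<forall>j\<in>I. far (PM G (pi1 \<B> g i j)) (\<xi> [i]) \<cdot>\<^bsub>?fib [i, j]\<^esub> \<phi> [i, j] =
        \<psi> [i, j] \<cdot>\<^bsub>?fib [i, j]\<^esub> far (PM G (pi2 \<B> g i j)) (\<xi> [j]))"
    using x y hom_iff sq_iff hom_Ar[of \<xi> "ob JX" x y] by (auto simp: cocycle_arrow_def)
  also have "\<dots> \<longleftrightarrow> descent_arrow \<B> G I g (reindex (x, \<phi>)) (reindex (y, \<psi>)) (\<lambda>i\<in>I. \<xi> [i])"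
    using dx by (auto simp: descent_arrow_def reindex_def PiE_iff)
  finally show ?thesis by simp
qed

lemma reindex_bij: "bij_betw reindex (cocycle_data F) (descent_data \<B> G I g)"
proof (rule bij_betw_imageI)
  show "inj_on reindex (cocycle_data F)"
  proof (rule inj_onI)
    fix p q assume pq: "p \<in> cocycle_data F" "q \<in> cocycle_data F" "reindex p = reindex q"
    obtain x \<phi> y \<psi> where eq: "p = (x, \<phi>)" "q = (y, \<psi>)" by (metis surj_pair)
    note ext = cocycle_data_extensional[OF pq(1)[unfolded eq]] cocycle_data_extensional[OF pq(2)[unfolded eq]]
    have r: "(\<lambda>i\<in>I. x [i]) = (\<lambda>i\<in>I. y [i])" "(\<lambda>(i, j)\<in>I \<times> I. \<phi> [i, j]) = (\<lambda>(i, j)\<in>I \<times> I. \<psi> [i, j])"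
      using pq(3) by (simp_all add: reindex_def eq)
    have "x [i] = y [i]" if "i \<in> I" for i
      using fun_cong[OF r(1), of i] that by simp
    moreover have "\<phi> [i, j] = \<psi> [i, j]" if "i \<in> I" "j \<in> I" for i j
      using fun_cong[OF r(2), of "(i, j)"] that by simp
    ultimately show "p = q"
      using extensional_eq_iff[OF ext(1,3)] extensional_eq_iff[OF ext(2,4)]
      unfolding eq tuples_all by simp
  qed
  show "reindex ` cocycle_data F = descent_data \<B> G I g"
  proof (intro equalityI subsetI)
    fix d assume "d \<in> reindex ` cocycle_data F"
    then obtain x \<phi> where "d = reindex (x, \<phi>)" and x: "(x, \<phi>) \<in> cocycle_data F" by auto
    then show "d \<in> descent_data \<B> G I g"
      using reindex_descent_data[OF cocycle_data_extensional[OF x]] by simp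
  next
    fix d assume d: "d \<in> descent_data \<B> G I g"
    obtain a \<phi> where a: "d = (a, \<phi>)" by fastforce
    \<comment> \<open>The inverse of reindexing: indices are read off the entries of a list, and
      restriction makes the result extensional.\<close>
    let ?x = "\<lambda>t\<in>tuples I JX. a (t ! 0)" and ?\<psi> = "\<lambda>t\<in>tuples I JY. \<phi> (t ! 0, t ! 1)"
    have "a \<in> extensional I" "\<phi> \<in> extensional (I \<times> I)"
      using d by (auto simp: descent_data_def a PiE_iff)
    then have re: "reindex (?x, ?\<psi>) = d"
      unfolding reindex_def a by (auto simp: restrict_eq_iff)
    have "(?x, ?\<psi>) \<in> cocycle_data F"
      using d reindex_descent_data[OF restrict_extensional restrict_extensional] unfolding re[symmetric]
      by blast
    then show "d \<in> reindex ` cocycle_data F"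
      by (rule rev_image_eqI) (rule re[symmetric])
  qed
qed

text \<open>Reindexing is an isomorphism of categories, so the transport lemma applies; the functor
  property includes that \<open>descent_cat\<close> is a category.\<close>

lemma reindex_fctr_props:
  "is_functor (cocycle_cat F) (descent_cat \<B> G I g) reindex_fctr"
  "fully_faithful (cocycle_cat F) (descent_cat \<B> G I g) reindex_fctr"
  "fob reindex_fctr ` Ob (cocycle_cat F) = Ob (descent_cat \<B> G I g)"
proof -
  interpret cc: category "cocycle_cat F" by (rule category_cocycle_cat)
  have arrE: "\<xi> \<in> extensional (tuples I JX)" "p \<in> cocycle_data F" "q \<in> cocycle_data F"
    if "cocycle_arrow F p q \<xi>" for p q \<xi>
    using that by (cases p; cases q; simp add: cocycle_arrow_def hom_ob)+
  have arr_iff: "descent_arrow \<B> G I g (reindex p) (reindex q) (\<lambda>i\<in>I. \<xi> [i]) \<longleftrightarrow> cocycle_arrow F p q \<xi>"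
    if "p \<in> cocycle_data F" "q \<in> cocycle_data F" "\<xi> \<in> extensional (tuples I JX)" for p q \<xi>
    using that reindex_descent_arrow by (cases p; cases q) simp
  have ob: "bij_betw (fob reindex_fctr) (Ob (cocycle_cat F)) (Ob (descent_cat \<B> G I g))"
  proof -
    have Ob_eq: "Ob (cocycle_cat F) = cocycle_data F" "Ob (descent_cat \<B> G I g) = descent_data \<B> G I g"
      by (simp_all add: cocycle_cat_def descent_cat_def)
    have "bij_betw (fob reindex_fctr) (cocycle_data F) (descent_data \<B> G I g) \<longleftrightarrow>
        bij_betw reindex (cocycle_data F) (descent_data \<B> G I g)"
      by (rule bij_betw_cong) (simp add: reindex_fctr_def Ob_eq)
    then show ?thesis using reindex_bij by (simp add: Ob_eq)
  qed
  then show "fob reindex_fctr ` Ob (cocycle_cat F) = Ob (descent_cat \<B> G I g)"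
    by (simp add: bij_betw_def)
  have far: "far reindex_fctr (p, \<xi>, q) = (reindex p, \<lambda>i\<in>I. \<xi> [i], reindex q)"
    if "(p, \<xi>, q) \<in> Ar (cocycle_cat F)" for p \<xi> q
    using that by (simp add: reindex_fctr_def)
  have ar: "bij_betw (far reindex_fctr) (Ar (cocycle_cat F)) (Ar (descent_cat \<B> G I g))"
  proof (rule bij_betw_imageI)
    show "inj_on (far reindex_fctr) (Ar (cocycle_cat F))"
    proof (rule inj_onI)
      fix k k' assume k: "k \<in> Ar (cocycle_cat F)" "k' \<in> Ar (cocycle_cat F)"
        and eq: "far reindex_fctr k = far reindex_fctr k'"
      obtain p \<xi> q p' \<xi>' q' where k_eq: "k = (p, \<xi>, q)" "k' = (p', \<xi>', q')" by (metis surj_pair)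
      have arr: "cocycle_arrow F p q \<xi>" "cocycle_arrow F p' q' \<xi>'"
        using k by (simp_all add: k_eq cocycle_cat_def)
      have r: "reindex p = reindex p'" "reindex q = reindex q'" "(\<lambda>i\<in>I. \<xi> [i]) = (\<lambda>i\<in>I. \<xi>' [i])"
        using eq k by (simp_all add: reindex_fctr_def k_eq)
      have "\<xi> [i] = \<xi>' [i]" if "i \<in> I" for i
        using fun_cong[OF r(3), of i] that by simp
      then have "\<xi> = \<xi>'"
        using extensional_eq_iff[OF arrE(1)[OF arr(1)] arrE(1)[OF arr(2)]] unfolding tuples_all by simp
      moreover have "p = p'" "q = q'"
        using r(1,2) reindex_bij arrE(2,3)[OF arr(1)] arrE(2,3)[OF arr(2)]
        unfolding bij_betw_def inj_on_def by blast+
      ultimately show "k = k'" by (simp add: k_eq)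
    qed
    show "far reindex_fctr ` Ar (cocycle_cat F) = Ar (descent_cat \<B> G I g)"
    proof (intro equalityI subsetI)
      fix h assume "h \<in> far reindex_fctr ` Ar (cocycle_cat F)"
      then show "h \<in> Ar (descent_cat \<B> G I g)"
        by (auto simp: reindex_fctr_def cocycle_cat_def descent_cat_def arr_iff[OF arrE(2,3,1)])
    next
      fix h assume "h \<in> Ar (descent_cat \<B> G I g)"
      then obtain P \<zeta> Q where h: "h = (P, \<zeta>, Q)" "descent_arrow \<B> G I g P Q \<zeta>"
        by (auto simp: descent_cat_def)
      then have "P \<in> descent_data \<B> G I g" "Q \<in> descent_data \<B> G I g" and \<zeta>: "\<zeta> \<in> extensional I"
        by (auto simp: descent_arrow_def PiE_iff split: prod.splits)
      then obtain p q where pq: "p \<in> cocycle_data F" "q \<in> cocycle_data F" "P = reindex p" "Q = reindex q"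
        using reindex_bij unfolding bij_betw_def by blast
      let ?\<xi> = "\<lambda>t\<in>tuples I JX. \<zeta> (t ! 0)"
      have re: "(\<lambda>i\<in>I. ?\<xi> [i]) = \<zeta>" using \<zeta> by (simp add: restrict_eq_iff)
      have "descent_arrow \<B> G I g (reindex p) (reindex q) (\<lambda>i\<in>I. ?\<xi> [i])"
        using h(2) unfolding re pq(3,4) .
      then have "cocycle_arrow F p q ?\<xi>"
        using arr_iff[OF pq(1,2) restrict_extensional] by blast
      then have k: "(p, ?\<xi>, q) \<in> Ar (cocycle_cat F)" by (simp add: cocycle_cat_def)
      show "h \<in> far reindex_fctr ` Ar (cocycle_cat F)"
        by (rule rev_image_eqI[OF k]) (simp only: far[OF k] re h(1) pq(3,4))
    qed
  qed
  have fob: "fob reindex_fctr p = reindex p" if "p \<in> cocycle_data F" for p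
    using that by (simp add: reindex_fctr_def cocycle_cat_def)
  have Dom: "Dom (descent_cat \<B> G I g) (far reindex_fctr k) = fob reindex_fctr (Dom (cocycle_cat F) k)"
    and Cod: "Cod (descent_cat \<B> G I g) (far reindex_fctr k) = fob reindex_fctr (Cod (cocycle_cat F) k)"
    if "k \<in> Ar (cocycle_cat F)" for k
  proof -
    obtain p \<xi> q where k: "k = (p, \<xi>, q)" by (metis surj_pair)
    have "cocycle_arrow F p q \<xi>" using that by (simp add: k cocycle_cat_def)
    note arrE(2,3)[OF this]
    then show "Dom (descent_cat \<B> G I g) (far reindex_fctr k) = fob reindex_fctr (Dom (cocycle_cat F) k)"
      "Cod (descent_cat \<B> G I g) (far reindex_fctr k) = fob reindex_fctr (Cod (cocycle_cat F) k)"
      using far[OF that[unfolded k]] fob by (simp_all add: k) (simp_all add: cocycle_cat_def descent_cat_def)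
  qed
  have Idt: "Idt (descent_cat \<B> G I g) (fob reindex_fctr p) = far reindex_fctr (Idt (cocycle_cat F) p)"
    if "p \<in> Ob (cocycle_cat F)" for p
  proof -
    have "Idt (cocycle_cat F) p = (p, Idt (ob JX) (fst p), p)" by (simp add: cocycle_cat_def)
    then show ?thesis
      using that cc.Ar_Idt[OF that] far[of p "Idt (ob JX) (fst p)" p]
      by (auto simp: fob cocycle_cat_def descent_cat_def ob_simps reindex_def intro!: restrict_ext)
  qed
  have Comp: "far reindex_fctr h \<cdot>\<^bsub>descent_cat \<B> G I g\<^esub> far reindex_fctr k =
      far reindex_fctr (h \<cdot>\<^bsub>cocycle_cat F\<^esub> k)"
    if k: "k \<in> Ar (cocycle_cat F)" and h: "h \<in> Ar (cocycle_cat F)"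
      and hk: "Dom (cocycle_cat F) h = Cod (cocycle_cat F) k" for h k
  proof -
    obtain p \<xi> q \<zeta> r where eq: "k = (p, \<xi>, q)" "h = (q, \<zeta>, r)"
      using hk by (cases h; cases k) (simp add: cocycle_cat_def)
    have "h \<cdot>\<^bsub>cocycle_cat F\<^esub> k = (p, \<zeta> \<cdot>\<^bsub>ob JX\<^esub> \<xi>, r)" by (simp add: eq cocycle_cat_def)
    then show ?thesis
      using cc.Ar_Comp[OF k h hk] k h far[of p "\<zeta> \<cdot>\<^bsub>ob JX\<^esub> \<xi>" r] far[of p \<xi> q] far[of q \<zeta> r]
      by (auto simp: eq descent_cat_def ob_simps intro!: restrict_ext)
  qed
  have ext: "fob reindex_fctr \<in> extensional (Ob (cocycle_cat F))"
    "far reindex_fctr \<in> extensional (Ar (cocycle_cat F))"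
    by (simp_all add: reindex_fctr_def)
  show "is_functor (cocycle_cat F) (descent_cat \<B> G I g) reindex_fctr"
    by (rule category_isomorphism(1)[OF category_cocycle_cat ext ob ar])
      (erule Dom Cod Idt | rule Comp; assumption)+
  show "fully_faithful (cocycle_cat F) (descent_cat \<B> G I g) reindex_fctr"
    by (rule category_isomorphism(2)[OF category_cocycle_cat ext ob ar])
      (erule Dom Cod Idt | rule Comp; assumption)+
qed

text \<open>The two functors are equal as records: their maps are restricted to \<open>W\<close>,
  and the cocycle of the pseudo cone at \<open>a\<close> reindexes to the canonical descent datum,
  because inverses in \<open>F(Y)\<close> are taken at each pair.\<close>

lemma descent_functor_eq:
  "descent_functor \<B> G b I g = comp_fctr W reindex_fctr (cocycle_functor F W cone)"
proof -
  have cc: "reindex (cone_cocycle F cone a) = canonical_descent \<B> G I g a" if a: "a \<in> Ob W" for a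
  proof -
    have "TC cone F1 a \<in> extensional (tuples I JY)" "\<And>t. t \<in> tuples I JY \<Longrightarrow> is_iso (fibre \<B> G g t) (TC cone F1 a t)"
      using PC_leg_simps(4)[of _ F1 a] a by (simp_all add: cone_simps)
    then have inv: "inv_arrow (ob JY) (TC cone F1 a) =
        (\<lambda>t\<in>tuples I JY. inv_arrow (fibre \<B> G g t) (TC cone F1 a t))"
      by (rule iso_ob(2))
    have "snd (cone_cocycle F cone a) [i, j] = inv_arrow (fibre \<B> G g [i, j]) (PC G (pi1 \<B> g i j) (g i) a)
        \<cdot>\<^bsub>fibre \<B> G g [i, j]\<^esub> PC G (pi2 \<B> g i j) (g j) a" if "i \<in> I" "j \<in> I" for i j
    proof -
      have "snd (cone_cocycle F cone a) [i, j] =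
          inv_arrow (ob JY) (TC cone F1 a) [i, j] \<cdot>\<^bsub>fibre \<B> G g [i, j]\<^esub> TC cone F2 a [i, j]"
        using that by (simp add: cone_cocycle_def ob_simps)
      also have "\<dots> = inv_arrow (fibre \<B> G g [i, j]) (PC G (pi1 \<B> g i j) (g i) a)
          \<cdot>\<^bsub>fibre \<B> G g [i, j]\<^esub> PC G (pi2 \<B> g i j) (g j) a"
        unfolding inv using that a by (simp add: cone_simps)
      finally show ?thesis .
    qed
    moreover have "fst (cone_cocycle F cone a) [i] = fob (PM G (g i)) a" if "i \<in> I" for i
      using that a by (simp add: cone_cocycle_def cone_simps leg_simps)
    ultimately show ?thesis
      by (auto simp: reindex_def canonical_descent_def intro!: restrict_ext)
  qed
  have ob: "fob reindex_fctr (fob (cocycle_functor F W cone) a) = canonical_descent \<B> G I g a"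
    if a: "a \<in> Ob W" for a
  proof -
    have "cone_cocycle F cone a \<in> Ob (cocycle_cat F)"
      using cone_cocycle_in[OF a] by (simp add: cocycle_cat_def)
    then show ?thesis
      by (simp add: fob_cocycle_functor[OF a] reindex_fctr_def cc[OF a])
  qed
  have ar: "far reindex_fctr (far (cocycle_functor F W cone) f) =
      (canonical_descent \<B> G I g (Dom W f), \<lambda>i\<in>I. far (PM G (g i)) f,
       canonical_descent \<B> G I g (Cod W f))" if f: "f \<in> Ar W" for f
  proof -
    have "(cone_cocycle F cone (Dom W f), far (leg JX) f, cone_cocycle F cone (Cod W f))
        \<in> Ar (cocycle_cat F)"
      using functor_far[OF is_functor_cocycle_functor f] by (simp add: far_cocycle_functor[OF f] cone_simps)
    moreover have "(\<lambda>i\<in>I. far (leg JX) f [i]) = (\<lambda>i\<in>I. far (PM G (g i)) f)"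
      by (rule restrict_ext) (simp add: leg_simps f)
    ultimately show ?thesis
      by (simp add: far_cocycle_functor[OF f] reindex_fctr_def cone_simps(1) cc C.Dom_in[OF f] C.Cod_in[OF f])
  qed
  show ?thesis
    unfolding descent_functor_def comp_fctr_def
    by (simp add: ob ar cong: restrict_cong)
qed

theorem bilimit_iff_descent:
  "is_bilimit TYPE(('oc, 'mc) cat) \<J> F W cone \<longleftrightarrow>
    is_equivalence W (descent_cat \<B> G I g) (descent_functor \<B> G b I g)"
  unfolding is_bilimit_iff descent_functor_eq
  using equivalence_comp_isomorphism_iff[OF reindex_fctr_props is_functor_cocycle_functor] by simp

end

theorem theorem12p6:
  fixes \<B> :: "('b, 'f) cat"
    and K :: "'b \<Rightarrow> ('i set \<times> ('i \<Rightarrow> 'f)) set"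
    and G :: "('b, 'f, 'o, 'm) pfctr"
  assumes "grothendieck_topology \<B> K"
    and "contravariant_pseudo_functor \<B> G"
  shows "stack TYPE(('oc, 'mc) cat) \<B> K G \<longleftrightarrow> giraud_stack \<B> K G"
proof -
  interpret grothendieck_topology \<B> K by fact
  have G: "pseudo_functor (dual \<B>) G"
    using assms(2) by (simp add: contravariant_pseudo_functor_def)
  have "is_bilimit TYPE(('oc, 'mc) cat) \<J> (cover_pf \<B> G I g) (PO G b) (cover_cone \<B> G b I g) \<longleftrightarrow>
      is_equivalence (PO G b) (descent_cat \<B> G I g) (descent_functor \<B> G b I g)"
    if b: "b \<in> Ob \<B>" and K: "(I, g) \<in> K b" for b I g
  proof -
    \<comment> \<open>Membership in \<open>K b\<close> is turned into a family of arrows over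
      \<open>b\<close>, the form that the locale of a single cover expects.\<close>
    have "g i \<in> Ar \<B>" "Cod \<B> (g i) = b" if "i \<in> I" for i
      using cover_family[OF b K] that by auto
    then interpret cover \<B> b I g G
      using b pullbacks G category_axioms
      by (intro cover.intro base_cover.intro base_cover_axioms.intro cover_axioms.intro)
    show ?thesis by (rule bilimit_iff_descent)
  qed
  then show ?thesis
    unfolding stack_def giraud_stack_def by (intro ball_cong refl) auto
qed

end
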